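(* Let $d\ge 1$ be an integer and let $(X,T)$ be a system of order $d$. Then its enveloping semigroup $E(X)$ is a $d$-step topologically nilpotent group, and thus it is a $d$-step nilpotent group.
   Context: A topological dynamical system $(X,T)$ is a compact metric space $X$ with a homeomorphism $T\colon X\to X$; it is minimal if every orbit $\{T^nx:n\in\mathbb{Z}\}$ is dense in $X$. Nilsystems: let $G$ be a $d$-step nilpotent Lie group, $\Gamma$ a discrete cocompact subgroup of $G$, and $\tau\in G$; the system $(G/\Gamma,T)$ with $T$ the left translation $x\mapsto \tau x$ is called a $d$-step nilsystem. A system of order $d$ is a minimal topological dynamical system which is either a $d$-step nilsystem or an inverse limit of $d$-step nilsystems. The enveloping semigroup $E(X)$ is the closure of $\{T^n:n\in\mathbb{Z}\}$ in $X^X$ with the product (pointwise convergence) topology; it is a semigroup under composition and carries the subspace topology. Nilpotency: $[g,h]=ghg^{-1}h^{-1}$. For a group $G$ and $A,B\subseteq G$, $[A,B]$ is the subgroup generated by $\{[a,b]:a\in A,b\in B\}$; $G_1=G$, $G_{j+1}=[G_j,G]$; $G$ is $d$-step nilpotent if $G_{d+1}$ is trivial. For a group $G$ that is also a topological space (no continuity of the operations assumed), $[A,B]_{\mathrm{top}}$ is the closed subgroup spanned by $\{[a,b]:a\in A,b\in B\}$, i.e. the smallest closed subgroup containing these commutators; $G_1^{\mathrm{top}}=G$, $G_{j+1}^{\mathrm{top}}=[G_j^{\mathrm{top}},G]_{\mathrm{top}}$; $G$ is $d$-step topologically nilpotent if $G_{d+1}^{\mathrm{top}}$ is trivial. *)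

theory Defs
  imports "HOL-Analysis.Analysis" "HOL-Algebra.Coset" "HOL-Algebra.Generated_Groups"
begin

section \<open>Smooth manifolds and Lie groups\<close>

text \<open>
  Since the members of an inverse system of nilsystems may have different dimensions, the model
  space is \<^const>\<open>Euclidean_space\<close> \<open>n\<close> (sequences vanishing from index \<open>n\<close> on) rather than a
  type of dimension \<open>n\<close>. A function on an open subset of it is of class \<open>C\<^sup>k\<close> if all its partial
  derivatives up to order \<open>k\<close> exist and are continuous.
\<close>

primrec C_k_on :: "nat \<Rightarrow> nat \<Rightarrow> (nat \<Rightarrow> real) set \<Rightarrow> ((nat \<Rightarrow> real) \<Rightarrow> real) \<Rightarrow> bool" where
  "C_k_on n 0 S f \<longleftrightarrow> continuous_map (subtopology (Euclidean_space n) S) euclideanreal f"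
| "C_k_on n (Suc k) S f \<longleftrightarrow>
     continuous_map (subtopology (Euclidean_space n) S) euclideanreal f \<and>
     (\<forall>i<n. \<exists>g. (\<forall>x\<in>S. ((\<lambda>t. f (x(i := t))) has_real_derivative g x) (at (x i))) \<and>
                C_k_on n k S g)"

definition smooth_on ::
  "nat \<Rightarrow> nat \<Rightarrow> (nat \<Rightarrow> real) set \<Rightarrow> ((nat \<Rightarrow> real) \<Rightarrow> (nat \<Rightarrow> real)) \<Rightarrow> bool" where
  "smooth_on n m S f \<longleftrightarrow> (\<forall>j<m. \<forall>k. C_k_on n k S (\<lambda>x. f x j))"

record 'a charted_space =
  mtop :: "'a topology"
  mdim :: nat
  atlas :: "('a set \<times> ('a \<Rightarrow> nat \<Rightarrow> real)) set"

definition smooth_manifold :: "'a charted_space \<Rightarrow> bool" where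
  "smooth_manifold M \<longleftrightarrow>
     Hausdorff_space (mtop M) \<and> second_countable (mtop M) \<and>
     (\<Union>(U, \<phi>)\<in>atlas M. U) = topspace (mtop M) \<and>
     (\<forall>(U, \<phi>)\<in>atlas M.
        openin (mtop M) U \<and> openin (Euclidean_space (mdim M)) (\<phi> ` U) \<and>
        homeomorphic_map (subtopology (mtop M) U)
          (subtopology (Euclidean_space (mdim M)) (\<phi> ` U)) \<phi>) \<and>
     (\<forall>(U, \<phi>)\<in>atlas M. \<forall>(V, \<psi>)\<in>atlas M.
        smooth_on (mdim M) (mdim M) (\<phi> ` (U \<inter> V)) (\<psi> \<circ> inv_into U \<phi>))"

definition smooth_map :: "'a charted_space \<Rightarrow> 'b charted_space \<Rightarrow> ('a \<Rightarrow> 'b) \<Rightarrow> bool" where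
  "smooth_map M N f \<longleftrightarrow>
     continuous_map (mtop M) (mtop N) f \<and>
     (\<forall>(U, \<phi>)\<in>atlas M. \<forall>(V, \<psi>)\<in>atlas N.
        smooth_on (mdim M) (mdim N) (\<phi> ` (U \<inter> f -` V)) (\<psi> \<circ> f \<circ> inv_into U \<phi>))"

definition prod_charted ::
  "'a charted_space \<Rightarrow> 'b charted_space \<Rightarrow> ('a \<times> 'b) charted_space" where
  "prod_charted M N =
     \<lparr> mtop = prod_topology (mtop M) (mtop N),
       mdim = mdim M + mdim N,
       atlas = {(U \<times> V, \<lambda>(x, y) i. if i < mdim M then \<phi> x i else \<psi> y (i - mdim M)) |
                U \<phi> V \<psi>. (U, \<phi>) \<in> atlas M \<and> (V, \<psi>) \<in> atlas N} \<rparr>"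

definition lie_group :: "'g monoid \<Rightarrow> 'g charted_space \<Rightarrow> bool" where
  "lie_group G M \<longleftrightarrow>
     group G \<and> smooth_manifold M \<and> topspace (mtop M) = carrier G \<and>
     smooth_map (prod_charted M M) M (\<lambda>(x, y). x \<otimes>\<^bsub>G\<^esub> y) \<and>
     smooth_map M M (\<lambda>x. inv\<^bsub>G\<^esub> x)"


section \<open>Nilpotency and topological nilpotency\<close>

definition commutators :: "'g monoid \<Rightarrow> 'g set \<Rightarrow> 'g set \<Rightarrow> 'g set" where
  "commutators G A B =
     {a \<otimes>\<^bsub>G\<^esub> b \<otimes>\<^bsub>G\<^esub> inv\<^bsub>G\<^esub> a \<otimes>\<^bsub>G\<^esub> inv\<^bsub>G\<^esub> b | a b. a \<in> A \<and> b \<in> B}"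

text \<open>Indices are shifted by one: \<open>lower_central G j\<close> is \<open>G\<^sub>j\<^sub>+\<^sub>1\<close>, and likewise below.\<close>

primrec lower_central :: "'g monoid \<Rightarrow> nat \<Rightarrow> 'g set" where
  "lower_central G 0 = carrier G"
| "lower_central G (Suc j) = generate G (commutators G (lower_central G j) (carrier G))"

definition nilpotent_group :: "nat \<Rightarrow> 'g monoid \<Rightarrow> bool" where
  "nilpotent_group d G \<longleftrightarrow> group G \<and> lower_central G d = {\<one>\<^bsub>G\<^esub>}"

definition closed_generate :: "'g monoid \<Rightarrow> 'g topology \<Rightarrow> 'g set \<Rightarrow> 'g set" where
  "closed_generate G M C = \<Inter>{H. subgroup H G \<and> closedin M H \<and> C \<subseteq> H}"

primrec top_lower_central :: "'g monoid \<Rightarrow> 'g topology \<Rightarrow> nat \<Rightarrow> 'g set" where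
  "top_lower_central G M 0 = carrier G"
| "top_lower_central G M (Suc j) =
     closed_generate G M (commutators G (top_lower_central G M j) (carrier G))"

definition top_nilpotent_group :: "nat \<Rightarrow> 'g monoid \<Rightarrow> 'g topology \<Rightarrow> bool" where
  "top_nilpotent_group d G M \<longleftrightarrow>
     group G \<and> topspace M = carrier G \<and> top_lower_central G M d = {\<one>\<^bsub>G\<^esub>}"


section \<open>Systems, nilsystems and inverse limits\<close>

text \<open>
  The abstract systems \<open>(X, T)\<close> below are given by a topology \<open>X\<close> and a map \<open>T\<close> that matters
  only on \<open>topspace X\<close>.
\<close>

definition conjugate_systems ::
  "'x topology \<Rightarrow> ('x \<Rightarrow> 'x) \<Rightarrow> 'y topology \<Rightarrow> ('y \<Rightarrow> 'y) \<Rightarrow> bool" where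
  "conjugate_systems X T Y S \<longleftrightarrow>
     (\<exists>h. homeomorphic_map X Y h \<and> (\<forall>x\<in>topspace X. h (T x) = S (h x)))"

definition factor_map ::
  "'x topology \<Rightarrow> ('x \<Rightarrow> 'x) \<Rightarrow> 'y topology \<Rightarrow> ('y \<Rightarrow> 'y) \<Rightarrow> ('x \<Rightarrow> 'y) \<Rightarrow> bool" where
  "factor_map X T Y S p \<longleftrightarrow>
     continuous_map X Y p \<and> p ` topspace X = topspace Y \<and>
     (\<forall>x\<in>topspace X. p (T x) = S (p x))"

definition inverse_limit_space ::
  "(nat \<Rightarrow> 'y topology) \<Rightarrow> (nat \<Rightarrow> 'y \<Rightarrow> 'y) \<Rightarrow> (nat \<Rightarrow> 'y) topology" where
  "inverse_limit_space Y p =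
     subtopology (product_topology Y UNIV) {x. \<forall>i. p i (x (Suc i)) = x i}"

definition left_coset_space :: "'g monoid \<Rightarrow> 'g topology \<Rightarrow> 'g set \<Rightarrow> 'g set topology" where
  "left_coset_space G M \<Gamma> =
     topology (\<lambda>\<U>. \<U> \<subseteq> (\<lambda>g. g <#\<^bsub>G\<^esub> \<Gamma>) ` carrier G \<and>
                   openin M {g \<in> carrier G. g <#\<^bsub>G\<^esub> \<Gamma> \<in> \<U>})"

lemma openin_left_coset_space:
  assumes "topspace M = carrier G"
  shows "openin (left_coset_space G M \<Gamma>) \<U> \<longleftrightarrow>
     \<U> \<subseteq> (\<lambda>g. g <#\<^bsub>G\<^esub> \<Gamma>) ` carrier G \<and> openin M {g \<in> carrier G. g <#\<^bsub>G\<^esub> \<Gamma> \<in> \<U>}"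
proof -
  let ?P = "\<lambda>\<U>. \<U> \<subseteq> (\<lambda>g. g <#\<^bsub>G\<^esub> \<Gamma>) ` carrier G \<and> openin M {g \<in> carrier G. g <#\<^bsub>G\<^esub> \<Gamma> \<in> \<U>}"
  have "istopology ?P"
    unfolding istopology_def
  proof (intro conjI allI impI)
    fix A B assume A: "?P A" and B: "?P B"
    have "{g \<in> carrier G. g <#\<^bsub>G\<^esub> \<Gamma> \<in> A \<inter> B} =
        {g \<in> carrier G. g <#\<^bsub>G\<^esub> \<Gamma> \<in> A} \<inter> {g \<in> carrier G. g <#\<^bsub>G\<^esub> \<Gamma> \<in> B}"
      by blast
    then show "openin M {g \<in> carrier G. g <#\<^bsub>G\<^esub> \<Gamma> \<in> A \<inter> B}"
      using A B by (simp add: openin_Int)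
    show "A \<inter> B \<subseteq> (\<lambda>g. g <#\<^bsub>G\<^esub> \<Gamma>) ` carrier G"
      using A by blast
  next
    fix K assume K: "\<forall>A\<in>K. ?P A"
    have "{g \<in> carrier G. g <#\<^bsub>G\<^esub> \<Gamma> \<in> \<Union>K} = (\<Union>A\<in>K. {g \<in> carrier G. g <#\<^bsub>G\<^esub> \<Gamma> \<in> A})"
      by blast
    then show "openin M {g \<in> carrier G. g <#\<^bsub>G\<^esub> \<Gamma> \<in> \<Union>K}"
      using K by (metis (no_types, lifting) imageE openin_Union)
    show "\<Union>K \<subseteq> (\<lambda>g. g <#\<^bsub>G\<^esub> \<Gamma>) ` carrier G"
      using K by blast
  qed
  then show ?thesis
    unfolding left_coset_space_def by (simp add: topology_inverse')
qed

lemma quotient_map_left_coset_space: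
  assumes "topspace M = carrier G"
  shows "quotient_map M (left_coset_space G M \<Gamma>) (\<lambda>g. g <#\<^bsub>G\<^esub> \<Gamma>)"
proof -
  have "openin (left_coset_space G M \<Gamma>) ((\<lambda>g. g <#\<^bsub>G\<^esub> \<Gamma>) ` carrier G)"
  proof -
    have "{g \<in> carrier G. g <#\<^bsub>G\<^esub> \<Gamma> \<in> (\<lambda>g. g <#\<^bsub>G\<^esub> \<Gamma>) ` carrier G} = topspace M"
      using assms by blast
    then show ?thesis
      unfolding openin_left_coset_space[OF assms] by simp
  qed
  then have "topspace (left_coset_space G M \<Gamma>) = (\<lambda>g. g <#\<^bsub>G\<^esub> \<Gamma>) ` carrier G"
    by (metis openin_left_coset_space[OF assms] openin_subset openin_topspace subset_antisym)
  then show ?thesis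
    by (auto simp: quotient_map_def openin_left_coset_space assms)
qed

text \<open>
  The argument \<open>TYPE('g)\<close> is the type on which the groups are carried; a statement that is
  polymorphic in \<open>'g\<close> speaks about arbitrary groups. Being a nilsystem, or an inverse limit of
  nilsystems, is understood up to conjugacy.
\<close>

definition nilsystem :: "'g itself \<Rightarrow> nat \<Rightarrow> 'x topology \<Rightarrow> ('x \<Rightarrow> 'x) \<Rightarrow> bool" where
  "nilsystem _ d X T \<longleftrightarrow>
     (\<exists>(G :: 'g monoid) M \<Gamma> \<tau>.
        lie_group G M \<and> nilpotent_group d G \<and>
        subgroup \<Gamma> G \<and> subtopology (mtop M) \<Gamma> = discrete_topology \<Gamma> \<and>
        compact_space (left_coset_space G (mtop M) \<Gamma>) \<and>
        \<tau> \<in> carrier G \<and>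
        conjugate_systems X T (left_coset_space G (mtop M) \<Gamma>) (\<lambda>x. \<tau> <#\<^bsub>G\<^esub> x))"

definition inverse_limit_of_nilsystems ::
  "'g itself \<Rightarrow> nat \<Rightarrow> 'x topology \<Rightarrow> ('x \<Rightarrow> 'x) \<Rightarrow> bool" where
  "inverse_limit_of_nilsystems _ d X T \<longleftrightarrow>
     (\<exists>(Y :: nat \<Rightarrow> 'g set topology) S p.
        (\<forall>i. nilsystem TYPE('g) d (Y i) (S i)) \<and>
        (\<forall>i. factor_map (Y (Suc i)) (S (Suc i)) (Y i) (S i) (p i)) \<and>
        conjugate_systems X T (inverse_limit_space Y p) (\<lambda>x i. S i (x i)))"

text \<open>Here \<open>inv_into UNIV T\<close> is the inverse map; \<open>inv\<close> would clash with group inverses.\<close>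

definition topological_dynamical_system :: "('a::metric_space \<Rightarrow> 'a) \<Rightarrow> bool" where
  "topological_dynamical_system T \<longleftrightarrow>
     compact (UNIV :: 'a set) \<and> homeomorphism UNIV UNIV T (inv_into UNIV T)"

definition int_iterate :: "('a \<Rightarrow> 'a) \<Rightarrow> int \<Rightarrow> 'a \<Rightarrow> 'a" where
  "int_iterate T n = (if 0 \<le> n then T ^^ nat n else inv_into UNIV T ^^ nat (- n))"

definition minimal_system :: "('a::metric_space \<Rightarrow> 'a) \<Rightarrow> bool" where
  "minimal_system T \<longleftrightarrow>
     topological_dynamical_system T \<and> (\<forall>x. closure (range (\<lambda>n. int_iterate T n x)) = UNIV)"

definition system_of_order :: "'g itself \<Rightarrow> nat \<Rightarrow> ('a::metric_space \<Rightarrow> 'a) \<Rightarrow> bool" where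
  "system_of_order _ d T \<longleftrightarrow>
     minimal_system T \<and>
     (nilsystem TYPE('g) d euclidean T \<or> inverse_limit_of_nilsystems TYPE('g) d euclidean T)"


section \<open>The enveloping semigroup\<close>

text \<open>The topology on the function type is that of pointwise convergence.\<close>

definition enveloping_semigroup :: "('a::topological_space \<Rightarrow> 'a) \<Rightarrow> ('a \<Rightarrow> 'a) set" where
  "enveloping_semigroup T = closure (range (int_iterate T))"

definition enveloping_monoid :: "('a::topological_space \<Rightarrow> 'a) \<Rightarrow> ('a \<Rightarrow> 'a) monoid" where
  "enveloping_monoid T = \<lparr> carrier = enveloping_semigroup T, mult = (\<circ>), one = id \<rparr>"

definition enveloping_topology :: "('a::topological_space \<Rightarrow> 'a) \<Rightarrow> ('a \<Rightarrow> 'a) topology" where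
  "enveloping_topology T = top_of_set (enveloping_semigroup T)"

end

theory Submission
  imports Defs
begin

text \<open>
  Index the vertices of a cube by boolean lists and let \<open>Q\<close> (\<open>dynamical_cubes\<close>) be the closure of
  the set of points \<open>\<epsilon> \<mapsto> T\<^sup>a\<^sup>\<cdot>\<^sup>\<epsilon> x\<close>. If \<open>u\<close> is in the enveloping semigroup \<open>E\<close>, then applying \<open>u\<close> to the
  coordinates in a facet maps \<open>Q\<close> to itself: this is clear for \<open>u = T\<^sup>n\<close> and survives pointwise
  limits. If \<open>a\<close> acts in this way on a face \<open>A\<close> and \<open>b\<close> on a face \<open>B\<close>, then \<open>[a, b]\<close> acts on
  \<open>A \<inter> B\<close> (\<open>commutator_stabilizer\<close>). Acting on a given face is a closed condition, so the closed lower
  central series of \<open>E\<close> acts on faces of increasing codimension, and its \<open>(d+1)\<close>-st term acts on a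
  single vertex of a cube of dimension \<open>d + 1\<close>. An element \<open>u\<close> of that term thus turns the constant
  cube \<open>x\<close> into a point of \<open>Q\<close> that equals \<open>x\<close> except for one vertex, where it is \<open>u x\<close>. Everything
  follows once such points are known to be constant (\<open>cube_rigid_system\<close>): then \<open>u = id\<close>.
  The same rigidity shows that \<open>id\<close> is the only idempotent of \<open>E\<close>, and by the Ellis--Numakura lemma
  \<open>E\<close> and each of its closed subsemigroups that contains \<open>id\<close> is then a group.

  Rigidity can be tested on a family of factors that separates points, which reduces inverse limits to
  nilsystems \<open>G/\<Gamma>\<close>. There, \<open>\<epsilon> \<mapsto> \<tau>\<^sup>a\<^sup>\<cdot>\<^sup>\<epsilon> g\<close> is a Host--Kra cube in \<open>G\<close>, and the claim becomes
  that a cube whose vertices but one are near \<open>\<Gamma>\<close> has its last vertex near \<open>\<Gamma>\<close> as well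
  (\<open>last_vertex_near_lattice\<close>). If \<open>G = B\<^sub>0 = B\<^sub>1 \<supseteq> B\<^sub>2 \<supseteq> \<dots>\<close> is a filtration such that \<open>\<Gamma>\<close> is discrete
  modulo each \<open>B\<^sub>j\<close>, then a cube near \<open>\<Gamma>\<close> is a small cube times a cube with values in \<open>\<Gamma>\<close>
  (\<open>cube_factorization\<close>), and because \<open>B\<^sub>d\<^sub>+\<^sub>1\<close> is trivial the last vertex of a cube of dimension
  \<open>d + 1\<close> is determined by the others.

  The heart of the proof is the choice of the filtration. For the lower central series discreteness
  is Mal'cev's theory of nilpotent lattices. For the upper central series \<open>Z\<^sub>m\<close> it is elementary
  (\<open>exists_lattice_mod_central\<close>): an element of \<open>\<Gamma>\<close> near \<open>Z\<^sub>m\<^sub>+\<^sub>1\<close> has commutators near \<open>Z\<^sub>m\<close> with the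
  finitely many generators of \<open>\<Gamma>\<close>, by induction these belong to \<open>Z\<^sub>m\<close>, and compactness of \<open>G/\<Gamma>\<close>
  extends this from \<open>\<Gamma>\<close> to \<open>G\<close>, because a Lie group has no small subgroups and so a homomorphism
  with values in a small neighbourhood is trivial. The upper central series is not indexed like a
  filtration, but \<open>B\<^sub>j = {g. [g, Z\<^sub>k] \<subseteq> Z\<^sub>k\<^sub>-\<^sub>j for all k}\<close>, made trivial for \<open>j > d\<close>, is one by
  the Hall--Witt identity (\<open>lowering\<close>, \<open>central_filtration\<close>), and it inherits discreteness from the \<open>Z\<^sub>k\<close> (\<open>exists_lattice_mod_lowering\<close>).

  Two finiteness properties are needed on the way. The groups \<open>\<Gamma> \<inter> Z\<^sub>k\<close> have to be finitely generated,
  which holds because finitely generated nilpotent groups are Noetherian; and \<open>\<Gamma>\<close> itself becomes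
  finitely generated after passing to the open subgroup generated by a compact set that contains
  \<open>\<tau>\<close>, a neighbourhood of the identity, and representatives of \<open>G/\<Gamma>\<close>.
\<close>

section \<open>Commutator calculus and the upper central series\<close>

context group
begin

definition commutator :: "'a \<Rightarrow> 'a \<Rightarrow> 'a" where
  "commutator a b = a \<otimes> b \<otimes> inv a \<otimes> inv b"

lemma cancel_inv_left [simp]:
  "x \<in> carrier G \<Longrightarrow> y \<in> carrier G \<Longrightarrow> inv x \<otimes> (x \<otimes> y) = y"
  by (simp flip: m_assoc)

lemma cancel_left_inv [simp]:
  "x \<in> carrier G \<Longrightarrow> y \<in> carrier G \<Longrightarrow> x \<otimes> (inv x \<otimes> y) = y"
  by (simp flip: m_assoc)

lemmas free_group_simps = m_assoc inv_mult_group

lemma commutator_closed [simp, intro]: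
  "a \<in> carrier G \<Longrightarrow> b \<in> carrier G \<Longrightarrow> commutator a b \<in> carrier G"
  by (simp add: commutator_def)

lemma inv_commutator:
  "a \<in> carrier G \<Longrightarrow> b \<in> carrier G \<Longrightarrow> inv (commutator a b) = commutator b a"
  by (simp add: commutator_def free_group_simps)

lemma commutator_mult_left:
  assumes "x \<in> carrier G" "y \<in> carrier G" "z \<in> carrier G"
  shows "commutator (x \<otimes> y) z = x \<otimes> commutator y z \<otimes> inv x \<otimes> commutator x z"
  using assms by (simp add: commutator_def free_group_simps)

lemma commutator_mult_right:
  assumes "x \<in> carrier G" "y \<in> carrier G" "z \<in> carrier G"
  shows "commutator x (y \<otimes> z) = commutator x y \<otimes> (y \<otimes> commutator x z \<otimes> inv y)"
  using assms by (simp add: commutator_def free_group_simps)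

lemma commutator_inv_right:
  assumes "x \<in> carrier G" "y \<in> carrier G"
  shows "commutator x (inv y) = inv y \<otimes> inv (commutator x y) \<otimes> y"
  using assms by (simp add: commutator_def free_group_simps)

lemma commutator_inv_left:
  assumes "x \<in> carrier G" "y \<in> carrier G"
  shows "commutator (inv x) y = inv x \<otimes> inv (commutator x y) \<otimes> x"
  using assms by (simp add: commutator_def free_group_simps)

lemma commutator_one [simp]:
  "x \<in> carrier G \<Longrightarrow> commutator x \<one> = \<one>" "x \<in> carrier G \<Longrightarrow> commutator \<one> x = \<one>"
  by (simp_all add: commutator_def)

lemma conj_eq_commutator:
  assumes "x \<in> carrier G" "y \<in> carrier G"
  shows "x \<otimes> y \<otimes> inv x = commutator x y \<otimes> y"
  using assms by (simp add: commutator_def free_group_simps)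

text \<open>
  Each factor is a quotient \<open>u a b c (u b c a)\<^sup>-\<^sup>1\<close> of values of one word \<open>u\<close>, so the cyclic
  product telescopes.
\<close>

lemma hall_witt:
  assumes "x \<in> carrier G" "y \<in> carrier G" "z \<in> carrier G"
  shows "commutator (commutator x y) (y \<otimes> z \<otimes> inv y) \<otimes>
         commutator (commutator y z) (z \<otimes> x \<otimes> inv z) \<otimes>
         commutator (commutator z x) (x \<otimes> y \<otimes> inv x) = \<one>"
proof -
  define u where "u a b c = a \<otimes> b \<otimes> inv a \<otimes> c \<otimes> a" for a b c
  have u: "commutator (commutator a b) (b \<otimes> c \<otimes> inv b) = u a b c \<otimes> inv (u b c a)"
    if "a \<in> carrier G" "b \<in> carrier G" "c \<in> carrier G" for a b c
    using that by (simp add: commutator_def u_def free_group_simps)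
  have "u a b c \<in> carrier G" if "a \<in> carrier G" "b \<in> carrier G" "c \<in> carrier G" for a b c
    using that by (simp add: u_def)
  then show ?thesis
    using assms by (simp only: u) (simp add: m_assoc)
qed

lemma normal_conj:
  assumes "N \<lhd> G" "x \<in> carrier G" "n \<in> N"
  shows "x \<otimes> n \<otimes> inv x \<in> N" "inv x \<otimes> n \<otimes> x \<in> N"
  using normal.inv_op_closed2[OF assms] normal.inv_op_closed1[OF assms] by simp_all

lemma normal_props:
  assumes "N \<lhd> G"
  shows "\<one> \<in> N" "\<And>x. x \<in> N \<Longrightarrow> x \<in> carrier G" "\<And>x. x \<in> N \<Longrightarrow> inv x \<in> N"
    "\<And>x y. x \<in> N \<Longrightarrow> y \<in> N \<Longrightarrow> x \<otimes> y \<in> N"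
  using normal_imp_subgroup[OF assms] subgroup.one_closed subgroup.mem_carrier
    subgroup.m_inv_closed subgroup.m_closed by metis+

lemma subgroup_commutator_right:
  assumes N: "N \<lhd> G" and x: "x \<in> carrier G"
  shows "subgroup {g \<in> carrier G. commutator x g \<in> N} G"
proof (rule subgroupI)
  show "{g \<in> carrier G. commutator x g \<in> N} \<noteq> {}"
    using normal_props(1)[OF N] x commutator_one(1)[OF x] by (metis (mono_tags, lifting) empty_iff mem_Collect_eq one_closed)
  fix a assume "a \<in> {g \<in> carrier G. commutator x g \<in> N}"
  then show "inv a \<in> {g \<in> carrier G. commutator x g \<in> N}"
    using normal_conj(2)[OF N] normal_props(3)[OF N] x by (simp add: commutator_inv_right)
next
  fix a b assume "a \<in> {g \<in> carrier G. commutator x g \<in> N}" "b \<in> {g \<in> carrier G. commutator x g \<in> N}"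
  then show "a \<otimes> b \<in> {g \<in> carrier G. commutator x g \<in> N}"
    using normal_conj(1)[OF N] normal_props(4)[OF N] x by (simp add: commutator_mult_right)
qed auto

lemma commutator_mod_left:
  assumes N: "N \<lhd> G" and "x \<in> carrier G" "y \<in> carrier G" "z \<in> carrier G"
    and n: "commutator y z \<in> N"
  shows "\<exists>n\<in>N. commutator (x \<otimes> y) z = commutator x z \<otimes> n"
proof
  let ?c = "commutator x z" and ?n = "x \<otimes> commutator y z \<otimes> inv x"
  have "?n \<in> N"
    using normal_conj(1)[OF N] assms by blast
  then show "inv ?c \<otimes> ?n \<otimes> ?c \<in> N"
    using normal_conj(2)[OF N] assms by blast
  show "commutator (x \<otimes> y) z = ?c \<otimes> (inv ?c \<otimes> ?n \<otimes> ?c)"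
    using assms by (simp add: commutator_mult_left m_assoc)
qed

lemma commutator_mod_right:
  assumes N: "N \<lhd> G" and "x \<in> carrier G" "y \<in> carrier G" "z \<in> carrier G"
    and n: "commutator x z \<in> N"
  shows "\<exists>n\<in>N. commutator x (y \<otimes> z) = commutator x y \<otimes> n"
  using normal_conj(1)[OF N, of y] assms by (auto simp: commutator_mult_right)

text \<open>
  The image of a homomorphism into the quotient by \<open>N\<close>, pulled back to the group. It is closed under
  inverses because \<open>\<phi> h \<otimes> \<phi> (inv h)\<close> agrees modulo \<open>N\<close> with \<open>\<phi> \<one>\<close>, which lies in \<open>N\<close>.
\<close>

lemma subgroup_image_mod:
  assumes N: "N \<lhd> G" and H: "subgroup H G" and \<phi>: "\<And>h. h \<in> H \<Longrightarrow> \<phi> h \<in> carrier G"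
    and mult: "\<And>h h'. h \<in> H \<Longrightarrow> h' \<in> H \<Longrightarrow> \<exists>n\<in>N. \<phi> (h \<otimes> h') = \<phi> h \<otimes> \<phi> h' \<otimes> n"
  shows "subgroup {\<phi> h \<otimes> n | h n. h \<in> H \<and> n \<in> N} G"
proof -
  have one: "\<one> \<in> H" and Hi: "\<And>h. h \<in> H \<Longrightarrow> inv h \<in> H" and Hm: "\<And>h k. h \<in> H \<Longrightarrow> k \<in> H \<Longrightarrow> h \<otimes> k \<in> H"
    and Hc: "\<And>h. h \<in> H \<Longrightarrow> h \<in> carrier G"
    using H subgroup.one_closed subgroup.m_inv_closed subgroup.m_closed subgroup.mem_carrier by metis+
  note Nc = normal_props(2)[OF N]
  have \<phi>1: "\<phi> \<one> \<in> N"
  proof -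
    obtain n where n: "n \<in> N" "\<phi> (\<one> \<otimes> \<one>) = \<phi> \<one> \<otimes> \<phi> \<one> \<otimes> n"
      using mult one by blast
    then have "\<phi> \<one> = \<phi> \<one> \<otimes> (\<phi> \<one> \<otimes> n)"
      using \<phi>[OF one] Nc by (simp add: m_assoc)
    then have "\<phi> \<one> \<otimes> n = \<one>"
      using \<phi>[OF one] Nc[OF n(1)] by (metis l_cancel_one' m_closed)
    then have "\<phi> \<one> = inv n"
      using \<phi>[OF one] Nc[OF n(1)] by (metis inv_equality inv_inv inv_closed)
    then show ?thesis
      using normal_props(3)[OF N] n by simp
  qed
  show ?thesis
  proof (rule subgroupI)
    show "{\<phi> h \<otimes> n | h n. h \<in> H \<and> n \<in> N} \<subseteq> carrier G"
      using \<phi> Nc by auto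
    show "{\<phi> h \<otimes> n | h n. h \<in> H \<and> n \<in> N} \<noteq> {}"
      using one normal_props(1)[OF N] by blast
  next
    fix a assume "a \<in> {\<phi> h \<otimes> n | h n. h \<in> H \<and> n \<in> N}"
    then obtain h n where h: "h \<in> H" "n \<in> N" "a = \<phi> h \<otimes> n"
      by blast
    obtain n' where n': "n' \<in> N" "\<phi> (h \<otimes> inv h) = \<phi> h \<otimes> \<phi> (inv h) \<otimes> n'"
      using mult h Hi by blast
    let ?x = "\<phi> h" and ?y = "\<phi> (inv h)"
    have c: "?x \<in> carrier G" "?y \<in> carrier G" "n \<in> carrier G" "n' \<in> carrier G"
      using h n' \<phi> Hi Nc by auto
    have "?x \<otimes> ?y \<otimes> n' \<in> N"
      using n'(2) \<phi>1 Hc[OF h(1)] by simp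
    then have "inv ?x \<otimes> (?x \<otimes> ?y \<otimes> n') \<otimes> ?x \<in> N"
      using normal_conj(2)[OF N] c by blast
    moreover have "inv ?x \<otimes> (?x \<otimes> ?y \<otimes> n') \<otimes> ?x = ?y \<otimes> n' \<otimes> ?x"
      using c by (simp add: m_assoc)
    ultimately have "?y \<otimes> n' \<otimes> ?x \<in> N" by simp
    then have 1: "inv n \<otimes> inv (?y \<otimes> n' \<otimes> ?x) \<in> N"
      using h by (simp only: normal_props[OF N])
    have "inv a = inv n \<otimes> inv ?x"
      using h c by (simp add: inv_mult_group)
    also have "\<dots> = ?y \<otimes> (inv ?y \<otimes> inv n \<otimes> ?y \<otimes> (inv ?y \<otimes> inv ?x))"
      using c by (simp add: m_assoc)
    finally have e: "inv a = ?y \<otimes> (inv ?y \<otimes> inv n \<otimes> ?y \<otimes> (inv ?y \<otimes> inv ?x))" .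
    have "n' \<otimes> inv (?x \<otimes> ?y \<otimes> n') \<in> N"
      using \<open>?x \<otimes> ?y \<otimes> n' \<in> N\<close> n'(1) by (simp only: normal_props[OF N])
    moreover have "n' \<otimes> inv (?x \<otimes> ?y \<otimes> n') = inv ?y \<otimes> inv ?x"
      using c by (simp add: free_group_simps)
    ultimately have "inv ?y \<otimes> inv ?x \<in> N" by simp
    moreover have "inv ?y \<otimes> inv n \<otimes> ?y \<in> N"
      using normal_conj(2)[OF N c(2)] normal_props(3)[OF N h(2)] by blast
    ultimately have "inv ?y \<otimes> inv n \<otimes> ?y \<otimes> (inv ?y \<otimes> inv ?x) \<in> N"
      by (simp only: normal_props[OF N])
    then show "inv a \<in> {\<phi> h \<otimes> n | h n. h \<in> H \<and> n \<in> N}"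
      using e Hi h by blast
  next
    fix a b assume "a \<in> {\<phi> h \<otimes> n | h n. h \<in> H \<and> n \<in> N}" "b \<in> {\<phi> h \<otimes> n | h n. h \<in> H \<and> n \<in> N}"
    then obtain h n h' n' where h: "h \<in> H" "n \<in> N" "a = \<phi> h \<otimes> n" "h' \<in> H" "n' \<in> N" "b = \<phi> h' \<otimes> n'"
      by blast
    obtain m where m: "m \<in> N" "\<phi> (h \<otimes> h') = \<phi> h \<otimes> \<phi> h' \<otimes> m"
      using mult h by blast
    have c: "\<phi> h \<in> carrier G" "\<phi> h' \<in> carrier G" "n \<in> carrier G" "n' \<in> carrier G" "m \<in> carrier G"
      using h m \<phi> Nc by auto
    have "inv m \<otimes> (inv (\<phi> h') \<otimes> n \<otimes> \<phi> h') \<otimes> n' \<in> N"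
      using normal_conj(2)[OF N c(2) h(2)] h(5) m(1) by (simp add: normal_props[OF N])
    moreover have "a \<otimes> b = \<phi> (h \<otimes> h') \<otimes> (inv m \<otimes> (inv (\<phi> h') \<otimes> n \<otimes> \<phi> h') \<otimes> n')"
      using c h m by (simp add: m_assoc)
    ultimately show "a \<otimes> b \<in> {\<phi> h \<otimes> n | h n. h \<in> H \<and> n \<in> N}"
      using h Hm by blast
  qed
qed

primrec upper_central :: "nat \<Rightarrow> 'a set" where
  "upper_central 0 = {\<one>}"
| "upper_central (Suc m) = {g \<in> carrier G. \<forall>h\<in>carrier G. commutator g h \<in> upper_central m}"

lemma upper_central_normal: "upper_central m \<lhd> G"
proof (induction m)
  case 0
  then show ?case
    using one_is_normal by simp
next
  case (Suc m)
  have eq: "upper_central (Suc m) = {g \<in> carrier G. \<forall>h\<in>carrier G. commutator h g \<in> upper_central m}"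
    using normal_props(3)[OF Suc] inv_commutator by (auto) metis+
  then have eq': "upper_central (Suc m) =
      (\<Inter>h\<in>carrier G. {g \<in> carrier G. commutator h g \<in> upper_central m})"
    by auto
  have "subgroup (upper_central (Suc m)) G"
    unfolding eq' using subgroup_commutator_right[OF Suc]
    by (intro subgroups_Inter) auto
  moreover have "x \<otimes> g \<otimes> inv x \<in> upper_central (Suc m)"
    if x: "x \<in> carrier G" and g: "g \<in> upper_central (Suc m)" for x g
  proof -
    have "commutator (x \<otimes> g \<otimes> inv x) h \<in> upper_central m" if h: "h \<in> carrier G" for h
    proof -
      have "commutator (x \<otimes> g \<otimes> inv x) h = x \<otimes> commutator g (inv x \<otimes> h \<otimes> x) \<otimes> inv x"
        using x g h by (simp add: commutator_def free_group_simps)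
      moreover have "commutator g (inv x \<otimes> h \<otimes> x) \<in> upper_central m"
        using g x h by simp
      ultimately show ?thesis
        using normal_conj(1)[OF Suc x] by simp
    qed
    then show ?thesis
      using x g by simp
  qed
  ultimately show ?case
    by (simp add: normal_inv_iff del: upper_central.simps)
qed

lemma upper_central_commutator:
  assumes "g \<in> upper_central (Suc m)" "h \<in> carrier G"
  shows "commutator g h \<in> upper_central m" "commutator h g \<in> upper_central m"
proof -
  show 1: "commutator g h \<in> upper_central m" using assms by simp
  show "commutator h g \<in> upper_central m"
    using normal_props(3)[OF upper_central_normal 1] assms inv_commutator[of g h] by simp
qed

lemma upper_central_Suc_mono: "upper_central m \<subseteq> upper_central (Suc m)"
proof (induction m)
  case (Suc m)
  then show ?case by auto
qed auto

lemma upper_central_mono: "m \<le> n \<Longrightarrow> upper_central m \<subseteq> upper_central n"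
  by (rule lift_Suc_mono_le[of upper_central, OF upper_central_Suc_mono])

lemmas upper_central_props = normal_props[OF upper_central_normal]
lemmas upper_central_conj = normal_conj[OF upper_central_normal]

end

text \<open>
  Read backwards from its trivial term, the lower central series stays below the upper central
  series, because each of its steps is central modulo the next term.
\<close>

lemma upper_central_eq_carrier:
  fixes G :: "'g monoid"
  assumes "nilpotent_group d G"
  shows "group.upper_central G d = carrier G"
proof -
  interpret group G
    using assms by (simp add: nilpotent_group_def)
  have sub: "lower_central G j \<subseteq> carrier G" for j
  proof (induction j)
    case (Suc j)
    have "commutators G (lower_central G j) (carrier G) \<subseteq> carrier G"
      using Suc by (force simp: commutators_def)
    then show ?case
      using generate_incl by simp
  qed simp
  have "j \<le> d \<Longrightarrow> lower_central G (d - j) \<subseteq> upper_central j" for j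
  proof (induction j)
    case 0
    then show ?case
      using assms by (simp add: nilpotent_group_def)
  next
    case (Suc j)
    have e: "d - j = Suc (d - Suc j)"
      using Suc.prems by simp
    have "commutator g h \<in> upper_central j"
      if g: "g \<in> lower_central G (d - Suc j)" and h: "h \<in> carrier G" for g h
    proof -
      have "commutator g h \<in> commutators G (lower_central G (d - Suc j)) (carrier G)"
        using g h by (auto simp: commutators_def commutator_def)
      then have "commutator g h \<in> lower_central G (d - j)"
        unfolding e by (simp add: generate.incl)
      then show ?thesis
        using Suc by auto
    qed
    then show ?case
      using sub by auto
  qed
  from this[of d] have "carrier G \<subseteq> upper_central d" by simp
  then show ?thesis
    using upper_central_props(2) by blast
qed

section \<open>Finite generation of subgroups of nilpotent groups\<close>

context group
begin

text \<open>
  The subgroups are taken in the ambient group; this avoids a change of carrier when \<open>H\<close> is itself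
  a subgroup.
\<close>

definition noetherian_subset :: "'a set \<Rightarrow> bool" where
  "noetherian_subset H \<longleftrightarrow>
     (\<forall>D. subgroup D G \<and> D \<subseteq> H \<longrightarrow> (\<exists>F. finite F \<and> F \<subseteq> carrier G \<and> D = generate G F))"

definition normalizes :: "'a set \<Rightarrow> 'a set \<Rightarrow> bool" where
  "normalizes A N \<longleftrightarrow> (\<forall>a\<in>A. \<forall>n\<in>N. a \<otimes> n \<otimes> inv a \<in> N \<and> inv a \<otimes> n \<otimes> a \<in> N)"

lemma conj_generate:
  assumes a: "a \<in> carrier G" and N: "N \<subseteq> carrier G"
    and n: "\<And>n. n \<in> N \<Longrightarrow> a \<otimes> n \<otimes> inv a \<in> generate G N"
    and x: "x \<in> generate G N"
  shows "a \<otimes> x \<otimes> inv a \<in> generate G N"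
  using x
proof (induction rule: generate.induct)
  case one
  then show ?case using a generate.one by simp
next
  case (incl h)
  then show ?case using n by simp
next
  case (inv h)
  then have "inv (a \<otimes> h \<otimes> inv a) \<in> generate G N"
    using n N a generate_m_inv_closed by auto
  moreover have "inv (a \<otimes> h \<otimes> inv a) = a \<otimes> inv h \<otimes> inv a"
    using inv a N by (auto simp: free_group_simps)
  ultimately show ?case by simp
next
  case (eng h1 h2)
  have "h1 \<in> carrier G" "h2 \<in> carrier G"
    using eng N generate_in_carrier by auto
  then have "a \<otimes> (h1 \<otimes> h2) \<otimes> inv a = (a \<otimes> h1 \<otimes> inv a) \<otimes> (a \<otimes> h2 \<otimes> inv a)"
    using a by (simp add: free_group_simps)
  then show ?case
    using eng generate.eng by metis
qed

lemma subgroup_normalizer: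
  assumes "N \<subseteq> carrier G"
  shows "subgroup {a \<in> carrier G. normalizes {a} N} G"
proof (rule subgroupI)
  show "{a \<in> carrier G. normalizes {a} N} \<noteq> {}"
    using assms by (force simp: normalizes_def subset_iff)
  fix a assume a: "a \<in> {a \<in> carrier G. normalizes {a} N}"
  then show "inv a \<in> {a \<in> carrier G. normalizes {a} N}"
    by (auto simp: normalizes_def)
  fix b assume b: "b \<in> {a \<in> carrier G. normalizes {a} N}"
  have "a \<otimes> b \<otimes> n \<otimes> inv (a \<otimes> b) = a \<otimes> (b \<otimes> n \<otimes> inv b) \<otimes> inv a"
       "inv (a \<otimes> b) \<otimes> n \<otimes> (a \<otimes> b) = inv b \<otimes> (inv a \<otimes> n \<otimes> a) \<otimes> b" if "n \<in> N" for n
    using a b that assms by (auto simp: subset_iff free_group_simps)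
  then show "a \<otimes> b \<in> {a \<in> carrier G. normalizes {a} N}"
    using a b by (auto simp: normalizes_def)
qed auto

text \<open>
  The extension step for polycyclic groups. For a subgroup \<open>D\<close>, the integers \<open>a\<close> such that \<open>D\<close>
  meets \<open>N t\<^sup>a\<close> form an ideal. An element of \<open>D\<close> whose exponent generates this ideal, together with
  generators of \<open>D \<inter> N\<close>, generates \<open>D\<close>.
\<close>

lemma noetherian_insert:
  assumes N: "subgroup N G" "noetherian_subset N" and t: "t \<in> carrier G" "normalizes {t} N"
  shows "noetherian_subset (generate G (insert t N))"
  unfolding noetherian_subset_def
proof (intro allI impI, elim conjE)
  fix D assume D: "subgroup D G" "D \<subseteq> generate G (insert t N)"
  note Nc = subgroup.mem_carrier[OF N(1)] and Nm = subgroup.m_closed[OF N(1)]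
    and Ni = subgroup.m_inv_closed[OF N(1)] and N1 = subgroup.one_closed[OF N(1)]
  note Dc = subgroup.mem_carrier[OF D(1)] and Dm = subgroup.m_closed[OF D(1)]
    and Di = subgroup.m_inv_closed[OF D(1)] and D1 = subgroup.one_closed[OF D(1)]
  \<comment> \<open>every element of the enlarged group is \<open>n t\<^sup>a\<close>\<close>
  have conjt: "t [^] (a::int) \<otimes> n \<otimes> t [^] (- a) \<in> N" if "n \<in> N" for a n
  proof -
    have "subgroup {a \<in> carrier G. normalizes {a} N} G"
      using Nc by (intro subgroup_normalizer) auto
    then have "t [^] a \<in> {a \<in> carrier G. normalizes {a} N}"
      using t by (intro subgroup_int_pow_closed) auto
    then show ?thesis
      using that t(1) by (auto simp: normalizes_def int_pow_neg)
  qed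
  have twist: "(n \<otimes> t [^] a) \<otimes> (m \<otimes> t [^] b) = n \<otimes> (t [^] a \<otimes> m \<otimes> t [^] (- a)) \<otimes> t [^] (a + b)"
    if "n \<in> N" "m \<in> N" for n m and a b :: int
    using that Nc t(1) by (simp add: m_assoc int_pow_mult int_pow_neg)
  have form: "\<exists>n\<in>N. \<exists>a::int. x = n \<otimes> t [^] a" if "x \<in> generate G (insert t N)" for x
    using that
  proof (induction rule: generate.induct)
    case one
    show ?case
      by (intro bexI[of _ \<one>] exI[of _ 0]) (auto simp: N1)
  next
    case (incl h)
    show ?case
    proof (cases "h = t")
      case True
      then show ?thesis
        using t by (intro bexI[of _ \<one>] exI[of _ 1]) (auto simp: N1)
    next
      case False
      then show ?thesis
        using incl Nc by (intro bexI[of _ h] exI[of _ 0]) auto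
    qed
  next
    case (inv h)
    show ?case
    proof (cases "h = t")
      case True
      then show ?thesis
        using t by (intro bexI[of _ \<one>] exI[of _ "-1"]) (auto simp: N1 int_pow_neg)
    next
      case False
      then show ?thesis
        using inv Nc Ni by (intro bexI[of _ "inv h"] exI[of _ 0]) auto
    qed
  next
    case (eng h1 h2)
    then obtain n a m b where h: "n \<in> N" "h1 = n \<otimes> t [^] (a::int)" "m \<in> N" "h2 = m \<otimes> t [^] (b::int)"
      by blast
    have "h1 \<otimes> h2 = (n \<otimes> (t [^] a \<otimes> m \<otimes> t [^] (- a))) \<otimes> t [^] (a + b)"
      using h twist by simp
    then show ?case
      using Nm[OF h(1) conjt[OF h(3)]] by blast
  qed
  define I where "I = {a::int. \<exists>n\<in>N. n \<otimes> t [^] a \<in> D}"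
  have I_diff: "a - b \<in> I" if ab: "a \<in> I" "b \<in> I" for a b
  proof -
    obtain n m where h: "n \<in> N" "n \<otimes> t [^] a \<in> D" "m \<in> N" "m \<otimes> t [^] b \<in> D"
      using ab by (auto simp: I_def)
    have "n \<otimes> t [^] a \<otimes> inv (m \<otimes> t [^] b) \<in> D"
      using h Dm Di by blast
    moreover have "n \<otimes> t [^] a \<otimes> inv (m \<otimes> t [^] b)
        = n \<otimes> (t [^] (a-b) \<otimes> inv m \<otimes> t [^] (- (a - b))) \<otimes> t [^] (a - b)"
      using h(1,3) Nc t(1) by (simp add: m_assoc int_pow_diff int_pow_neg inv_mult_group)
    ultimately show ?thesis
      using h conjt[of "inv m" "a - b"] Ni Nm by (auto simp: I_def)
  qed
  have I0: "0 \<in> I"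
    using N1 D1 unfolding I_def by (auto intro!: bexI[of _ \<one>])
  have I_neg: "- a \<in> I" if "a \<in> I" for a
    using I_diff[OF I0 that] by simp
  have I_add: "a + b \<in> I" if "a \<in> I" "b \<in> I" for a b
    using I_diff[OF that(1) I_neg[OF that(2)]] by simp
  have I_mult_nat: "int k * a \<in> I" if "a \<in> I" for k a
    by (induction k) (auto simp: I0 distrib_right intro: I_add that)
  have I_mult: "k * a \<in> I" if "a \<in> I" for k a
    using I_mult_nat[OF that, of "nat k"] I_neg[OF I_mult_nat[OF that, of "nat (- k)"]]
    by (cases "k \<ge> 0") auto
  have "\<exists>m\<in>I. \<forall>a\<in>I. m dvd a"
  proof (cases "\<exists>a\<in>I. a > 0")
    case False
    then have "\<forall>a\<in>I. a = 0"
      using I_neg by (metis neg_0_less_iff_less not_less_iff_gr_or_eq)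
    then show ?thesis
      using I0 by auto
  next
    case True
    then obtain k :: nat where k: "k > 0" "int k \<in> I"
      using zero_less_imp_eq_int by auto
    define m where "m = (LEAST k::nat. k > 0 \<and> int k \<in> I)"
    have m: "m > 0" "int m \<in> I"
      using LeastI[of "\<lambda>k. k > 0 \<and> int k \<in> I", OF conjI[OF k]] by (auto simp: m_def)
    have "int m dvd a" if a: "a \<in> I" for a
    proof -
      have "a mod int m \<in> I"
        using I_diff[OF a I_mult[OF m(2), of "a div int m"]]
        by (simp add: minus_div_mult_eq_mod)
      moreover have "0 \<le> a mod int m" "a mod int m < int m"
        using m by auto
      moreover from this have "nat (a mod int m) < m" by linarith
      ultimately have "\<not> nat (a mod int m) > 0"
        using not_less_Least[of "nat (a mod int m)" "\<lambda>k. k > 0 \<and> int k \<in> I"] m_def by auto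
      then show ?thesis
        using \<open>0 \<le> a mod int m\<close> by (simp add: dvd_eq_mod_eq_0)
    qed
    then show ?thesis
      using m by auto
  qed
  then obtain m where mI: "m \<in> I" and m: "\<And>a. a \<in> I \<Longrightarrow> m dvd a"
    by blast
  obtain n0 where n0: "n0 \<in> N" "n0 \<otimes> t [^] m \<in> D"
    using mI by (auto simp: I_def)
  define x0 where "x0 = n0 \<otimes> t [^] m"
  have x0: "x0 \<in> D" "x0 \<in> carrier G"
    unfolding x0_def by (rule n0(2), rule Dc[OF n0(2)])
  have pow: "\<exists>n\<in>N. x0 [^] (q::int) = n \<otimes> t [^] (q * m)" for q
  proof -
    have nat: "\<exists>n\<in>N. x0 [^] (k::nat) = n \<otimes> t [^] (int k * m)" for k
    proof (induction k)
      case 0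
      show ?case
        by (rule bexI[OF _ N1]) simp
    next
      case (Suc k)
      obtain n where n: "n \<in> N" "x0 [^] k = n \<otimes> t [^] (int k * m)"
        using Suc.IH by (elim bexE)
      have e: "int (Suc k) * m = int k * m + m"
        by (simp add: distrib_right)
      have "x0 [^] Suc k = (n \<otimes> t [^] (int k * m)) \<otimes> (n0 \<otimes> t [^] m)"
        by (simp only: nat_pow_Suc n(2) x0_def[symmetric])
      also have "\<dots> = n \<otimes> (t [^] (int k * m) \<otimes> n0 \<otimes> t [^] (- (int k * m))) \<otimes> t [^] (int (Suc k) * m)"
        unfolding e by (rule twist[OF n(1) n0(1)])
      finally show ?case
        by (rule bexI[OF _ Nm[OF n(1) conjt[OF n0(1)]]])
    qed
    show ?thesis
    proof (cases "q \<ge> 0")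
      case True
      then have e: "int (nat q) = q"
        by simp
      then have "x0 [^] q = x0 [^] nat q"
        using int_pow_int[of G x0 "nat q"] by (simp only: e)
      then show ?thesis
        using nat[of "nat q"] by (simp only: e)
    next
      case False
      then have "int (nat (- q)) = - q"
        by simp
      then obtain n where n: "n \<in> N" "x0 [^] nat (- q) = n \<otimes> t [^] (- q * m)"
        using nat[of "nat (- q)"] by (elim bexE) (simp only:)
      have "x0 [^] q = inv (x0 [^] nat (- q))"
        using False int_pow_def2[of G x0 q] by simp
      also have "\<dots> = t [^] (q * m) \<otimes> inv n"
        using n(2) Nc[OF n(1)] t(1) by (simp add: inv_mult_group int_pow_neg)
      also have "\<dots> = (t [^] (q * m) \<otimes> inv n \<otimes> t [^] (- (q * m))) \<otimes> t [^] (q * m)"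
        using Nc[OF n(1)] t(1) by (simp add: m_assoc int_pow_neg)
      finally show ?thesis
        by (rule bexI[OF _ conjt[OF Ni[OF n(1)]]])
    qed
  qed
  have DN: "subgroup (D \<inter> N) G"
    by (rule subgroups_Inter_pair[OF D(1) N(1)])
  obtain F where F: "finite F" "F \<subseteq> carrier G" "D \<inter> N = generate G F"
    using N(2)[unfolded noetherian_subset_def, rule_format, OF conjI[OF DN Int_lower2]] by (elim exE conjE) 
  have FD: "F \<subseteq> D"
  proof
    fix x assume "x \<in> F"
    then have "x \<in> D \<inter> N"
      unfolding F(3) by (rule generate.incl)
    then show "x \<in> D"
      by (rule IntD1)
  qed
  have "D \<subseteq> generate G (insert x0 F)"
  proof
    fix x assume x: "x \<in> D"
    then obtain n a where n: "n \<in> N" "x = n \<otimes> t [^] (a::int)"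
      using form D by blast
    then have "a \<in> I"
      using x by (auto simp: I_def)
    then obtain q where q: "a = q * m"
      using m by (metis dvd_def mult.commute)
    obtain n' where n': "n' \<in> N" "x0 [^] q = n' \<otimes> t [^] (q * m)"
      using pow[of q] by (elim bexE)
    have x0q: "x0 [^] q \<in> D"
      using x0(1) D(1) by (simp add: subgroup_int_pow_closed)
    have "x \<otimes> inv (x0 [^] q) = n \<otimes> inv n'"
      using n(2) n'(2) q Nc[OF n(1)] Nc[OF n'(1)] t(1) by (simp add: free_group_simps)
    then have "x \<otimes> inv (x0 [^] q) \<in> N"
      using Nm[OF n(1) Ni[OF n'(1)]] by simp
    then have "x \<otimes> inv (x0 [^] q) \<in> D \<inter> N"
      using Dm[OF x Di[OF x0q]] by (rule IntI[rotated])
    then have 1: "x \<otimes> inv (x0 [^] q) \<in> generate G (insert x0 F)"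
      using F(3) mono_generate[of F "insert x0 F"] by blast
    have "subgroup (generate G (insert x0 F)) G"
      using F x0 by (intro generate_is_subgroup) auto
    then have 2: "x0 [^] q \<in> generate G (insert x0 F)"
      by (intro subgroup_int_pow_closed) (auto intro: generate.incl)
    have "x = (x \<otimes> inv (x0 [^] q)) \<otimes> x0 [^] q"
      using Dc[OF x] x0 by (simp add: m_assoc)
    then show "x \<in> generate G (insert x0 F)"
      using 1 2 generate.eng by metis
  qed
  moreover have "generate G (insert x0 F) \<subseteq> D"
    using FD x0 D(1) by (intro generate_subgroup_incl) auto
  ultimately show "\<exists>F. finite F \<and> F \<subseteq> carrier G \<and> D = generate G F"
    using F x0 by (intro exI[of _ "insert x0 F"]) auto
qed

lemma generate_self: "subgroup N G \<Longrightarrow> generate G N = N"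
  using generate_subgroup_incl[of N N] by (auto intro: generate.incl)

lemma generate_insert_generate:
  assumes "A \<subseteq> carrier G" "t \<in> carrier G"
  shows "generate G (insert t (generate G A)) = generate G (insert t A)"
proof
  have "subgroup (generate G (insert t A)) G"
    using assms by (intro generate_is_subgroup) auto
  moreover have "generate G A \<subseteq> generate G (insert t A)"
    by (intro mono_generate) auto
  ultimately show "generate G (insert t (generate G A)) \<subseteq> generate G (insert t A)"
    by (intro generate_subgroup_incl) (auto intro: generate.incl)
  show "generate G (insert t A) \<subseteq> generate G (insert t (generate G A))"
    by (intro mono_generate) (auto intro: generate.incl)
qed

text \<open>
  Modulo \<open>N\<close> the elements of \<open>F\<close> commute with \<open>\<Gamma>\<close>. So \<open>\<Gamma>\<close> normalizes the subgroup generated by \<open>N\<close>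
  and any part of \<open>F\<close>, and the elements of \<open>F\<close> can be adjoined one at a time.
\<close>

lemma noetherian_extend:
  assumes N: "subgroup N G" "noetherian_subset N" and \<Gamma>: "subgroup \<Gamma> G" "normalizes \<Gamma> N"
    and F: "finite F" "F \<subseteq> \<Gamma>" "\<And>t g. t \<in> F \<Longrightarrow> g \<in> \<Gamma> \<Longrightarrow> commutator g t \<in> N"
  shows "noetherian_subset (generate G (N \<union> F))"
  using F
proof (induction F rule: finite_induct)
  case empty
  then show ?case
    using N by (simp add: generate_self)
next
  case (insert t F)
  note \<Gamma>c = subgroup.mem_carrier[OF \<Gamma>(1)]
  have t: "t \<in> \<Gamma>" and t_c: "t \<in> carrier G" and F: "F \<subseteq> \<Gamma>"
    using insert.prems \<Gamma>c by auto
  have NF: "N \<union> F \<subseteq> carrier G"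
    using F subgroup.subset[OF N(1)] subgroup.subset[OF \<Gamma>(1)] by blast
  have conj: "g \<otimes> x \<otimes> inv g \<in> generate G (N \<union> F)" if g: "g \<in> \<Gamma>" and x: "x \<in> N \<union> F" for g x
    using x
  proof
    assume "x \<in> N"
    then have "g \<otimes> x \<otimes> inv g \<in> N"
      using \<Gamma>(2) g by (simp add: normalizes_def)
    then show ?thesis
      by (intro generate.incl) simp
  next
    assume x: "x \<in> F"
    then have "commutator g x \<in> N"
      using insert.prems(2) g by blast
    then have "commutator g x \<otimes> x \<in> generate G (N \<union> F)"
      using x by (intro generate.eng generate.incl) auto
    then show ?thesis
      using x F g \<Gamma>c by (simp add: conj_eq_commutator subset_iff)
  qed
  have conj': "g \<otimes> x \<otimes> inv g \<in> generate G (N \<union> F)"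
    if g: "g \<in> \<Gamma>" and x: "x \<in> generate G (N \<union> F)" for g x
    by (rule conj_generate[OF \<Gamma>c[OF g] NF conj[OF g] x])
  have "normalizes {t} (generate G (N \<union> F))"
    using conj'[OF t] conj'[OF subgroup.m_inv_closed[OF \<Gamma>(1) t]] t_c by (simp add: normalizes_def)
  then have "noetherian_subset (generate G (insert t (generate G (N \<union> F))))"
    using insert F NF t_c by (intro noetherian_insert generate_is_subgroup) auto
  then show ?case
    using NF t_c by (simp add: generate_insert_generate)
qed

primrec iterated_commutators :: "'a set \<Rightarrow> nat \<Rightarrow> 'a set" where
  "iterated_commutators S 0 = S"
| "iterated_commutators S (Suc i) = (\<lambda>(t, s). commutator t s) ` (iterated_commutators S i \<times> S)"

text \<open>
  Let \<open>L j\<close> be generated by the iterated commutators of at least \<open>j + 1\<close> elements of \<open>S\<close>.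
  Conjugating such a commutator \<open>t\<close> by \<open>s \<in> S\<close> multiplies it by the inverse of a longer one, so \<open>L j\<close> is
  normalized by the whole group, and \<open>L j\<close> arises from \<open>L (j + 1)\<close> by adjoining finitely many
  elements that are central modulo \<open>L (j + 1)\<close>. As \<open>L d\<close> is trivial, finitely many
  extension steps lead from the trivial group to \<open>L 0\<close>.
\<close>

theorem noetherian_if_nilpotent:
  assumes nil: "upper_central d = carrier G"
    and S: "finite S" "S \<subseteq> carrier G" "\<And>s. s \<in> S \<Longrightarrow> inv s \<in> S"
  shows "noetherian_subset (generate G S)"
proof -
  let ?\<Gamma> = "generate G S" and ?T = "iterated_commutators S"
  have \<Gamma>: "subgroup ?\<Gamma> G"
    using S by (simp add: generate_is_subgroup)
  note \<Gamma>c = subgroup.mem_carrier[OF \<Gamma>]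
  have fin: "finite (?T i)" for i
    by (induction i) (auto simp: S)
  have T\<Gamma>: "?T i \<subseteq> ?\<Gamma>" for i
  proof (induction i)
    case 0
    then show ?case by (auto intro: generate.incl)
  next
    case (Suc i)
    have "commutator t s \<in> ?\<Gamma>" if "t \<in> ?T i" "s \<in> S" for t s
      unfolding commutator_def using subsetD[OF Suc that(1)] generate.incl[OF that(2)]
      by (intro subgroup.m_closed[OF \<Gamma>] subgroup.m_inv_closed[OF \<Gamma>])
    then show ?case by auto
  qed
  have Tc: "?T i \<subseteq> carrier G" for i
    using T\<Gamma>[of i] subgroup.subset[OF \<Gamma>] by blast
  have Tz: "?T i \<subseteq> upper_central (d - i)" for i
  proof (induction i)
    case 0
    then show ?case using S nil by simp
  next
    case (Suc i)
    have "commutator t s \<in> upper_central (d - Suc i)" if t: "t \<in> ?T i" and s: "s \<in> S" for t s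
    proof (cases "i < d")
      case True
      then have "d - i = Suc (d - Suc i)" by simp
      then have "t \<in> upper_central (Suc (d - Suc i))"
        using Suc t by (metis subsetD)
      then show ?thesis
        using upper_central_commutator s S by blast
    next
      case False
      then have "t = \<one>"
        using Suc t by auto
      then show ?thesis
        using s S upper_central_props(1) by auto
    qed
    then show ?case by auto
  qed
  define L where "L j = generate G (\<Union>i\<in>{j..}. ?T i)" for j
  have Lc: "(\<Union>i\<in>{j..}. ?T i) \<subseteq> carrier G" for j
    using Tc by blast
  have L: "subgroup (L j) G" for j
    unfolding L_def by (rule generate_is_subgroup[OF Lc])
  have TL: "t \<in> L j" if "t \<in> ?T i" "j \<le> i" for t i j
    unfolding L_def using that by (intro generate.incl) auto
  have normS: "s \<otimes> x \<otimes> inv s \<in> L j" if s: "s \<in> S" and x: "x \<in> L j" for s x j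
    unfolding L_def
  proof (rule conj_generate[OF _ Lc _ x[unfolded L_def]])
    show sc: "s \<in> carrier G" using s S by blast
    fix t assume "t \<in> (\<Union>i\<in>{j..}. ?T i)"
    then obtain i where i: "i \<ge> j" "t \<in> ?T i" by auto
    have tc: "t \<in> carrier G" using i Tc by blast
    have "commutator t s \<in> ?T (Suc i)"
      using i s by force
    then have "commutator t s \<in> L j"
      using i(1) by (intro TL[of _ "Suc i"]) simp_all
    then have "inv (commutator t s) \<otimes> t \<in> L j"
      using TL[OF i(2,1)] by (intro subgroup.m_closed[OF L] subgroup.m_inv_closed[OF L])
    then show "s \<otimes> t \<otimes> inv s \<in> generate G (\<Union>i\<in>{j..}. ?T i)"
      using sc tc by (simp add: conj_eq_commutator inv_commutator L_def)
  qed
  have norm: "normalizes ?\<Gamma> (L j)" for j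
  proof -
    have "?\<Gamma> \<subseteq> {a \<in> carrier G. normalizes {a} (L j)}"
    proof (rule generate_subgroup_incl[OF _ subgroup_normalizer[OF subgroup.subset[OF L]]])
      have "normalizes {s} (L j)" if s: "s \<in> S" for s
        using normS[OF s] normS[OF S(3)[OF s]] s S(2) by (auto simp: normalizes_def)
      then show "S \<subseteq> {a \<in> carrier G. normalizes {a} (L j)}"
        using S by auto
    qed
    then show ?thesis
      by (auto simp: normalizes_def)
  qed
  have normD: "g \<otimes> x \<otimes> inv g \<in> L j" "inv g \<otimes> x \<otimes> g \<in> L j" if "g \<in> ?\<Gamma>" "x \<in> L j" for g x j
    using norm[of j] that by (simp_all add: normalizes_def)
  have comm: "commutator g t \<in> L (Suc j)" if t: "t \<in> ?T j" and g: "g \<in> ?\<Gamma>" for t g j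
    using g
  proof (induction rule: generate.induct)
    case one
    then show ?case
      using subsetD[OF Tc t] subgroup.one_closed[OF L] by simp
  next
    case (incl s)
    have "commutator t s \<in> ?T (Suc j)"
      using t incl by force
    then have "inv (commutator t s) \<in> L (Suc j)"
      by (intro subgroup.m_inv_closed[OF L] TL[of _ "Suc j"]) simp_all
    then show ?case
      using t Tc S incl by (auto simp: inv_commutator subset_iff)
  next
    case (inv s)
    have c: "s \<in> carrier G" "t \<in> carrier G"
      using t Tc inv S by auto
    have "commutator t s \<in> ?T (Suc j)"
      using t inv by force
    then have "commutator t s \<in> L (Suc j)"
      by (rule TL) simp
    then have "inv s \<otimes> commutator t s \<otimes> s \<in> L (Suc j)"
      using normD(2)[OF generate.incl[OF inv]] by blast
    then show ?case
      using c by (simp add: commutator_inv_left inv_commutator)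
  next
    case (eng g h)
    have c: "g \<in> carrier G" "t \<in> carrier G" "h \<in> carrier G"
      using t Tc eng \<Gamma>c by auto
    have "g \<otimes> commutator h t \<otimes> inv g \<in> L (Suc j)"
      by (rule normD(1)[OF eng.hyps(1) eng.IH(2)])
    then have "g \<otimes> commutator h t \<otimes> inv g \<otimes> commutator g t \<in> L (Suc j)"
      by (rule subgroup.m_closed[OF L _ eng.IH(1)])
    then show ?case
      using c by (simp add: commutator_mult_left)
  qed
  have Lsplit: "L j = generate G (L (Suc j) \<union> ?T j)" for j
  proof
    have "{j..} = insert j {Suc j..}" by auto
    then have "(\<Union>i\<in>{j..}. ?T i) \<subseteq> L (Suc j) \<union> ?T j"
      using TL by auto
    then show "L j \<subseteq> generate G (L (Suc j) \<union> ?T j)"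
      unfolding L_def[of j] by (rule mono_generate)
    have "L (Suc j) \<subseteq> L j"
      unfolding L_def by (intro mono_generate UN_mono) auto
    then show "generate G (L (Suc j) \<union> ?T j) \<subseteq> L j"
      using TL by (intro generate_subgroup_incl[OF _ L]) auto
  qed
  have Ld: "L d = {\<one>}"
  proof -
    have "(\<Union>i\<in>{d..}. ?T i) \<subseteq> {\<one>}"
      using Tz by fastforce
    then have "L d \<subseteq> {\<one>}"
      unfolding L_def using generate_subgroup_incl triv_subgroup by blast
    then show ?thesis
      using subgroup.one_closed[OF L] by blast
  qed
  have "j \<le> d \<Longrightarrow> noetherian_subset (L (d - j))" for j
  proof (induction j)
    case 0
    have "D = generate G {}" if "subgroup D G" "D \<subseteq> {\<one>}" for D
      using that subgroup.one_closed[OF that(1)] by (auto simp: generate_empty)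
    then show ?case
      using Ld by (auto simp: noetherian_subset_def)
  next
    case (Suc j)
    have e: "d - j = Suc (d - Suc j)"
      using Suc.prems by simp
    have "noetherian_subset (L (Suc (d - Suc j)))"
      using Suc e by simp
    then show ?case
      unfolding Lsplit[of "d - Suc j"]
      by (intro noetherian_extend[OF L _ \<Gamma> norm fin T\<Gamma> comm])
  qed
  from this[of d] have "noetherian_subset (L 0)" by simp
  moreover have "?\<Gamma> \<subseteq> L 0"
    by (intro generate_subgroup_incl[OF _ L]) (auto intro: TL[of _ 0])
  ultimately show ?thesis
    unfolding noetherian_subset_def by (meson subset_trans)
qed

end

section \<open>Cube groups of a filtration\<close>

locale group_filtration = group G for G (structure) +
  fixes B :: "nat \<Rightarrow> 'a set"
  assumes B_subgroup: "subgroup (B i) G"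
    and B_0: "B 0 = carrier G"
    and B_dec: "B (Suc i) \<subseteq> B i"
    and B_comm: "a \<in> B i \<Longrightarrow> b \<in> B j \<Longrightarrow> commutator a b \<in> B (i + j)"
begin

text \<open>
  The Host--Kra cubes of dimension \<open>n\<close> for the filtration shifted by \<open>i\<close>. A cube of dimension
  \<open>n + 1\<close> is given by its lower face \<open>f\<^sub>0\<close> and the quotient \<open>f\<^sub>0\<^sup>-\<^sup>1 f\<^sub>1\<close> of its opposite faces,
  where the quotient must be a cube one step deeper in the filtration; this recursion is what all
  inductions on cubes below use. The vertices are the lists of length
  \<open>n\<close>; the values elsewhere only have to lie in the carrier.
\<close>

primrec cubes :: "nat \<Rightarrow> nat \<Rightarrow> (bool list \<Rightarrow> 'a) set" where
  "cubes 0 i = {f. range f \<subseteq> carrier G \<and> f [] \<in> B i}"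
| "cubes (Suc n) i = {f. range f \<subseteq> carrier G \<and> (\<lambda>\<epsilon>. f (False # \<epsilon>)) \<in> cubes n i \<and>
     (\<lambda>\<epsilon>. inv (f (False # \<epsilon>)) \<otimes> f (True # \<epsilon>)) \<in> cubes n (Suc i)}"

lemma cubes_carrier: "f \<in> cubes n i \<Longrightarrow> f \<epsilon> \<in> carrier G"
  by (cases n) auto

text \<open>
  The four closure properties depend on each other: the quotient of the opposite faces of a product
  or of a commutator contains conjugates \<open>g f g\<^sup>-\<^sup>1 = [g, f] f\<close>, which are handled by
  commutators of cubes in one dimension less.
\<close>

lemma cubes_group:
  "(\<forall>i f g. f \<in> cubes n i \<longrightarrow> g \<in> cubes n i \<longrightarrow> (\<lambda>\<epsilon>. f \<epsilon> \<otimes> g \<epsilon>) \<in> cubes n i) \<and>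
   (\<forall>i f. f \<in> cubes n i \<longrightarrow> (\<lambda>\<epsilon>. inv (f \<epsilon>)) \<in> cubes n i) \<and>
   (\<forall>i. cubes n (Suc i) \<subseteq> cubes n i) \<and>
   (\<forall>i j f g. f \<in> cubes n i \<longrightarrow> g \<in> cubes n j \<longrightarrow> (\<lambda>\<epsilon>. commutator (f \<epsilon>) (g \<epsilon>)) \<in> cubes n (i + j))"
proof (induction n)
  case 0
  then show ?case
    using subgroup.m_closed[OF B_subgroup] subgroup.m_inv_closed[OF B_subgroup] subsetD[OF B_dec] B_comm
    by (auto simp: image_subset_iff)
next
  case (Suc n)
  then have mult: "\<And>i f g. f \<in> cubes n i \<Longrightarrow> g \<in> cubes n i \<Longrightarrow> (\<lambda>\<epsilon>. f \<epsilon> \<otimes> g \<epsilon>) \<in> cubes n i"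
    and inv: "\<And>i f. f \<in> cubes n i \<Longrightarrow> (\<lambda>\<epsilon>. inv (f \<epsilon>)) \<in> cubes n i"
    and dec: "\<And>i. cubes n (Suc i) \<subseteq> cubes n i"
    and comm: "\<And>i j f g. f \<in> cubes n i \<Longrightarrow> g \<in> cubes n j \<Longrightarrow>
                 (\<lambda>\<epsilon>. commutator (f \<epsilon>) (g \<epsilon>)) \<in> cubes n (i + j)"
    by auto
  have antimono: "f \<in> cubes n i" if "f \<in> cubes n j" "i \<le> j" for f i j
    using lift_Suc_antimono_le[of "cubes n", OF dec that(2)] that(1) by blast
  have conj: "(\<lambda>\<epsilon>. g \<epsilon> \<otimes> f \<epsilon> \<otimes> inv (g \<epsilon>)) \<in> cubes n i"
    if f: "f \<in> cubes n i" and g: "g \<in> cubes n j" for f g i j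
  proof -
    have "(\<lambda>\<epsilon>. commutator (g \<epsilon>) (f \<epsilon>) \<otimes> f \<epsilon>) \<in> cubes n i"
      using mult[OF antimono[OF comm[OF g f]] f] by simp
    then show ?thesis
      using cubes_carrier[OF f] cubes_carrier[OF g] by (simp add: conj_eq_commutator)
  qed
  show ?case
  proof (intro conjI allI impI)
    fix i f g assume fg: "f \<in> cubes (Suc n) i" "g \<in> cubes (Suc n) i"
    let ?f0 = "\<lambda>\<epsilon>. f (False # \<epsilon>)" and ?g0 = "\<lambda>\<epsilon>. g (False # \<epsilon>)"
    let ?h = "\<lambda>\<epsilon>. inv (f (False # \<epsilon>)) \<otimes> f (True # \<epsilon>)" and ?k = "\<lambda>\<epsilon>. inv (g (False # \<epsilon>)) \<otimes> g (True # \<epsilon>)"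
    have c: "f \<epsilon> \<in> carrier G" "g \<epsilon> \<in> carrier G" for \<epsilon>
      using fg cubes_carrier by blast+
    have "(\<lambda>\<epsilon>. inv (?g0 \<epsilon>) \<otimes> ?h \<epsilon> \<otimes> inv (inv (?g0 \<epsilon>)) \<otimes> ?k \<epsilon>) \<in> cubes n (Suc i)"
      using fg by (intro mult[OF conj[OF _ inv]]) auto
    then have "(\<lambda>\<epsilon>. inv (f (False # \<epsilon>) \<otimes> g (False # \<epsilon>)) \<otimes> (f (True # \<epsilon>) \<otimes> g (True # \<epsilon>))) \<in> cubes n (Suc i)"
      using c by (simp add: free_group_simps)
    then show "(\<lambda>\<epsilon>. f \<epsilon> \<otimes> g \<epsilon>) \<in> cubes (Suc n) i"
      using fg c mult by auto
  next
    fix i f assume f: "f \<in> cubes (Suc n) i"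
    let ?f0 = "\<lambda>\<epsilon>. f (False # \<epsilon>)" and ?h = "\<lambda>\<epsilon>. inv (f (False # \<epsilon>)) \<otimes> f (True # \<epsilon>)"
    have c: "f \<epsilon> \<in> carrier G" for \<epsilon>
      using f cubes_carrier by blast
    have "(\<lambda>\<epsilon>. ?f0 \<epsilon> \<otimes> inv (?h \<epsilon>) \<otimes> inv (?f0 \<epsilon>)) \<in> cubes n (Suc i)"
      using f by (intro conj[OF inv]) auto
    then have "(\<lambda>\<epsilon>. inv (inv (f (False # \<epsilon>))) \<otimes> inv (f (True # \<epsilon>))) \<in> cubes n (Suc i)"
      using c by (simp add: free_group_simps)
    then show "(\<lambda>\<epsilon>. inv (f \<epsilon>)) \<in> cubes (Suc n) i"
      using f c inv by auto
  next
    fix i show "cubes (Suc n) (Suc i) \<subseteq> cubes (Suc n) i"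
      using dec by auto
  next
    fix i j f g assume f: "f \<in> cubes (Suc n) i" and g: "g \<in> cubes (Suc n) j"
    let ?f0 = "\<lambda>\<epsilon>. f (False # \<epsilon>)" and ?g0 = "\<lambda>\<epsilon>. g (False # \<epsilon>)"
    let ?g1 = "\<lambda>\<epsilon>. g (True # \<epsilon>)"
    let ?h = "\<lambda>\<epsilon>. inv (f (False # \<epsilon>)) \<otimes> f (True # \<epsilon>)" and ?k = "\<lambda>\<epsilon>. inv (g (False # \<epsilon>)) \<otimes> g (True # \<epsilon>)"
    have c: "f \<epsilon> \<in> carrier G" "g \<epsilon> \<in> carrier G" for \<epsilon>
      using f g cubes_carrier by blast+
    have f0: "?f0 \<in> cubes n i" and g0: "?g0 \<in> cubes n j" and h: "?h \<in> cubes n (Suc i)" and k: "?k \<in> cubes n (Suc j)"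
      using f g by auto
    have "(\<lambda>\<epsilon>. ?g0 \<epsilon> \<otimes> ?k \<epsilon>) \<in> cubes n j"
      by (rule mult[OF g0 subsetD[OF dec k]])
    then have g1: "?g1 \<in> cubes n j"
      using c by simp
    have c0: "(\<lambda>\<epsilon>. commutator (?f0 \<epsilon>) (?g0 \<epsilon>)) \<in> cubes n (i + j)"
      by (rule comm[OF f0 g0])
    \<comment> \<open>\<open>[f\<^sub>0 h, g\<^sub>0 k]\<close> differs from \<open>[f\<^sub>0, g\<^sub>0]\<close> by conjugates of \<open>[h, g\<^sub>0 k]\<close> and \<open>[f\<^sub>0, k]\<close>\<close>
    have 1: "(\<lambda>\<epsilon>. commutator (?h \<epsilon>) (?g1 \<epsilon>)) \<in> cubes n (Suc (i + j))"
      using comm[OF h g1] by simp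
    have 2: "(\<lambda>\<epsilon>. commutator (?f0 \<epsilon>) (?k \<epsilon>)) \<in> cubes n (Suc (i + j))"
      using comm[OF f0 k] by simp
    have "(\<lambda>\<epsilon>. inv (commutator (?f0 \<epsilon>) (?g0 \<epsilon>)) \<otimes> (?f0 \<epsilon> \<otimes> commutator (?h \<epsilon>) (?g1 \<epsilon>) \<otimes> inv (?f0 \<epsilon>))
        \<otimes> inv (inv (commutator (?f0 \<epsilon>) (?g0 \<epsilon>)))
        \<otimes> (?g0 \<epsilon> \<otimes> commutator (?f0 \<epsilon>) (?k \<epsilon>) \<otimes> inv (?g0 \<epsilon>))) \<in> cubes n (Suc (i + j))"
      by (rule mult[OF conj[OF conj[OF 1 f0] inv[OF c0]] conj[OF 2 g0]])
    moreover have "inv (commutator (?f0 \<epsilon>) (?g0 \<epsilon>)) \<otimes> (?f0 \<epsilon> \<otimes> commutator (?h \<epsilon>) (?g1 \<epsilon>) \<otimes> inv (?f0 \<epsilon>))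
        \<otimes> inv (inv (commutator (?f0 \<epsilon>) (?g0 \<epsilon>))) \<otimes> (?g0 \<epsilon> \<otimes> commutator (?f0 \<epsilon>) (?k \<epsilon>) \<otimes> inv (?g0 \<epsilon>))
      = inv (commutator (f (False # \<epsilon>)) (g (False # \<epsilon>))) \<otimes> commutator (f (True # \<epsilon>)) (g (True # \<epsilon>))" for \<epsilon>
    proof -
      let ?a = "f (False # \<epsilon>)" and ?b = "g (False # \<epsilon>)" and ?a' = "f (True # \<epsilon>)" and ?b' = "g (True # \<epsilon>)"
      have "commutator ?a' ?b' = commutator (?a \<otimes> ?h \<epsilon>) ?b'"
        using c by simp
      also have "\<dots> = ?a \<otimes> commutator (?h \<epsilon>) ?b' \<otimes> inv ?a \<otimes> commutator ?a ?b'"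
        using c by (intro commutator_mult_left) auto
      also have "commutator ?a ?b' = commutator ?a (?b \<otimes> ?k \<epsilon>)"
        using c by simp
      also have "\<dots> = commutator ?a ?b \<otimes> (?b \<otimes> commutator ?a (?k \<epsilon>) \<otimes> inv ?b)"
        using c by (intro commutator_mult_right) auto
      finally have e: "commutator ?a' ?b' = ?a \<otimes> commutator (?h \<epsilon>) ?b' \<otimes> inv ?a \<otimes>
          (commutator ?a ?b \<otimes> (?b \<otimes> commutator ?a (?k \<epsilon>) \<otimes> inv ?b))" .
      show ?thesis
        unfolding e using c by (simp add: m_assoc)
    qed
    ultimately have "(\<lambda>\<epsilon>. inv (commutator (f (False # \<epsilon>)) (g (False # \<epsilon>))) \<otimes> commutator (f (True # \<epsilon>)) (g (True # \<epsilon>)))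
        \<in> cubes n (Suc (i + j))"
      by (simp only:)
    then show "(\<lambda>\<epsilon>. commutator (f \<epsilon>) (g \<epsilon>)) \<in> cubes (Suc n) (i + j)"
      using c c0 by auto
  qed
qed

lemma cubes_mult: "f \<in> cubes n i \<Longrightarrow> g \<in> cubes n i \<Longrightarrow> (\<lambda>\<epsilon>. f \<epsilon> \<otimes> g \<epsilon>) \<in> cubes n i"
  and cubes_inv: "f \<in> cubes n i \<Longrightarrow> (\<lambda>\<epsilon>. inv (f \<epsilon>)) \<in> cubes n i"
  and cubes_comm: "f \<in> cubes n i \<Longrightarrow> g \<in> cubes n j \<Longrightarrow> (\<lambda>\<epsilon>. commutator (f \<epsilon>) (g \<epsilon>)) \<in> cubes n (i + j)"
  using cubes_group[of n] by blast+

lemma cubes_antimono: "i \<le> j \<Longrightarrow> cubes n j \<subseteq> cubes n i"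
  using lift_Suc_antimono_le[of "cubes n"] cubes_group[of n] by blast

lemma cubes_conj:
  assumes f: "f \<in> cubes n i" and g: "g \<in> cubes n j"
  shows "(\<lambda>\<epsilon>. g \<epsilon> \<otimes> f \<epsilon> \<otimes> inv (g \<epsilon>)) \<in> cubes n i"
proof -
  have "(\<lambda>\<epsilon>. commutator (g \<epsilon>) (f \<epsilon>) \<otimes> f \<epsilon>) \<in> cubes n i"
    using cubes_comm[OF g f] cubes_antimono[of i "j + i" n] by (intro cubes_mult f) auto
  then show ?thesis
    using cubes_carrier[OF f] cubes_carrier[OF g] by (simp add: conj_eq_commutator)
qed

lemma cubes_const: "a \<in> B i \<Longrightarrow> (\<lambda>\<epsilon>. a) \<in> cubes n i"
proof (induction n arbitrary: a i)
  case 0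
  then show ?case
    using subgroup.mem_carrier[OF B_subgroup] by auto
next
  case (Suc n)
  then have "a \<in> carrier G"
    using subgroup.mem_carrier[OF B_subgroup] by auto
  then show ?case
    using Suc.IH[OF Suc.prems] Suc.IH[of \<one> "Suc i"] subgroup.one_closed[OF B_subgroup] by auto
qed

end

section \<open>A filtration cut out by the upper central series\<close>

locale nilpotent_class = group G for G (structure) +
  fixes d :: nat
  assumes class_pos: "d \<ge> 1" and upper_central_class: "upper_central d = carrier G"
begin

text \<open>
  A filtration adapted to the upper central series \<open>Z\<^sub>k\<close>. Taking the lower central series instead
  would require Mal'cev's theorem that a lattice is discrete modulo each of its terms, whereas
  discreteness modulo \<open>Z\<^sub>k\<close> is elementary and is inherited by \<open>lowering\<close>.
\<close>

definition lowering :: "nat \<Rightarrow> 'a set" where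
  "lowering j =
     {g \<in> carrier G. \<forall>k\<le>d. \<forall>z\<in>upper_central k. commutator g z \<in> upper_central (k - j)}"

text \<open>
  The group \<open>lowering j\<close> contains the centre for every \<open>j\<close>, while the last vertex of a
  \<open>(d + 1)\<close>-dimensional cube is determined by the others only if the terms beyond \<open>d\<close> are trivial.
  Cutting off is compatible with commutators, since \<open>lowering j\<close> is contained in
  \<open>Z\<^sub>d\<^sub>-\<^sub>j\<^sub>+\<^sub>1\<close>.
\<close>

definition central_filtration :: "nat \<Rightarrow> 'a set" where
  "central_filtration j = (if j \<le> d then lowering j else {\<one>})"

lemma lowering_carrier: "g \<in> lowering j \<Longrightarrow> g \<in> carrier G"
  by (simp add: lowering_def)

lemma loweringD:
  "g \<in> lowering j \<Longrightarrow> k \<le> d \<Longrightarrow> z \<in> upper_central k \<Longrightarrow> commutator g z \<in> upper_central (k - j)"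
  by (simp add: lowering_def)

lemma lowering_subgroup: "subgroup (lowering j) G"
proof (rule subgroupI)
  have "commutator \<one> z \<in> upper_central (k - j)" if "z \<in> upper_central k" for k z
    using upper_central_props(1) commutator_one(2)[OF upper_central_props(2)[OF that]] by simp
  then have "\<one> \<in> lowering j"
    by (simp add: lowering_def)
  then show "lowering j \<noteq> {}"
    by blast
  fix a assume a: "a \<in> lowering j"
  have "commutator (inv a) z \<in> upper_central (k - j)" if "k \<le> d" "z \<in> upper_central k" for k z
    using upper_central_conj(2)[OF lowering_carrier[OF a] upper_central_props(3)[OF loweringD[OF a that]]]
      lowering_carrier[OF a] upper_central_props(2)[OF that(2)]
    by (simp add: commutator_inv_left)
  then show "inv a \<in> lowering j"
    using lowering_carrier[OF a] by (simp add: lowering_def)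
  fix b assume b: "b \<in> lowering j"
  have "commutator (a \<otimes> b) z \<in> upper_central (k - j)" if "k \<le> d" "z \<in> upper_central k" for k z
    using upper_central_props(4)[OF
        upper_central_conj(1)[OF lowering_carrier[OF a] loweringD[OF b that]] loweringD[OF a that]]
      lowering_carrier[OF a] lowering_carrier[OF b] upper_central_props(2)[OF that(2)]
    by (simp add: commutator_mult_left)
  then show "a \<otimes> b \<in> lowering j"
    using lowering_carrier[OF a] lowering_carrier[OF b] by (simp add: lowering_def)
qed (auto simp: lowering_def)

lemma lowering_conj:
  assumes g: "g \<in> lowering j" and h: "h \<in> carrier G"
  shows "h \<otimes> g \<otimes> inv h \<in> lowering j"
proof -
  have "commutator (h \<otimes> g \<otimes> inv h) z \<in> upper_central (k - j)" if k: "k \<le> d" "z \<in> upper_central k" for k z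
  proof -
    have zc: "z \<in> carrier G" by (rule upper_central_props(2)[OF k(2)])
    have "commutator (h \<otimes> g \<otimes> inv h) z = h \<otimes> commutator g (inv h \<otimes> z \<otimes> h) \<otimes> inv h"
      using lowering_carrier[OF g] h zc by (simp add: commutator_def free_group_simps)
    moreover have "commutator g (inv h \<otimes> z \<otimes> h) \<in> upper_central (k - j)"
      by (rule loweringD[OF g k(1) upper_central_conj(2)[OF h k(2)]])
    ultimately show ?thesis
      using upper_central_conj(1)[OF h] by simp
  qed
  then show ?thesis
    using lowering_carrier[OF g] h by (simp add: lowering_def)
qed

lemma lowering_0: "lowering 0 = carrier G"
proof -
  have "commutator g z \<in> upper_central k" if g: "g \<in> carrier G" and z: "z \<in> upper_central k" for g z k
    unfolding commutator_def
    by (rule upper_central_props(4)[OF upper_central_conj(1)[OF g z] upper_central_props(3)[OF z]])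
  then show ?thesis
    by (auto simp: lowering_def)
qed

lemma lowering_1: "lowering 1 = carrier G"
proof -
  have "commutator g z \<in> upper_central (k - 1)" if g: "g \<in> carrier G" and z: "z \<in> upper_central k" for g z k
  proof (cases k)
    case 0
    then show ?thesis using g z by simp
  next
    case (Suc m)
    then show ?thesis using upper_central_commutator(2)[of z m g] g z by simp
  qed
  then show ?thesis
    by (auto simp: lowering_def)
qed

lemma lowering_Suc: "lowering (Suc j) \<subseteq> lowering j"
proof
  fix g assume g: "g \<in> lowering (Suc j)"
  have "commutator g z \<in> upper_central (k - j)" if "k \<le> d" "z \<in> upper_central k" for k z
    by (rule subsetD[OF upper_central_mono loweringD[OF g that]]) simp
  then show "g \<in> lowering j"
    using lowering_carrier[OF g] by (simp add: lowering_def)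
qed

lemma lowering_subset_upper_central: "lowering j \<subseteq> upper_central (Suc (d - j))"
  using loweringD[of _ j d] lowering_carrier by (auto simp: upper_central_class)

text \<open>
  The three subgroups lemma in its elementwise form, the Hall--Witt identity: of the three iterated
  commutators of \<open>a\<close>, \<open>b\<close> and an element of \<open>Z\<^sub>k\<close>, two lie in \<open>Z\<^sub>k\<^sub>-\<^sub>i\<^sub>-\<^sub>j\<close>, hence so does the third.
\<close>

lemma lowering_commutator:
  assumes a: "a \<in> lowering i" and b: "b \<in> lowering j"
  shows "commutator a b \<in> lowering (i + j)"
proof -
  note ac = lowering_carrier[OF a] and bc = lowering_carrier[OF b]
  have "commutator (commutator a b) w \<in> upper_central (k - (i + j))" if k: "k \<le> d" and w: "w \<in> upper_central k" for k w
  proof -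
    define z where "z = inv b \<otimes> w \<otimes> b"
    have z: "z \<in> upper_central k"
      unfolding z_def by (rule upper_central_conj(2)[OF bc w])
    note zc = upper_central_props(2)[OF z] and wc = upper_central_props(2)[OF w]
    have w_eq: "w = b \<otimes> z \<otimes> inv b"
      using bc wc by (simp add: z_def m_assoc)
    have 1: "commutator (commutator b z) (z \<otimes> a \<otimes> inv z) \<in> upper_central (k - (i + j))"
    proof -
      have "commutator (z \<otimes> a \<otimes> inv z) (commutator b z) \<in> upper_central (k - j - i)"
        by (rule loweringD[OF lowering_conj[OF a zc] _ loweringD[OF b k z]]) (use k in simp)
      from upper_central_props(3)[OF this] show ?thesis
        using ac bc zc by (simp add: inv_commutator add.commute)
    qed
    have 2: "commutator (commutator z a) (a \<otimes> b \<otimes> inv a) \<in> upper_central (k - (i + j))"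
    proof -
      have "inv (commutator a z) \<in> upper_central (k - i)"
        by (rule upper_central_props(3)[OF loweringD[OF a k z]])
      then have "commutator z a \<in> upper_central (k - i)"
        using ac zc by (simp add: inv_commutator)
      then have "commutator (a \<otimes> b \<otimes> inv a) (commutator z a) \<in> upper_central (k - i - j)"
        by (rule loweringD[OF lowering_conj[OF b ac], rotated]) (use k in simp)
      from upper_central_props(3)[OF this] show ?thesis
        using ac bc zc by (simp add: inv_commutator)
    qed
    let ?x = "commutator (commutator b z) (z \<otimes> a \<otimes> inv z)"
      and ?y = "commutator (commutator z a) (a \<otimes> b \<otimes> inv a)"
    have "commutator (commutator a b) (b \<otimes> z \<otimes> inv b) \<otimes> ?x \<otimes> ?y = \<one>"
      by (rule hall_witt[OF ac bc zc])
    then have "commutator (commutator a b) w \<otimes> (?x \<otimes> ?y) = \<one>"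
      unfolding w_eq using ac bc zc by (simp add: m_assoc)
    then have "commutator (commutator a b) w = inv (?x \<otimes> ?y)"
      using ac bc zc wc by (intro inv_equality[symmetric]) auto
    then show ?thesis
      using upper_central_props(3)[OF upper_central_props(4)[OF 1 2]] by simp
  qed
  then show ?thesis
    using ac bc by (simp add: lowering_def)
qed

sublocale group_filtration G central_filtration
proof (rule group_filtration.intro[OF group_axioms], rule group_filtration_axioms.intro)
  show "subgroup (central_filtration i) G" for i
    using lowering_subgroup triv_subgroup by (simp add: central_filtration_def)
  show "central_filtration 0 = carrier G"
    by (simp add: central_filtration_def lowering_0)
  show "central_filtration (Suc i) \<subseteq> central_filtration i" for i
    using lowering_Suc[of i] subgroup.one_closed[OF lowering_subgroup] by (auto simp: central_filtration_def)
  fix a b i j assume a: "a \<in> central_filtration i" and b: "b \<in> central_filtration j"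
  show "commutator a b \<in> central_filtration (i + j)"
  proof (cases "i \<le> d \<and> j \<le> d")
    case False
    have "a \<in> carrier G" "b \<in> carrier G"
      using a b lowering_carrier by (auto simp: central_filtration_def split: if_splits)
    then have "commutator a b = \<one>"
      using False a b by (auto simp: central_filtration_def split: if_splits)
    then show ?thesis
      using subgroup.one_closed[OF lowering_subgroup] by (simp add: central_filtration_def)
  next
    case True
    then have ab: "a \<in> lowering i" "b \<in> lowering j"
      using a b by (auto simp: central_filtration_def)
    show ?thesis
    proof (cases "i + j \<le> d")
      case False
      then have "j \<ge> 1"
        using True by auto
      then have "Suc (d - j) \<le> d" "Suc (d - j) - i = 0"
        using True False by auto
      then have "commutator a b = \<one>"
        using loweringD[OF ab(1) _ subsetD[OF lowering_subset_upper_central ab(2)]] by simp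
      then show ?thesis
        using False by (simp add: central_filtration_def)
    qed (simp add: central_filtration_def lowering_commutator[OF ab])
  qed
qed

lemma central_filtration_1: "central_filtration 1 = carrier G"
  using class_pos lowering_1 by (simp add: central_filtration_def)

end

section \<open>Groups with small neighbourhoods of the identity\<close>

text \<open>
  The identity neighbourhoods of a topological group without small subgroups, reduced to their
  algebraic properties. These pass to subgroups on a different carrier by mere intersection.
\<close>

locale group_nbhds = group G for G (structure) +
  fixes \<U> :: "'a set set"
  assumes nb_carrier: "carrier G \<in> \<U>"
    and nb_subset: "U \<in> \<U> \<Longrightarrow> U \<subseteq> carrier G"
    and nb_one: "U \<in> \<U> \<Longrightarrow> \<one> \<in> U"
    and nb_Int: "U \<in> \<U> \<Longrightarrow> V \<in> \<U> \<Longrightarrow> U \<inter> V \<in> \<U>"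
    and nb_mult: "U \<in> \<U> \<Longrightarrow> \<exists>V\<in>\<U>. \<forall>x\<in>V. \<forall>y\<in>V. x \<otimes> y \<in> U"
    and nb_inv: "U \<in> \<U> \<Longrightarrow> \<exists>V\<in>\<U>. \<forall>x\<in>V. inv x \<in> U"
    and nb_conj: "U \<in> \<U> \<Longrightarrow> g \<in> carrier G \<Longrightarrow> \<exists>V\<in>\<U>. \<forall>v\<in>V. g \<otimes> v \<otimes> inv g \<in> U"
    and no_small_subgroups: "\<exists>U\<in>\<U>. \<forall>H. subgroup H G \<longrightarrow> H \<subseteq> U \<longrightarrow> H = {\<one>}"
begin

lemma mem_set_mult: "x \<in> A <#> B \<longleftrightarrow> (\<exists>a\<in>A. \<exists>b\<in>B. x = a \<otimes> b)"
  by (auto simp: set_mult_def)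

lemma set_multI: "a \<in> A \<Longrightarrow> b \<in> B \<Longrightarrow> x = a \<otimes> b \<Longrightarrow> x \<in> A <#> B"
  by (auto simp: mem_set_mult)

lemma nb_quotient:
  assumes "U \<in> \<U>"
  shows "\<exists>V\<in>\<U>. \<forall>x\<in>V. \<forall>y\<in>V. inv x \<otimes> y \<in> U"
proof -
  obtain V where V: "V \<in> \<U>" "\<forall>x\<in>V. \<forall>y\<in>V. x \<otimes> y \<in> U"
    using nb_mult[OF assms] by (rule bexE)
  obtain W where W: "W \<in> \<U>" "\<forall>x\<in>W. inv x \<in> V"
    using nb_inv[OF V(1)] by (rule bexE)
  show ?thesis
    using nb_Int[OF V(1) W(1)] V(2) W(2) by (intro bexI[of _ "V \<inter> W"]) auto
qed

text \<open>
  Equicontinuity at the identity of the conjugations by elements of \<open>A\<close>, the property of compact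
  sets by which commutators with elements of \<open>A\<close> are uniformly small.
\<close>

definition bounded_set :: "'a set \<Rightarrow> bool" where
  "bounded_set A \<longleftrightarrow> A \<subseteq> carrier G \<and> (\<forall>U\<in>\<U>. \<exists>V\<in>\<U>. \<forall>a\<in>A. \<forall>v\<in>V. a \<otimes> v \<otimes> inv a \<in> U)"

lemma bounded_set_mono: "bounded_set A \<Longrightarrow> B \<subseteq> A \<Longrightarrow> bounded_set B"
  unfolding bounded_set_def by (meson subset_iff)

lemma bounded_set_empty: "bounded_set {}"
  using nb_carrier by (auto simp: bounded_set_def)

lemma bounded_set_Un:
  assumes A: "bounded_set A" and B: "bounded_set B"
  shows "bounded_set (A \<union> B)"
  unfolding bounded_set_def
proof (intro conjI ballI)
  show "A \<union> B \<subseteq> carrier G"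
    using A B by (simp add: bounded_set_def)
  fix U assume U: "U \<in> \<U>"
  obtain V where V: "V \<in> \<U>" "\<forall>a\<in>A. \<forall>v\<in>V. a \<otimes> v \<otimes> inv a \<in> U"
    using A U unfolding bounded_set_def by blast
  obtain W where W: "W \<in> \<U>" "\<forall>a\<in>B. \<forall>v\<in>W. a \<otimes> v \<otimes> inv a \<in> U"
    using B U unfolding bounded_set_def by blast
  show "\<exists>V\<in>\<U>. \<forall>a\<in>A \<union> B. \<forall>v\<in>V. a \<otimes> v \<otimes> inv a \<in> U"
    using V W nb_Int by (intro bexI[of _ "V \<inter> W"]) auto
qed

lemma bounded_set_UN: "finite I \<Longrightarrow> (\<And>i. i \<in> I \<Longrightarrow> bounded_set (A i)) \<Longrightarrow> bounded_set (\<Union>i\<in>I. A i)"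
  by (induction I rule: finite_induct) (auto simp: bounded_set_empty intro: bounded_set_Un)

lemma bounded_set_finite:
  assumes "finite A" "A \<subseteq> carrier G"
  shows "bounded_set A"
proof -
  have "bounded_set {a}" if "a \<in> A" for a
    using nb_conj assms that by (auto simp: bounded_set_def)
  then have "bounded_set (\<Union>a\<in>A. {a})"
    by (rule bounded_set_UN[OF assms(1)])
  then show ?thesis
    by simp
qed

lemma bounded_set_mult_right:
  assumes A: "bounded_set A" and g: "g \<in> carrier G"
  shows "bounded_set ((\<lambda>a. a \<otimes> g) ` A)"
  unfolding bounded_set_def
proof (intro conjI ballI)
  have Ac: "A \<subseteq> carrier G"
    using A by (simp add: bounded_set_def)
  then show "(\<lambda>a. a \<otimes> g) ` A \<subseteq> carrier G"
    using g by auto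
  fix U assume U: "U \<in> \<U>"
  obtain V where V: "V \<in> \<U>" "\<forall>a\<in>A. \<forall>v\<in>V. a \<otimes> v \<otimes> inv a \<in> U"
    using A U unfolding bounded_set_def by blast
  obtain W where W: "W \<in> \<U>" "\<forall>v\<in>W. g \<otimes> v \<otimes> inv g \<in> V"
    using nb_conj[OF V(1) g] by blast
  have "(a \<otimes> g) \<otimes> v \<otimes> inv (a \<otimes> g) \<in> U" if a: "a \<in> A" and v: "v \<in> W" for a v
  proof -
    have "a \<in> carrier G" "v \<in> carrier G"
      using a v Ac nb_subset[OF W(1)] by auto
    then have "(a \<otimes> g) \<otimes> v \<otimes> inv (a \<otimes> g) = a \<otimes> (g \<otimes> v \<otimes> inv g) \<otimes> inv a"
      using g by (simp add: free_group_simps)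
    then show ?thesis
      using V(2) W(2) a v by simp
  qed
  then show "\<exists>V\<in>\<U>. \<forall>a\<in>(\<lambda>a. a \<otimes> g) ` A. \<forall>v\<in>V. a \<otimes> v \<otimes> inv a \<in> U"
    using W(1) by auto
qed

text \<open>
  Here \<open>[v c, a] = v [c, a] v\<^sup>-\<^sup>1 [v, a]\<close>, where the first part lies in \<open>N\<close>, and
  \<open>[v, a] = v (a v\<^sup>-\<^sup>1 a\<^sup>-\<^sup>1)\<close> is small uniformly in \<open>a \<in> A\<close>.
\<close>

lemma small_commutators:
  assumes A: "bounded_set A" and U: "U \<in> \<U>"
  shows "\<exists>V\<in>\<U>. \<forall>N v c a. N \<lhd> G \<longrightarrow> v \<in> V \<longrightarrow> c \<in> carrier G \<longrightarrow> a \<in> A \<longrightarrow>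
    commutator c a \<in> N \<longrightarrow> commutator (v \<otimes> c) a \<in> U <#> N"
proof -
  obtain W where W: "W \<in> \<U>" "\<forall>x\<in>W. \<forall>y\<in>W. x \<otimes> y \<in> U"
    using nb_mult[OF U] by blast
  obtain W1 where W1: "W1 \<in> \<U>" "\<forall>a\<in>A. \<forall>v\<in>W1. a \<otimes> v \<otimes> inv a \<in> W"
    using A W(1) unfolding bounded_set_def by blast
  obtain W2 where W2: "W2 \<in> \<U>" "\<forall>v\<in>W2. inv v \<in> W1"
    using nb_inv[OF W1(1)] by blast
  show ?thesis
  proof (intro bexI[of _ "W \<inter> W2"] allI impI)
    show "W \<inter> W2 \<in> \<U>" by (rule nb_Int[OF W(1) W2(1)])
    fix N v c a assume N: "N \<lhd> G" and v: "v \<in> W \<inter> W2" and c: "c \<in> carrier G" and a: "a \<in> A"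
      and n: "commutator c a \<in> N"
    have ac: "a \<in> carrier G" and vc: "v \<in> carrier G"
      using A a v nb_subset[OF W(1)] by (auto simp: bounded_set_def)
    have "commutator v a = v \<otimes> (a \<otimes> inv v \<otimes> inv a)"
      using ac vc by (simp add: commutator_def m_assoc)
    then have "commutator v a \<in> U"
      using W W1 W2 v a by auto
    then show "commutator (v \<otimes> c) a \<in> U <#> N"
      using commutator_mod_left[OF N vc c ac n] by (auto simp: mem_set_mult)
  qed
qed

lemma nb_finite_Inter:
  assumes "finite I" and "\<And>i. i \<in> I \<Longrightarrow> \<exists>U\<in>\<U>. \<forall>x\<in>U. P i x"
  shows "\<exists>U\<in>\<U>. \<forall>i\<in>I. \<forall>x\<in>U. P i x"
  using assms
proof (induction I rule: finite_induct)
  case empty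
  then show ?case using nb_carrier by blast
next
  case (insert i I)
  obtain U where U: "U \<in> \<U>" "\<forall>i\<in>I. \<forall>x\<in>U. P i x"
    using insert.IH insert.prems by blast
  obtain V where V: "V \<in> \<U>" "\<forall>x\<in>V. P i x"
    using insert.prems by blast
  show ?case
    using nb_Int[OF U(1) V(1)] U(2) V(2) by (intro bexI[of _ "U \<inter> V"]) auto
qed

end

section \<open>Rigidity of cocompact lattices\<close>

text \<open>
  A finitely generated cocompact lattice in a nilpotent group. The compact set \<open>K\<close> of
  representatives enters through two consequences of compactness.
\<close>

locale nilpotent_lattice = group_nbhds G \<U> + nilpotent_class G d
  for G (structure) and \<U> and d +
  fixes \<Gamma> K S :: "'a set"
  assumes lattice_eq: "\<Gamma> = generate G S"
    and S: "finite S" "S \<subseteq> carrier G" "\<And>s. s \<in> S \<Longrightarrow> inv s \<in> S"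
    and discrete: "\<exists>U\<in>\<U>. U \<inter> \<Gamma> \<subseteq> {\<one>}"
    and K_bounded: "bounded_set K"
    and K_precompact: "\<And>U. U \<in> \<U> \<Longrightarrow> \<exists>F. finite F \<and> F \<subseteq> carrier G \<and> K \<subseteq> F <#> U"
    and covering: "carrier G = K <#> \<Gamma>"
begin

lemma lattice: "subgroup \<Gamma> G"
  unfolding lattice_eq by (rule generate_is_subgroup[OF S(2)])

lemmas lattice_carrier = subgroup.mem_carrier[OF lattice]
  and lattice_mult = subgroup.m_closed[OF lattice]
  and lattice_inv = subgroup.m_inv_closed[OF lattice]
  and lattice_one = subgroup.one_closed[OF lattice]

lemma lattice_commutator: "\<gamma> \<in> \<Gamma> \<Longrightarrow> \<delta> \<in> \<Gamma> \<Longrightarrow> commutator \<gamma> \<delta> \<in> \<Gamma>"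
  unfolding commutator_def by (intro lattice_mult lattice_inv)

lemma gens_in_lattice: "s \<in> S \<Longrightarrow> s \<in> \<Gamma>"
  unfolding lattice_eq by (rule generate.incl)

lemma K_carrier: "k \<in> K \<Longrightarrow> k \<in> carrier G"
  using K_bounded by (auto simp: bounded_set_def)

lemma coverE:
  assumes "g \<in> carrier G"
  obtains k \<gamma> where "k \<in> K" "\<gamma> \<in> \<Gamma>" "g = k \<otimes> \<gamma>"
  using assms covering mem_set_mult by metis

lemma commutator_in_normal_if_generators:
  assumes N: "N \<lhd> G" and x: "x \<in> carrier G" and F: "F \<subseteq> carrier G"
    and gen: "\<And>s. s \<in> F \<Longrightarrow> commutator x s \<in> N" and g: "g \<in> generate G F"
  shows "commutator x g \<in> N"
proof -
  have "generate G F \<subseteq> {g \<in> carrier G. commutator x g \<in> N}"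
    using gen F by (intro generate_subgroup_incl[OF _ subgroup_commutator_right[OF N x]]) auto
  then show ?thesis
    using g by blast
qed

text \<open>
  The absence of small subgroups in \<open>Z\<^sub>m\<^sub>+\<^sub>1/Z\<^sub>m\<close>, expressed in the group itself.
\<close>

definition nss_mod :: "'a set \<Rightarrow> nat \<Rightarrow> bool" where
  "nss_mod U m \<longleftrightarrow> (\<forall>H. subgroup H G \<longrightarrow> H \<subseteq> upper_central (Suc m) \<longrightarrow>
     H \<subseteq> U <#> upper_central m \<longrightarrow> H \<subseteq> upper_central m)"

lemma nss_mod_mono:
  assumes U: "nss_mod U m" and V: "V \<subseteq> U"
  shows "nss_mod V m"
  unfolding nss_mod_def
proof (intro allI impI)
  fix H assume H: "subgroup H G" "H \<subseteq> upper_central (Suc m)" "H \<subseteq> V <#> upper_central m"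
  have "H \<subseteq> U <#> upper_central m"
    using H(3) V by (force simp: mem_set_mult)
  then show "H \<subseteq> upper_central m"
    using U H(1,2) unfolding nss_mod_def by blast
qed

lemma central_conj:
  assumes x: "x \<in> upper_central (Suc m)" and g: "g \<in> carrier G"
  shows "\<exists>n\<in>upper_central m. g \<otimes> x \<otimes> inv g = x \<otimes> n"
proof
  note xc = upper_central_props(2)[OF x]
  show "inv x \<otimes> commutator g x \<otimes> x \<in> upper_central m"
    by (rule upper_central_conj(2)[OF xc upper_central_commutator(2)[OF x g]])
  show "g \<otimes> x \<otimes> inv g = x \<otimes> (inv x \<otimes> commutator g x \<otimes> x)"
    using xc g by (simp add: conj_eq_commutator) (simp add: m_assoc)
qed

text \<open>
  The image of a homomorphism into \<open>Z\<^sub>m\<^sub>+\<^sub>1/Z\<^sub>m\<close> is a subgroup, so it is trivial as soon as all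
  values are small.
\<close>

lemma nss_mod_hom_trivial:
  assumes U: "U \<in> \<U>" "nss_mod U m" and D: "subgroup D G"
    and \<phi>: "\<And>z. z \<in> D \<Longrightarrow> \<phi> z \<in> upper_central (Suc m)"
    and mult: "\<And>z z'. z \<in> D \<Longrightarrow> z' \<in> D \<Longrightarrow> \<exists>n\<in>upper_central m. \<phi> (z \<otimes> z') = \<phi> z \<otimes> \<phi> z' \<otimes> n"
    and small: "\<And>z. z \<in> D \<Longrightarrow> \<phi> z \<in> U <#> upper_central m"
    and z: "z \<in> D"
  shows "\<phi> z \<in> upper_central m"
proof -
  let ?H = "{\<phi> z \<otimes> n | z n. z \<in> D \<and> n \<in> upper_central m}"
  have "subgroup ?H G"
    using upper_central_props(2)[OF \<phi>] mult by (intro subgroup_image_mod[OF upper_central_normal D])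
  moreover have "?H \<subseteq> upper_central (Suc m)"
  proof
    fix y assume "y \<in> ?H"
    then obtain z n where "z \<in> D" "n \<in> upper_central m" "y = \<phi> z \<otimes> n"
      by blast
    then show "y \<in> upper_central (Suc m)"
      using upper_central_props(4)[OF \<phi> subsetD[OF upper_central_Suc_mono]] by metis
  qed
  moreover have "?H \<subseteq> U <#> upper_central m"
  proof
    fix y assume "y \<in> ?H"
    then obtain z n where zn: "z \<in> D" "n \<in> upper_central m" "y = \<phi> z \<otimes> n"
      by blast
    obtain u n' where u: "u \<in> U" "n' \<in> upper_central m" "\<phi> z = u \<otimes> n'"
      using small[OF zn(1)] by (auto simp only: mem_set_mult)
    have "y = u \<otimes> (n' \<otimes> n)"
      using zn(3) u(3) subsetD[OF nb_subset[OF U(1)] u(1)] upper_central_props(2)[OF zn(2)]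
        upper_central_props(2)[OF u(2)] by (simp add: m_assoc)
    then show "y \<in> U <#> upper_central m"
      by (rule set_multI[OF u(1) upper_central_props(4)[OF u(2) zn(2)]])
  qed
  ultimately have "?H \<subseteq> upper_central m"
    using U(2) unfolding nss_mod_def by blast
  moreover have "\<phi> z = \<phi> z \<otimes> \<one>"
    using upper_central_props(2)[OF \<phi>[OF z]] by simp
  then have "\<phi> z \<in> ?H"
    using z upper_central_props(1) by blast
  ultimately show ?thesis by blast
qed

text \<open>
  The property climbs up the central series. For a subgroup \<open>H\<close> of \<open>Z\<^sub>m\<^sub>+\<^sub>2\<close> close to \<open>Z\<^sub>m\<^sub>+\<^sub>1\<close> and a
  fixed \<open>a\<close> in \<open>K\<close> or \<open>S\<close>, the map \<open>h \<mapsto> [h, a]\<close> is a homomorphism from \<open>H\<close> to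
  \<open>Z\<^sub>m\<^sub>+\<^sub>1/Z\<^sub>m\<close> with small values, hence trivial. So modulo \<open>Z\<^sub>m\<close> the group \<open>H\<close> commutes with \<open>K\<close> and
  with \<open>\<Gamma>\<close>, and thus with everything, which means \<open>H \<subseteq> Z\<^sub>m\<^sub>+\<^sub>1\<close>.
\<close>

lemma exists_nss_mod: "\<exists>U\<in>\<U>. nss_mod U m"
proof (induction m)
  case 0
  obtain U where U: "U \<in> \<U>" "\<forall>H. subgroup H G \<longrightarrow> H \<subseteq> U \<longrightarrow> H = {\<one>}"
    using no_small_subgroups by blast
  have "nss_mod U 0"
    unfolding nss_mod_def
  proof (intro allI impI)
    fix H assume H: "subgroup H G" "H \<subseteq> U <#> upper_central 0"
    have "H \<subseteq> U"
      using H(2) nb_subset[OF U(1)] by (force simp: mem_set_mult)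
    then show "H \<subseteq> upper_central 0"
      using U(2) H(1) by simp
  qed
  then show ?case
    using U(1) by blast
next
  case (Suc m)
  then obtain U where U: "U \<in> \<U>" "nss_mod U m"
    by blast
  have KS: "bounded_set (K \<union> S)"
    by (rule bounded_set_Un[OF K_bounded bounded_set_finite[OF S(1,2)]])
  obtain V where V: "V \<in> \<U>" and small:
    "\<forall>N v c a. N \<lhd> G \<longrightarrow> v \<in> V \<longrightarrow> c \<in> carrier G \<longrightarrow> a \<in> K \<union> S \<longrightarrow> commutator c a \<in> N \<longrightarrow>
       commutator (v \<otimes> c) a \<in> U <#> N"
    using small_commutators[OF KS U(1)] by (elim bexE)
  have "nss_mod V (Suc m)"
    unfolding nss_mod_def
  proof (intro allI impI)
    fix H assume H: "subgroup H G" "H \<subseteq> upper_central (Suc (Suc m))" "H \<subseteq> V <#> upper_central (Suc m)"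
    note Hc = subgroup.mem_carrier[OF H(1)]
    have KSc: "a \<in> carrier G" if "a \<in> K \<union> S" for a
      using that K_carrier S(2) by blast
    have 1: "commutator h a \<in> upper_central m" if h: "h \<in> H" and a: "a \<in> K \<union> S" for h a
    proof -
      note ac = KSc[OF a]
      have Hz: "commutator h a \<in> upper_central (Suc m)" if "h \<in> H" for h
        by (rule upper_central_commutator(1)[OF subsetD[OF H(2) that] ac])
      show ?thesis
      proof (rule nss_mod_hom_trivial[OF U H(1) Hz])
        fix h h' assume h: "h \<in> H" and h': "h' \<in> H"
        let ?x = "commutator h a" and ?y = "commutator h' a"
        have xc: "?x \<in> carrier G" and yc: "?y \<in> carrier G"
          using Hc h h' ac by auto
        obtain n where n: "n \<in> upper_central m" "h \<otimes> ?y \<otimes> inv h = ?y \<otimes> n"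
          using central_conj[OF Hz[OF h'] Hc[OF h]] by (elim bexE)
        have yn: "?y \<otimes> n \<in> upper_central (Suc m)"
          by (rule upper_central_props(4)[OF Hz[OF h'] subsetD[OF upper_central_Suc_mono n(1)]])
        obtain n' where n': "n' \<in> upper_central m" "inv ?x \<otimes> (?y \<otimes> n) \<otimes> inv (inv ?x) = (?y \<otimes> n) \<otimes> n'"
          using central_conj[OF yn inv_closed[OF xc]] by (elim bexE)
        note nc = upper_central_props(2)[OF n(1)] upper_central_props(2)[OF n'(1)]
        have "commutator (h \<otimes> h') a = ?y \<otimes> n \<otimes> ?x"
          by (simp only: commutator_mult_left[OF Hc[OF h] Hc[OF h'] ac] n(2))
        also have "\<dots> = ?x \<otimes> (inv ?x \<otimes> (?y \<otimes> n) \<otimes> inv (inv ?x))"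
          using xc yc nc by (simp add: m_assoc)
        also have "\<dots> = ?x \<otimes> ?y \<otimes> (n \<otimes> n')"
          unfolding n'(2) using xc yc nc by (simp add: m_assoc)
        finally show "\<exists>n\<in>upper_central m. commutator (h \<otimes> h') a = ?x \<otimes> ?y \<otimes> n"
          by (rule bexI[OF _ upper_central_props(4)[OF n(1) n'(1)]])
      next
        fix h assume h: "h \<in> H"
        obtain v c where vc: "v \<in> V" "c \<in> upper_central (Suc m)" "h = v \<otimes> c"
          using subsetD[OF H(3) h] by (auto simp only: mem_set_mult)
        show "commutator h a \<in> U <#> upper_central m"
          unfolding vc(3)
          by (rule small[rule_format, OF upper_central_normal vc(1) upper_central_props(2)[OF vc(2)] a
                upper_central_commutator(1)[OF vc(2) ac]])
      qed (assumption | rule h)+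
    qed
    show "H \<subseteq> upper_central (Suc m)"
    proof
      fix h assume h: "h \<in> H"
      note hc = Hc[OF h]
      have \<Gamma>: "commutator h \<gamma> \<in> upper_central m" if "\<gamma> \<in> \<Gamma>" for \<gamma>
        by (rule commutator_in_normal_if_generators[OF upper_central_normal hc S(2)])
          (use 1[OF h] that lattice_eq in auto)
      have "commutator h g \<in> upper_central m" if g: "g \<in> carrier G" for g
      proof -
        obtain k \<gamma> where k: "k \<in> K" "\<gamma> \<in> \<Gamma>" "g = k \<otimes> \<gamma>"
          using g by (rule coverE)
        obtain n where n: "n \<in> upper_central m" "commutator h (k \<otimes> \<gamma>) = commutator h k \<otimes> n"
          using commutator_mod_right[OF upper_central_normal hc K_carrier[OF k(1)] lattice_carrier[OF k(2)] \<Gamma>[OF k(2)]]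
          by blast
        then show ?thesis
          using upper_central_props(4)[OF 1[OF h UnI1[OF k(1)]] n(1)] k(3) by simp
      qed
      then show "h \<in> upper_central (Suc m)"
        using hc by simp
    qed
  qed
  then show ?case
    using V by blast
qed

text \<open>
  The homomorphism \<open>z \<mapsto> [x, z]\<close> from \<open>D\<close> to \<open>Z\<^sub>m\<^sub>+\<^sub>1/Z\<^sub>m\<close> vanishes on \<open>\<Delta>\<close>, so all its values are
  attained on \<open>A\<close>, where they are small. This is how compactness extends commutator relations from
  a lattice to the group.
\<close>

lemma commutator_vanish:
  assumes U: "U \<in> \<U>" "nss_mod U m" and D: "subgroup D G" and x: "x \<in> carrier G"
    and central: "\<And>z. z \<in> D \<Longrightarrow> commutator x z \<in> upper_central (Suc m)"
    and cover: "\<And>z. z \<in> D \<Longrightarrow> \<exists>k\<in>A. \<exists>\<delta>\<in>\<Delta>. z = k \<otimes> \<delta>"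
    and A: "A \<subseteq> carrier G" "\<And>k. k \<in> A \<Longrightarrow> commutator x k \<in> U <#> upper_central m"
    and \<Delta>: "\<Delta> \<subseteq> carrier G" "\<And>\<delta>. \<delta> \<in> \<Delta> \<Longrightarrow> commutator x \<delta> \<in> upper_central m"
    and z: "z \<in> D"
  shows "commutator x z \<in> upper_central m"
proof -
  note Dc = subgroup.mem_carrier[OF D]
  show ?thesis
  proof (rule nss_mod_hom_trivial[OF U D central])
    fix z z' assume z: "z \<in> D" and z': "z' \<in> D"
    obtain n where n: "n \<in> upper_central m" "z \<otimes> commutator x z' \<otimes> inv z = commutator x z' \<otimes> n"
      using central_conj[OF central[OF z'] Dc[OF z]] by (elim bexE)
    have "commutator x (z \<otimes> z') = commutator x z \<otimes> commutator x z' \<otimes> n"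
      using commutator_mult_right[OF x Dc[OF z] Dc[OF z']] n x Dc[OF z] Dc[OF z'] upper_central_props(2)[OF n(1)]
      by (simp add: m_assoc)
    then show "\<exists>n\<in>upper_central m. commutator x (z \<otimes> z') = commutator x z \<otimes> commutator x z' \<otimes> n"
      using n(1) by (rule bexI)
  next
    fix z assume "z \<in> D"
    then obtain k \<delta> where k: "k \<in> A" "\<delta> \<in> \<Delta>" "z = k \<otimes> \<delta>"
      using cover by blast
    obtain n where n: "n \<in> upper_central m" "commutator x (k \<otimes> \<delta>) = commutator x k \<otimes> n"
      using commutator_mod_right[OF upper_central_normal x subsetD[OF A(1) k(1)] subsetD[OF \<Delta>(1) k(2)] \<Delta>(2)[OF k(2)]]
      by blast
    obtain u n' where u: "u \<in> U" "n' \<in> upper_central m" "commutator x k = u \<otimes> n'"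
      using A(2)[OF k(1)] by (auto simp only: mem_set_mult)
    have "commutator x z = u \<otimes> (n' \<otimes> n)"
      using k(3) n(2) u(3) subsetD[OF nb_subset[OF U(1)] u(1)] upper_central_props(2)[OF n(1)]
        upper_central_props(2)[OF u(2)] by (simp add: m_assoc)
    then show "commutator x z \<in> U <#> upper_central m"
      by (rule set_multI[OF u(1) upper_central_props(4)[OF u(2) n(1)]])
  qed (assumption | rule z)+
qed

text \<open>
  Let \<open>\<gamma> \<in> \<Gamma> \<inter> Z\<^sub>m\<^sub>+\<^sub>2\<close> be close to \<open>Z\<^sub>m\<^sub>+\<^sub>1\<close>. Its commutators with the finitely many generators of
  \<open>\<Gamma>\<close> belong to \<open>\<Gamma> \<inter> Z\<^sub>m\<^sub>+\<^sub>1\<close> and are close to \<open>Z\<^sub>m\<close>, hence lie in \<open>Z\<^sub>m\<close> by induction. So \<open>\<gamma>\<close>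
  commutes with \<open>\<Gamma>\<close> modulo \<open>Z\<^sub>m\<close>, and then with the whole group.
\<close>

lemma exists_discrete_mod_central:
  "\<exists>U\<in>\<U>. \<forall>\<gamma>\<in>\<Gamma>. \<gamma> \<in> upper_central (Suc m) \<longrightarrow> \<gamma> \<in> U <#> upper_central m \<longrightarrow> \<gamma> \<in> upper_central m"
proof (induction m)
  case 0
  obtain U where U: "U \<in> \<U>" "U \<inter> \<Gamma> \<subseteq> {\<one>}"
    using discrete by blast
  have "\<gamma> \<in> upper_central 0" if "\<gamma> \<in> \<Gamma>" "\<gamma> \<in> U <#> upper_central 0" for \<gamma>
    using that U(2) subsetD[OF nb_subset[OF U(1)]] by (auto simp: mem_set_mult)
  then show ?case
    using U(1) by blast
next
  case (Suc m)
  then obtain U1 where U1: "U1 \<in> \<U>"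
    and IH: "\<And>\<gamma>. \<gamma> \<in> \<Gamma> \<Longrightarrow> \<gamma> \<in> upper_central (Suc m) \<Longrightarrow> \<gamma> \<in> U1 <#> upper_central m \<Longrightarrow> \<gamma> \<in> upper_central m"
    by blast
  obtain U2 where U2: "U2 \<in> \<U>" "nss_mod U2 m"
    using exists_nss_mod by blast
  define U where "U = U1 \<inter> U2"
  have U: "U \<in> \<U>" "nss_mod U m"
    using nb_Int[OF U1 U2(1)] nss_mod_mono[OF U2(2)] by (auto simp: U_def)
  have KS: "bounded_set (K \<union> S)"
    by (rule bounded_set_Un[OF K_bounded bounded_set_finite[OF S(1,2)]])
  obtain V where V: "V \<in> \<U>" and small:
    "\<forall>N v c a. N \<lhd> G \<longrightarrow> v \<in> V \<longrightarrow> c \<in> carrier G \<longrightarrow> a \<in> K \<union> S \<longrightarrow> commutator c a \<in> N \<longrightarrow>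
       commutator (v \<otimes> c) a \<in> U <#> N"
    using small_commutators[OF KS U(1)] by (elim bexE)
  have "\<gamma> \<in> upper_central (Suc m)"
    if \<gamma>: "\<gamma> \<in> \<Gamma>" "\<gamma> \<in> upper_central (Suc (Suc m))" "\<gamma> \<in> V <#> upper_central (Suc m)" for \<gamma>
  proof -
    note \<gamma>c = lattice_carrier[OF \<gamma>(1)]
    obtain v c where vc: "v \<in> V" "c \<in> upper_central (Suc m)" "\<gamma> = v \<otimes> c"
      using \<gamma>(3) by (auto simp only: mem_set_mult)
    have KS_small: "commutator \<gamma> a \<in> U <#> upper_central m" if a: "a \<in> K \<union> S" for a
    proof -
      have "a \<in> carrier G"
        using a K_carrier S(2) by blast
      then show ?thesis
        unfolding vc(3)
        by (intro small[rule_format, OF upper_central_normal vc(1) upper_central_props(2)[OF vc(2)] a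
              upper_central_commutator(1)[OF vc(2)]])
    qed
    have S0: "commutator \<gamma> s \<in> upper_central m" if s: "s \<in> S" for s
    proof (rule IH)
      show "commutator \<gamma> s \<in> \<Gamma>"
        by (rule lattice_commutator[OF \<gamma>(1) gens_in_lattice[OF s]])
      show "commutator \<gamma> s \<in> upper_central (Suc m)"
        using s S(2) by (intro upper_central_commutator(1)[OF \<gamma>(2)]) auto
      show "commutator \<gamma> s \<in> U1 <#> upper_central m"
        using KS_small[of s] s by (auto simp: mem_set_mult U_def)
    qed
    have "commutator \<gamma> g \<in> upper_central m" if g: "g \<in> carrier G" for g
    proof (rule commutator_vanish[OF U subgroup_self \<gamma>c, where A = K and \<Delta> = \<Gamma>])
      show "commutator \<gamma> z \<in> upper_central (Suc m)" if "z \<in> carrier G" for z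
        by (rule upper_central_commutator(1)[OF \<gamma>(2) that])
      show "\<exists>k\<in>K. \<exists>\<delta>\<in>\<Gamma>. z = k \<otimes> \<delta>" if "z \<in> carrier G" for z
        using that by (rule coverE) blast
      show "commutator \<gamma> k \<in> U <#> upper_central m" if "k \<in> K" for k
        using KS_small that by blast
      show "commutator \<gamma> \<delta> \<in> upper_central m" if "\<delta> \<in> \<Gamma>" for \<delta>
        by (rule commutator_in_normal_if_generators[OF upper_central_normal \<gamma>c S(2) S0])
          (use that lattice_eq in auto)
    qed (use g K_carrier lattice_carrier in auto)
    then show ?thesis
      using \<gamma>c by simp
  qed
  then show ?case
    using V by blast
qed

text \<open>
  Downwards from \<open>Z\<^sub>d\<close>, the whole group: an element of \<open>\<Gamma>\<close> close to \<open>Z\<^sub>m\<close> is close to \<open>Z\<^sub>m\<^sub>+\<^sub>1\<close> and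
  therefore lies in it, which is the situation of the previous lemma.
\<close>

lemma exists_lattice_mod_central:
  assumes "m \<le> d"
  shows "\<exists>U\<in>\<U>. \<forall>\<gamma>\<in>\<Gamma>. \<gamma> \<in> U <#> upper_central m \<longrightarrow> \<gamma> \<in> upper_central m"
  using assms
proof (induction m rule: inc_induct)
  case base
  have "\<gamma> \<in> upper_central d" if "\<gamma> \<in> \<Gamma>" for \<gamma>
    using lattice_carrier[OF that] upper_central_class by simp
  then show ?case
    using nb_carrier by blast
next
  case (step m)
  obtain U1 where U1: "U1 \<in> \<U>" "\<forall>\<gamma>\<in>\<Gamma>. \<gamma> \<in> U1 <#> upper_central (Suc m) \<longrightarrow> \<gamma> \<in> upper_central (Suc m)"
    using step.IH by blast
  obtain U2 where U2: "U2 \<in> \<U>"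
    "\<forall>\<gamma>\<in>\<Gamma>. \<gamma> \<in> upper_central (Suc m) \<longrightarrow> \<gamma> \<in> U2 <#> upper_central m \<longrightarrow> \<gamma> \<in> upper_central m"
    using exists_discrete_mod_central by blast
  have "\<gamma> \<in> upper_central m" if \<gamma>: "\<gamma> \<in> \<Gamma>" "\<gamma> \<in> (U1 \<inter> U2) <#> upper_central m" for \<gamma>
  proof -
    obtain u c where u: "u \<in> U1" "u \<in> U2" "c \<in> upper_central m" "\<gamma> = u \<otimes> c"
      using \<gamma>(2) by (auto simp only: mem_set_mult)
    have "\<gamma> \<in> U1 <#> upper_central (Suc m)"
      using u subsetD[OF upper_central_Suc_mono u(3)] by (auto simp only: mem_set_mult)
    moreover have "\<gamma> \<in> U2 <#> upper_central m"
      using u by (auto simp only: mem_set_mult)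
    ultimately show ?thesis
      using U1(2) U2(2) \<gamma>(1) by blast
  qed
  then show ?case
    using nb_Int[OF U1(1) U2(1)] by blast
qed

text \<open>
  Cover \<open>K\<close> by finitely many small translates \<open>f V\<close>, and choose for each \<open>f\<close>, if possible, one
  \<open>g f \<in> \<Gamma>\<close> such that \<open>f V (g f)\<close> meets \<open>Z\<^sub>k\<close>. If \<open>z = a \<gamma>\<close> is in \<open>Z\<^sub>k\<close> with \<open>a \<in> f V\<close>, then
  \<open>\<gamma> (g f)\<^sup>-\<^sup>1\<close> is close to \<open>Z\<^sub>k\<close>, hence in \<open>Z\<^sub>k\<close>, and \<open>z\<close> is the product of \<open>a (g f)\<close> and
  \<open>(g f)\<^sup>-\<^sup>1 \<gamma>\<close>, both in \<open>Z\<^sub>k\<close>.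
\<close>

lemma upper_central_cocompact:
  assumes k: "k \<le> d"
  shows "\<exists>A. bounded_set A \<and> A \<subseteq> upper_central k \<and> upper_central k \<subseteq> A <#> (\<Gamma> \<inter> upper_central k)"
proof -
  let ?Z = "upper_central k"
  obtain U where U: "U \<in> \<U>" and disc: "\<forall>\<gamma>\<in>\<Gamma>. \<gamma> \<in> U <#> ?Z \<longrightarrow> \<gamma> \<in> ?Z"
    using exists_lattice_mod_central[OF k] by (elim bexE)
  obtain V where V: "V \<in> \<U>" "\<forall>x\<in>V. \<forall>y\<in>V. inv x \<otimes> y \<in> U"
    using nb_quotient[OF U] by (rule bexE)
  note Vc = subsetD[OF nb_subset[OF V(1)]]
  obtain F where F: "finite F" "F \<subseteq> carrier G" "K \<subseteq> F <#> V"
    using K_precompact[OF V(1)] by blast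
  define hit where "hit f \<gamma> \<longleftrightarrow> \<gamma> \<in> \<Gamma> \<and> (\<exists>v\<in>V. f \<otimes> v \<otimes> \<gamma> \<in> ?Z)" for f \<gamma>
  define g where "g f = (SOME \<gamma>. hit f \<gamma>)" for f
  have g: "hit f (g f)" if "hit f \<gamma>" for f \<gamma>
    unfolding g_def using that by (rule someI)
  define F' where "F' = {f \<in> F. hit f (g f)}"
  define A where "A = (\<Union>f\<in>F'. (\<lambda>a. a \<otimes> g f) ` K) \<inter> ?Z"
  have "bounded_set (\<Union>f\<in>F'. (\<lambda>a. a \<otimes> g f) ` K)"
  proof (rule bounded_set_UN)
    show "finite F'" using F(1) by (simp add: F'_def)
    fix f assume "f \<in> F'"
    then have "g f \<in> \<Gamma>" by (simp add: F'_def hit_def)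
    then show "bounded_set ((\<lambda>a. a \<otimes> g f) ` K)"
      by (intro bounded_set_mult_right[OF K_bounded] lattice_carrier)
  qed
  then have A: "bounded_set A"
    unfolding A_def by (rule bounded_set_mono) simp
  have "z \<in> A <#> (\<Gamma> \<inter> ?Z)" if z: "z \<in> ?Z" for z
  proof -
    note zc = upper_central_props(2)[OF z]
    obtain a \<gamma> where a: "a \<in> K" "\<gamma> \<in> \<Gamma>" "z = a \<otimes> \<gamma>"
      using zc by (rule coverE)
    obtain f u where f: "f \<in> F" "u \<in> V" "a = f \<otimes> u"
      using subsetD[OF F(3) a(1)] by (auto simp only: mem_set_mult)
    have "hit f \<gamma>"
      using a f z by (auto simp: hit_def)
    then have hg: "hit f (g f)"
      by (rule g)
    then obtain v where v: "v \<in> V" "f \<otimes> v \<otimes> g f \<in> ?Z" and g\<Gamma>: "g f \<in> \<Gamma>"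
      by (auto simp: hit_def)
    have c: "f \<in> carrier G" "u \<in> carrier G" "v \<in> carrier G" "g f \<in> carrier G" "\<gamma> \<in> carrier G"
      using subsetD[OF F(2) f(1)] Vc[OF f(2)] Vc[OF v(1)] lattice_carrier[OF g\<Gamma>] lattice_carrier[OF a(2)] by auto
    have "inv (f \<otimes> v \<otimes> g f) \<otimes> z \<in> ?Z"
      by (rule upper_central_props(4)[OF upper_central_props(3)[OF v(2)] z])
    then have "g f \<otimes> (inv (f \<otimes> v \<otimes> g f) \<otimes> z) \<otimes> inv (g f) \<in> ?Z"
      by (rule upper_central_conj(1)[OF c(4)])
    moreover have "g f \<otimes> (inv (f \<otimes> v \<otimes> g f) \<otimes> z) \<otimes> inv (g f) = inv v \<otimes> u \<otimes> (\<gamma> \<otimes> inv (g f))"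
      using c by (simp add: a f free_group_simps)
    ultimately have 1: "inv v \<otimes> u \<otimes> (\<gamma> \<otimes> inv (g f)) \<in> ?Z"
      by simp
    have "\<gamma> \<otimes> inv (g f) = (inv u \<otimes> v) \<otimes> (inv v \<otimes> u \<otimes> (\<gamma> \<otimes> inv (g f)))"
      using c by (simp add: m_assoc)
    then have "\<gamma> \<otimes> inv (g f) \<in> U <#> ?Z"
      using V(2) f(2) v(1) 1 by (intro set_multI[OF _ 1]) auto
    moreover have "\<gamma> \<otimes> inv (g f) \<in> \<Gamma>"
      by (rule lattice_mult[OF a(2) lattice_inv[OF g\<Gamma>]])
    ultimately have "\<gamma> \<otimes> inv (g f) \<in> ?Z"
      using disc by blast
    then have "inv (g f) \<otimes> (\<gamma> \<otimes> inv (g f)) \<otimes> g f \<in> ?Z"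
      by (rule upper_central_conj(2)[OF c(4)])
    then have 2: "inv (g f) \<otimes> \<gamma> \<in> ?Z"
      using c by (simp add: m_assoc)
    have 3: "inv (g f) \<otimes> \<gamma> \<in> \<Gamma>"
      by (rule lattice_mult[OF lattice_inv[OF g\<Gamma>] a(2)])
    have "a \<otimes> g f = z \<otimes> inv (inv (g f) \<otimes> \<gamma>)"
      using c K_carrier[OF a(1)] by (simp add: a(3) free_group_simps)
    then have 4: "a \<otimes> g f \<in> ?Z"
      using upper_central_props(4)[OF z upper_central_props(3)[OF 2]] by simp
    have "z = (a \<otimes> g f) \<otimes> (inv (g f) \<otimes> \<gamma>)"
      using c K_carrier[OF a(1)] by (simp add: a(3) m_assoc)
    moreover have "a \<otimes> g f \<in> A"
      using 4 a(1) f(1) hg by (auto simp: A_def F'_def)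
    ultimately show ?thesis
      using 2 3 mem_set_mult by blast
  qed
  then show ?thesis
    using A by (intro exI[of _ A]) (auto simp: A_def)
qed

text \<open>
  If \<open>\<gamma> \<in> \<Gamma>\<close> is close to \<open>lowering (j + 1)\<close>, it lies in \<open>lowering j\<close> by induction, so its commutators
  with \<open>Z\<^sub>k\<close> lie in \<open>Z\<^sub>k\<^sub>-\<^sub>j\<close>. Those with the finitely many generators of \<open>\<Gamma> \<inter> Z\<^sub>k\<close> are moreover
  elements of \<open>\<Gamma>\<close> close to \<open>Z\<^sub>k\<^sub>-\<^sub>j\<^sub>-\<^sub>1\<close>, hence in it, and cocompactness of \<open>\<Gamma> \<inter> Z\<^sub>k\<close> in \<open>Z\<^sub>k\<close>
  extends this to all of \<open>Z\<^sub>k\<close>.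
\<close>

lemma exists_lattice_mod_lowering:
  assumes "j \<le> d"
  shows "\<exists>U\<in>\<U>. \<forall>\<gamma>\<in>\<Gamma>. \<gamma> \<in> U <#> lowering j \<longrightarrow> \<gamma> \<in> lowering j"
  using assms
proof (induction j)
  case 0
  have "\<gamma> \<in> lowering 0" if "\<gamma> \<in> \<Gamma>" for \<gamma>
    using lattice_carrier[OF that] lowering_0 by simp
  then show ?case
    using nb_carrier by blast
next
  case (Suc j)
  then obtain U0 where U0: "U0 \<in> \<U>" "\<forall>\<gamma>\<in>\<Gamma>. \<gamma> \<in> U0 <#> lowering j \<longrightarrow> \<gamma> \<in> lowering j"
    by (auto simp: Suc_le_eq)
  have step: "\<exists>V\<in>\<U>. \<forall>v\<in>V. \<forall>c\<in>lowering (Suc j). v \<otimes> c \<in> \<Gamma> \<longrightarrow> v \<otimes> c \<in> lowering j \<longrightarrow>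
          (\<forall>z\<in>upper_central k. commutator (v \<otimes> c) z \<in> upper_central (k - Suc j))" if k: "k \<in> {..d}" for k
  proof (cases "k \<le> j")
    case True
    then have e: "k - j = 0" "k - Suc j = 0" by auto
    have "commutator x z \<in> upper_central (k - Suc j)" if x: "x \<in> lowering j" and z: "z \<in> upper_central k" for x z
      using loweringD[OF x _ z] k e by simp
    then show ?thesis
      using nb_carrier by blast
  next
    case False
    define m where "m = k - Suc j"
    have m: "k - j = Suc m"
      using False by (simp add: m_def)
    have kd: "k \<le> d" using k by simp
    let ?Z = "upper_central k"
    have sub: "subgroup (\<Gamma> \<inter> ?Z) G"
      by (rule subgroups_Inter_pair[OF lattice normal_imp_subgroup[OF upper_central_normal]])
    have "noetherian_subset \<Gamma>"
      unfolding lattice_eq by (rule noetherian_if_nilpotent[OF upper_central_class S])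
    then obtain F where F: "finite F" "F \<subseteq> carrier G" "\<Gamma> \<inter> ?Z = generate G F"
      using sub unfolding noetherian_subset_def by (meson Int_lower1)
    have FZ: "x \<in> \<Gamma>" "x \<in> ?Z" if "x \<in> F" for x
    proof -
      have "x \<in> \<Gamma> \<inter> ?Z"
        unfolding F(3) using that by (rule generate.incl)
      then show "x \<in> \<Gamma>" "x \<in> ?Z" by auto
    qed
    obtain A where A: "bounded_set A" "A \<subseteq> ?Z" "?Z \<subseteq> A <#> (\<Gamma> \<inter> ?Z)"
      using upper_central_cocompact[OF kd] by blast
    have AZ: "x \<in> ?Z" if "x \<in> A \<union> F" for x
      using that A(2) FZ by blast
    obtain U1 where U1: "U1 \<in> \<U>"
      "\<forall>\<gamma>\<in>\<Gamma>. \<gamma> \<in> upper_central (Suc m) \<longrightarrow> \<gamma> \<in> U1 <#> upper_central m \<longrightarrow> \<gamma> \<in> upper_central m"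
      using exists_discrete_mod_central[of m] by (elim bexE)
    obtain U2 where U2: "U2 \<in> \<U>" "nss_mod U2 m"
      using exists_nss_mod by blast
    define U where "U = U1 \<inter> U2"
    have U: "U \<in> \<U>" "nss_mod U m"
      using nb_Int[OF U1(1) U2(1)] nss_mod_mono[OF U2(2)] by (auto simp: U_def)
    obtain V where V: "V \<in> \<U>" and small:
      "\<forall>N v c a. N \<lhd> G \<longrightarrow> v \<in> V \<longrightarrow> c \<in> carrier G \<longrightarrow> a \<in> A \<union> F \<longrightarrow> commutator c a \<in> N \<longrightarrow>
         commutator (v \<otimes> c) a \<in> U <#> N"
      using small_commutators[OF bounded_set_Un[OF A(1) bounded_set_finite[OF F(1,2)]] U(1)] by (elim bexE)
    have "commutator (v \<otimes> c) z \<in> upper_central m"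
      if v: "v \<in> V" and c: "c \<in> lowering (Suc j)" and vc\<Gamma>: "v \<otimes> c \<in> \<Gamma>" and vcj: "v \<otimes> c \<in> lowering j"
        and z: "z \<in> ?Z" for v c z
    proof -
      have AF: "commutator (v \<otimes> c) a \<in> U <#> upper_central m" if a: "a \<in> A \<union> F" for a
        using loweringD[OF c kd AZ[OF a]]
        by (intro small[rule_format, OF upper_central_normal v lowering_carrier[OF c] a]) (simp add: m_def)
      have central: "commutator (v \<otimes> c) z \<in> upper_central (Suc m)" if z: "z \<in> ?Z" for z
        using loweringD[OF vcj kd z] by (simp add: m del: upper_central.simps)
      have F0: "commutator (v \<otimes> c) s \<in> upper_central m" if s: "s \<in> F" for s
      proof (rule U1(2)[rule_format])
        show "commutator (v \<otimes> c) s \<in> \<Gamma>"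
          by (rule lattice_commutator[OF vc\<Gamma> FZ(1)[OF s]])
        show "commutator (v \<otimes> c) s \<in> upper_central (Suc m)"
          by (rule central[OF FZ(2)[OF s]])
        show "commutator (v \<otimes> c) s \<in> U1 <#> upper_central m"
          using AF[of s] s by (auto simp: mem_set_mult U_def)
      qed
      show ?thesis
      proof (rule commutator_vanish[OF U normal_imp_subgroup[OF upper_central_normal] lattice_carrier[OF vc\<Gamma>]
            central, where A = A and \<Delta> = "\<Gamma> \<inter> ?Z"])
        show "\<exists>k\<in>A. \<exists>\<delta>\<in>\<Gamma> \<inter> ?Z. z = k \<otimes> \<delta>" if "z \<in> ?Z" for z
          using subsetD[OF A(3) that] by (simp only: mem_set_mult)
        show "A \<subseteq> carrier G"
          using A(1) by (simp add: bounded_set_def)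
        show "\<Gamma> \<inter> ?Z \<subseteq> carrier G"
          using lattice_carrier by blast
        show "commutator (v \<otimes> c) a \<in> U <#> upper_central m" if "a \<in> A" for a
          using AF that by blast
        show "commutator (v \<otimes> c) \<delta> \<in> upper_central m" if "\<delta> \<in> \<Gamma> \<inter> ?Z" for \<delta>
          by (rule commutator_in_normal_if_generators[OF upper_central_normal lattice_carrier[OF vc\<Gamma>] F(2) F0])
            (use that F(3) in auto)
      qed (use z in auto)
    qed
    then show ?thesis
      using V by (auto simp: m_def intro!: bexI[of _ V])
  qed
  obtain V where V: "V \<in> \<U>"
    "\<forall>k\<in>{..d}. \<forall>v\<in>V. \<forall>c\<in>lowering (Suc j). v \<otimes> c \<in> \<Gamma> \<longrightarrow> v \<otimes> c \<in> lowering j \<longrightarrow>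
          (\<forall>z\<in>upper_central k. commutator (v \<otimes> c) z \<in> upper_central (k - Suc j))"
  proof (rule bexE)
    show "\<exists>V\<in>\<U>. \<forall>k\<in>{..d}. \<forall>v\<in>V. \<forall>c\<in>lowering (Suc j). v \<otimes> c \<in> \<Gamma> \<longrightarrow> v \<otimes> c \<in> lowering j \<longrightarrow>
          (\<forall>z\<in>upper_central k. commutator (v \<otimes> c) z \<in> upper_central (k - Suc j))"
      by (rule nb_finite_Inter[OF finite_atMost]) (rule step)
  qed
  have "\<gamma> \<in> lowering (Suc j)" if \<gamma>: "\<gamma> \<in> \<Gamma>" "\<gamma> \<in> (U0 \<inter> V) <#> lowering (Suc j)" for \<gamma>
  proof -
    obtain v c where vc: "v \<in> U0" "v \<in> V" "c \<in> lowering (Suc j)" "\<gamma> = v \<otimes> c"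
      using \<gamma>(2) by (auto simp only: mem_set_mult)
    have "\<gamma> \<in> U0 <#> lowering j"
      using vc subsetD[OF lowering_Suc vc(3)] by (auto simp only: mem_set_mult)
    then have "\<gamma> \<in> lowering j"
      using U0(2) \<gamma>(1) by blast
    then show ?thesis
      using V(2) vc \<gamma>(1) lattice_carrier[OF \<gamma>(1)] by (auto simp: lowering_def)
  qed
  then show ?case
    using nb_Int[OF U0(1) V(1)] by blast
qed

lemma exists_lattice_mod_filtration:
  "\<exists>U\<in>\<U>. \<forall>\<gamma>\<in>\<Gamma>. \<gamma> \<in> U <#> central_filtration j \<longrightarrow> \<gamma> \<in> central_filtration j"
proof (cases "j \<le> d")
  case True
  then show ?thesis
    using exists_lattice_mod_lowering by (simp add: central_filtration_def)
next
  case False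
  obtain U where U: "U \<in> \<U>" "U \<inter> \<Gamma> \<subseteq> {\<one>}"
    using discrete by blast
  have "\<gamma> = \<one>" if "\<gamma> \<in> \<Gamma>" "\<gamma> \<in> U <#> {\<one>}" for \<gamma>
    using that U(2) subsetD[OF nb_subset[OF U(1)]] by (auto simp: mem_set_mult)
  then show ?thesis
    using U(1) False by (auto simp: central_filtration_def)
qed

text \<open>
  Dividing \<open>f\<close> by \<open>s\<close> on the left and by \<open>g\<close> on the right, on both opposite faces, makes the
  lower face trivial. The upper face becomes \<open>h\<close>, which is one step deeper in the filtration, and if
  \<open>s\<close> is small, then \<open>h\<close> is near \<open>\<Gamma>\<close> wherever the upper face of \<open>f\<close> is.
\<close>

lemma divide_by_lower_face:
  assumes f: "f \<in> cubes (Suc n) i" and s: "s \<in> cubes n i" and g: "g \<in> cubes n i"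
    and sg: "\<forall>\<epsilon>. length \<epsilon> = n \<longrightarrow> s \<epsilon> \<in> W \<and> g \<epsilon> \<in> \<Gamma> \<and> f (False # \<epsilon>) = s \<epsilon> \<otimes> g \<epsilon>"
    and W: "W \<in> \<U>" "\<forall>x\<in>W. \<forall>y\<in>W. inv x \<otimes> y \<in> V"
  obtains h where "h \<in> cubes n (Suc i)"
    "\<And>\<epsilon>. length \<epsilon> = n \<Longrightarrow> f (True # \<epsilon>) = s \<epsilon> \<otimes> h \<epsilon> \<otimes> g \<epsilon>"
    "\<And>\<epsilon>. length \<epsilon> = n \<Longrightarrow> f (True # \<epsilon>) \<in> W <#> \<Gamma> \<Longrightarrow> h \<epsilon> \<in> V <#> \<Gamma>"
proof
  let ?df = "\<lambda>\<epsilon>. inv (f (False # \<epsilon>)) \<otimes> f (True # \<epsilon>)"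
  let ?h = "\<lambda>\<epsilon>. g \<epsilon> \<otimes> ?df \<epsilon> \<otimes> inv (g \<epsilon>)"
  have fc: "f \<epsilon> \<in> carrier G" for \<epsilon>
    by (rule cubes_carrier[OF f])
  note sc = cubes_carrier[OF s] and gc = cubes_carrier[OF g]
  have "?df \<in> cubes n (Suc i)"
    using f by simp
  then show "?h \<in> cubes n (Suc i)"
    by (rule cubes_conj[OF _ g])
  fix \<epsilon> :: "bool list" assume \<epsilon>: "length \<epsilon> = n"
  note sg\<epsilon> = sg[rule_format, OF \<epsilon>]
  show "f (True # \<epsilon>) = s \<epsilon> \<otimes> ?h \<epsilon> \<otimes> g \<epsilon>"
    using sg\<epsilon> fc[of "True # \<epsilon>"] sc[of \<epsilon>] gc[of \<epsilon>] by (simp add: free_group_simps)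
  assume "f (True # \<epsilon>) \<in> W <#> \<Gamma>"
  then obtain w \<gamma> where w: "w \<in> W" "\<gamma> \<in> \<Gamma>" "f (True # \<epsilon>) = w \<otimes> \<gamma>"
    by (auto simp: mem_set_mult)
  have "?h \<epsilon> = (inv (s \<epsilon>) \<otimes> w) \<otimes> (\<gamma> \<otimes> inv (g \<epsilon>))"
    using sg\<epsilon> w(3) subsetD[OF nb_subset[OF W(1)] w(1)] lattice_carrier[OF w(2)] sc[of \<epsilon>] gc[of \<epsilon>]
    by (simp add: free_group_simps)
  moreover have "inv (s \<epsilon>) \<otimes> w \<in> V"
    using W(2) sg\<epsilon> w(1) by blast
  moreover have "\<gamma> \<otimes> inv (g \<epsilon>) \<in> \<Gamma>"
    using sg\<epsilon> by (intro lattice_mult lattice_inv w(2)) simp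
  ultimately show "?h \<epsilon> \<in> V <#> \<Gamma>"
    by (intro set_multI)
qed

text \<open>
  Factor the lower face, divide by it, and factor what remains of the upper face. In dimension \<open>0\<close>
  an element \<open>u \<gamma>\<close> of the filtration group with \<open>u\<close> small is given; then \<open>\<gamma>\<close> is close to that group,
  and belongs to it by the discreteness of \<open>\<Gamma>\<close> modulo the filtration.
\<close>

lemma cube_factorization:
  assumes "U \<in> \<U>"
  shows "\<exists>V\<in>\<U>. \<forall>f\<in>cubes n i. (\<forall>\<epsilon>. length \<epsilon> = n \<longrightarrow> f \<epsilon> \<in> V <#> \<Gamma>) \<longrightarrow>
    (\<exists>s\<in>cubes n i. \<exists>g\<in>cubes n i. \<forall>\<epsilon>. length \<epsilon> = n \<longrightarrow> s \<epsilon> \<in> U \<and> g \<epsilon> \<in> \<Gamma> \<and> f \<epsilon> = s \<epsilon> \<otimes> g \<epsilon>)"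
  using assms
proof (induction n arbitrary: i U)
  case 0
  obtain U1 where U1: "U1 \<in> \<U>" "\<forall>\<gamma>\<in>\<Gamma>. \<gamma> \<in> U1 <#> central_filtration i \<longrightarrow> \<gamma> \<in> central_filtration i"
    using exists_lattice_mod_filtration[of i] by (rule bexE)
  obtain U2 where U2: "U2 \<in> \<U>" "\<forall>x\<in>U2. inv x \<in> U1"
    using nb_inv[OF U1(1)] by (rule bexE)
  show ?case
  proof (intro bexI[of _ "U \<inter> U2"] ballI impI)
    show "U \<inter> U2 \<in> \<U>" by (rule nb_Int[OF 0 U2(1)])
    fix f assume f: "f \<in> cubes 0 i" and "\<forall>\<epsilon>. length \<epsilon> = 0 \<longrightarrow> f \<epsilon> \<in> (U \<inter> U2) <#> \<Gamma>"
    then obtain u \<gamma> where u: "u \<in> U" "u \<in> U2" "\<gamma> \<in> \<Gamma>" "f [] = u \<otimes> \<gamma>"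
      by (auto simp: mem_set_mult)
    have uc: "u \<in> carrier G" by (rule subsetD[OF nb_subset[OF 0] u(1)])
    have fB: "f [] \<in> central_filtration i"
      using f by simp
    have "\<gamma> = inv u \<otimes> f []"
      using u(4) uc lattice_carrier[OF u(3)] by simp
    then have "\<gamma> \<in> U1 <#> central_filtration i"
      using u U2(2) fB by (intro set_multI[of "inv u" _ "f []"]) auto
    then have \<gamma>: "\<gamma> \<in> central_filtration i"
      using U1(2) u(3) by blast
    have "u = f [] \<otimes> inv \<gamma>"
      using u(4) uc lattice_carrier[OF u(3)] by (simp add: m_assoc)
    then have uB: "u \<in> central_filtration i"
      using subgroup.m_closed[OF B_subgroup fB subgroup.m_inv_closed[OF B_subgroup \<gamma>]] by simp
    show "\<exists>s\<in>cubes 0 i. \<exists>g\<in>cubes 0 i. \<forall>\<epsilon>. length \<epsilon> = 0 \<longrightarrow> s \<epsilon> \<in> U \<and> g \<epsilon> \<in> \<Gamma> \<and> f \<epsilon> = s \<epsilon> \<otimes> g \<epsilon>"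
      by (rule bexI[OF _ cubes_const[OF uB]], rule bexI[OF _ cubes_const[OF \<gamma>]]) (use u in auto)
  qed
next
  case (Suc n)
  obtain U1 where U1: "U1 \<in> \<U>" "\<forall>x\<in>U1. \<forall>y\<in>U1. x \<otimes> y \<in> U"
    using nb_mult[OF Suc.prems] by (rule bexE)
  obtain V1 where V1: "V1 \<in> \<U>" and IH1: "\<forall>f\<in>cubes n (Suc i). (\<forall>\<epsilon>. length \<epsilon> = n \<longrightarrow> f \<epsilon> \<in> V1 <#> \<Gamma>) \<longrightarrow>
    (\<exists>s\<in>cubes n (Suc i). \<exists>g\<in>cubes n (Suc i). \<forall>\<epsilon>. length \<epsilon> = n \<longrightarrow> s \<epsilon> \<in> U1 \<and> g \<epsilon> \<in> \<Gamma> \<and> f \<epsilon> = s \<epsilon> \<otimes> g \<epsilon>)"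
    using Suc.IH[OF U1(1), of "Suc i"] by (rule bexE)
  obtain W where W: "W \<in> \<U>" "\<forall>x\<in>W. \<forall>y\<in>W. inv x \<otimes> y \<in> V1"
    using nb_quotient[OF V1] by (rule bexE)
  define U0 where "U0 = U \<inter> U1 \<inter> W"
  have U0: "U0 \<in> \<U>"
    unfolding U0_def by (intro nb_Int Suc.prems U1(1) W(1))
  obtain V0 where V0: "V0 \<in> \<U>" and IH0: "\<forall>f\<in>cubes n i. (\<forall>\<epsilon>. length \<epsilon> = n \<longrightarrow> f \<epsilon> \<in> V0 <#> \<Gamma>) \<longrightarrow>
    (\<exists>s\<in>cubes n i. \<exists>g\<in>cubes n i. \<forall>\<epsilon>. length \<epsilon> = n \<longrightarrow> s \<epsilon> \<in> U0 \<and> g \<epsilon> \<in> \<Gamma> \<and> f \<epsilon> = s \<epsilon> \<otimes> g \<epsilon>)"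
    using Suc.IH[OF U0, of i] by (rule bexE)
  show ?case
  proof (intro bexI[of _ "V0 \<inter> W"] ballI impI)
    show "V0 \<inter> W \<in> \<U>" by (rule nb_Int[OF V0 W(1)])
    fix f assume f: "f \<in> cubes (Suc n) i"
      and near: "\<forall>\<epsilon>. length \<epsilon> = Suc n \<longrightarrow> f \<epsilon> \<in> (V0 \<inter> W) <#> \<Gamma>"
    have "f (False # \<epsilon>) \<in> V0 <#> \<Gamma>" if "length \<epsilon> = n" for \<epsilon>
      using near[rule_format, of "False # \<epsilon>"] that by (auto simp: mem_set_mult)
    moreover have "(\<lambda>\<epsilon>. f (False # \<epsilon>)) \<in> cubes n i"
      using f by simp
    ultimately obtain s0 g0 where s0: "s0 \<in> cubes n i" and g0: "g0 \<in> cubes n i"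
      and sg0: "\<forall>\<epsilon>. length \<epsilon> = n \<longrightarrow> s0 \<epsilon> \<in> U0 \<and> g0 \<epsilon> \<in> \<Gamma> \<and> f (False # \<epsilon>) = s0 \<epsilon> \<otimes> g0 \<epsilon>"
      using IH0[rule_format, of "\<lambda>\<epsilon>. f (False # \<epsilon>)"] by blast
    note s0c = cubes_carrier[OF s0] and g0c = cubes_carrier[OF g0]
    obtain h where h: "h \<in> cubes n (Suc i)"
      and f1: "\<And>\<epsilon>. length \<epsilon> = n \<Longrightarrow> f (True # \<epsilon>) = s0 \<epsilon> \<otimes> h \<epsilon> \<otimes> g0 \<epsilon>"
      and h_near: "\<And>\<epsilon>. length \<epsilon> = n \<Longrightarrow> f (True # \<epsilon>) \<in> W <#> \<Gamma> \<Longrightarrow> h \<epsilon> \<in> V1 <#> \<Gamma>"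
      using divide_by_lower_face[OF f s0 g0 _ W] sg0 unfolding U0_def by blast
    have "h \<epsilon> \<in> V1 <#> \<Gamma>" if \<epsilon>: "length \<epsilon> = n" for \<epsilon>
      using near[rule_format, of "True # \<epsilon>"] \<epsilon> by (intro h_near) (auto simp: mem_set_mult)
    then obtain s1 g1 where s1: "s1 \<in> cubes n (Suc i)" and g1: "g1 \<in> cubes n (Suc i)"
      and sg1: "\<forall>\<epsilon>. length \<epsilon> = n \<longrightarrow> s1 \<epsilon> \<in> U1 \<and> g1 \<epsilon> \<in> \<Gamma> \<and> h \<epsilon> = s1 \<epsilon> \<otimes> g1 \<epsilon>"
      using IH1[rule_format, OF h] by blast
    note s1c = cubes_carrier[OF s1] and g1c = cubes_carrier[OF g1]
    define s where "s \<epsilon> = (case \<epsilon> of [] \<Rightarrow> \<one> | b # \<epsilon>' \<Rightarrow> if b then s0 \<epsilon>' \<otimes> s1 \<epsilon>' else s0 \<epsilon>')" for \<epsilon>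
    define g where "g \<epsilon> = (case \<epsilon> of [] \<Rightarrow> \<one> | b # \<epsilon>' \<Rightarrow> if b then g1 \<epsilon>' \<otimes> g0 \<epsilon>' else g0 \<epsilon>')" for \<epsilon>
    have "s \<in> cubes (Suc n) i"
    proof -
      have "range s \<subseteq> carrier G"
        using s0c s1c by (auto simp: s_def split: list.split)
      then show ?thesis
        using s0 s1 s0c s1c by (simp add: s_def)
    qed
    moreover have "g \<in> cubes (Suc n) i"
    proof -
      have "range g \<subseteq> carrier G"
        using g0c g1c by (auto simp: g_def split: list.split)
      moreover have "(\<lambda>\<epsilon>. inv (g0 \<epsilon>) \<otimes> g1 \<epsilon> \<otimes> inv (inv (g0 \<epsilon>))) \<in> cubes n (Suc i)"
        by (rule cubes_conj[OF g1 cubes_inv[OF g0]])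
      then have "(\<lambda>\<epsilon>. inv (g0 \<epsilon>) \<otimes> (g1 \<epsilon> \<otimes> g0 \<epsilon>)) \<in> cubes n (Suc i)"
        using g0c g1c by (simp add: m_assoc)
      ultimately show ?thesis
        using g0 by (simp add: g_def)
    qed
    moreover have "s \<epsilon> \<in> U \<and> g \<epsilon> \<in> \<Gamma> \<and> f \<epsilon> = s \<epsilon> \<otimes> g \<epsilon>" if \<epsilon>: "length \<epsilon> = Suc n" for \<epsilon>
    proof -
      obtain b \<epsilon>' where b: "\<epsilon> = b # \<epsilon>'" "length \<epsilon>' = n"
        using \<epsilon> by (cases \<epsilon>) auto
      note 0 = sg0[rule_format, OF b(2)] and 1 = sg1[rule_format, OF b(2)]
      show ?thesis
      proof (cases b)
        case False
        then show ?thesis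
          using 0 b by (simp add: s_def g_def U0_def)
      next
        case True
        have "f (True # \<epsilon>') = (s0 \<epsilon>' \<otimes> s1 \<epsilon>') \<otimes> (g1 \<epsilon>' \<otimes> g0 \<epsilon>')"
          using 1 f1[OF b(2)] s0c[of \<epsilon>'] s1c[of \<epsilon>'] g0c[of \<epsilon>'] g1c[of \<epsilon>'] by (simp add: m_assoc)
        moreover have "s0 \<epsilon>' \<otimes> s1 \<epsilon>' \<in> U"
          using 0 1 U1(2) by (simp add: U0_def)
        moreover have "g1 \<epsilon>' \<otimes> g0 \<epsilon>' \<in> \<Gamma>"
          using 0 1 by (intro lattice_mult) auto
        ultimately show ?thesis
          using True b by (simp add: s_def g_def)
      qed
    qed
    ultimately show "\<exists>s\<in>cubes (Suc n) i. \<exists>g\<in>cubes (Suc n) i.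
        \<forall>\<epsilon>. length \<epsilon> = Suc n \<longrightarrow> s \<epsilon> \<in> U \<and> g \<epsilon> \<in> \<Gamma> \<and> f \<epsilon> = s \<epsilon> \<otimes> g \<epsilon>"
      by blast
  qed
qed

text \<open>
  Dividing by the factorization of the lower face leaves a cube of one dimension less and one step
  deeper in the filtration. When dimension \<open>0\<close> is reached, the filtration has become trivial.
\<close>

theorem last_vertex_near_lattice:
  assumes "U \<in> \<U>" "i + n > d"
  shows "\<exists>V\<in>\<U>. \<forall>f\<in>cubes n i. (\<forall>\<epsilon>. length \<epsilon> = n \<longrightarrow> \<epsilon> \<noteq> replicate n True \<longrightarrow> f \<epsilon> \<in> V <#> \<Gamma>) \<longrightarrow>
    f (replicate n True) \<in> U <#> \<Gamma>"
  using assms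
proof (induction n arbitrary: i U)
  case 0
  have "f [] \<in> U <#> \<Gamma>" if "f \<in> cubes 0 i" for f
  proof -
    have "f [] = \<one> \<otimes> \<one>"
      using that 0 by (simp add: central_filtration_def)
    then show ?thesis
      by (rule set_multI[OF nb_one[OF 0(1)] lattice_one])
  qed
  then show ?case
    using nb_carrier by auto
next
  case (Suc n)
  obtain U1 where U1: "U1 \<in> \<U>" "\<forall>x\<in>U1. \<forall>y\<in>U1. x \<otimes> y \<in> U"
    using nb_mult[OF Suc.prems(1)] by (rule bexE)
  obtain V1 where V1: "V1 \<in> \<U>" and IH1: "\<forall>f\<in>cubes n (Suc i).
      (\<forall>\<epsilon>. length \<epsilon> = n \<longrightarrow> \<epsilon> \<noteq> replicate n True \<longrightarrow> f \<epsilon> \<in> V1 <#> \<Gamma>) \<longrightarrow> f (replicate n True) \<in> U1 <#> \<Gamma>"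
    using Suc.IH[OF U1(1), of "Suc i"] Suc.prems(2) by auto
  obtain W where W: "W \<in> \<U>" "\<forall>x\<in>W. \<forall>y\<in>W. inv x \<otimes> y \<in> V1"
    using nb_quotient[OF V1] by (rule bexE)
  have U0: "U1 \<inter> W \<in> \<U>"
    by (intro nb_Int U1(1) W(1))
  obtain V0 where V0: "V0 \<in> \<U>" and fact: "\<forall>f\<in>cubes n i. (\<forall>\<epsilon>. length \<epsilon> = n \<longrightarrow> f \<epsilon> \<in> V0 <#> \<Gamma>) \<longrightarrow>
    (\<exists>s\<in>cubes n i. \<exists>g\<in>cubes n i. \<forall>\<epsilon>. length \<epsilon> = n \<longrightarrow> s \<epsilon> \<in> U1 \<inter> W \<and> g \<epsilon> \<in> \<Gamma> \<and> f \<epsilon> = s \<epsilon> \<otimes> g \<epsilon>)"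
    using cube_factorization[OF U0, of n i] by (rule bexE)
  show ?case
  proof (intro bexI[of _ "V0 \<inter> W"] ballI impI)
    show "V0 \<inter> W \<in> \<U>" by (rule nb_Int[OF V0 W(1)])
    fix f assume f: "f \<in> cubes (Suc n) i"
      and near: "\<forall>\<epsilon>. length \<epsilon> = Suc n \<longrightarrow> \<epsilon> \<noteq> replicate (Suc n) True \<longrightarrow> f \<epsilon> \<in> (V0 \<inter> W) <#> \<Gamma>"
    have "f (False # \<epsilon>) \<in> V0 <#> \<Gamma>" if "length \<epsilon> = n" for \<epsilon>
      using near[rule_format, of "False # \<epsilon>"] that by (auto simp: mem_set_mult)
    moreover have "(\<lambda>\<epsilon>. f (False # \<epsilon>)) \<in> cubes n i"
      using f by simp
    ultimately obtain s0 g0 where s0: "s0 \<in> cubes n i" and g0: "g0 \<in> cubes n i"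
      and sg0: "\<forall>\<epsilon>. length \<epsilon> = n \<longrightarrow> s0 \<epsilon> \<in> U1 \<inter> W \<and> g0 \<epsilon> \<in> \<Gamma> \<and> f (False # \<epsilon>) = s0 \<epsilon> \<otimes> g0 \<epsilon>"
      using fact[rule_format, of "\<lambda>\<epsilon>. f (False # \<epsilon>)"] by blast
    note s0c = cubes_carrier[OF s0] and g0c = cubes_carrier[OF g0]
    obtain h where h: "h \<in> cubes n (Suc i)"
      and f1: "\<And>\<epsilon>. length \<epsilon> = n \<Longrightarrow> f (True # \<epsilon>) = s0 \<epsilon> \<otimes> h \<epsilon> \<otimes> g0 \<epsilon>"
      and h_near: "\<And>\<epsilon>. length \<epsilon> = n \<Longrightarrow> f (True # \<epsilon>) \<in> W <#> \<Gamma> \<Longrightarrow> h \<epsilon> \<in> V1 <#> \<Gamma>"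
      using divide_by_lower_face[OF f s0 g0 _ W] sg0 by blast
    have "h \<epsilon> \<in> V1 <#> \<Gamma>" if "length \<epsilon> = n" "\<epsilon> \<noteq> replicate n True" for \<epsilon>
      using near[rule_format, of "True # \<epsilon>"] that by (intro h_near) (auto simp: mem_set_mult)
    then have "h (replicate n True) \<in> U1 <#> \<Gamma>"
      using IH1[rule_format, OF h] by blast
    then obtain u \<gamma> where u: "u \<in> U1" "\<gamma> \<in> \<Gamma>" "h (replicate n True) = u \<otimes> \<gamma>"
      by (auto simp only: mem_set_mult)
    define t where "t = replicate n True"
    have t: "length t = n" by (simp add: t_def)
    note 0 = sg0[rule_format, OF t]
    have "f (True # t) = (s0 t \<otimes> u) \<otimes> (\<gamma> \<otimes> g0 t)"
      using f1[OF t] u(3) s0c[of t] g0c[of t] subsetD[OF nb_subset[OF U1(1)] u(1)] lattice_carrier[OF u(2)]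
      by (simp add: t_def m_assoc)
    moreover have "s0 t \<otimes> u \<in> U"
      using 0 u(1) U1(2) by simp
    moreover have "\<gamma> \<otimes> g0 t \<in> \<Gamma>"
      using 0 u(2) by (intro lattice_mult) auto
    ultimately have "f (True # t) \<in> U <#> \<Gamma>"
      by (intro set_multI)
    then show "f (replicate (Suc n) True) \<in> U <#> \<Gamma>"
      by (simp add: t_def)
  qed
qed

end

section \<open>Passing to a compactly generated open subgroup\<close>

text \<open>
  The scalar product of \<open>a\<close> with \<open>\<epsilon>\<close>, read as a vector of zeros and ones.
\<close>

primrec cube_exponent :: "(nat \<Rightarrow> int) \<Rightarrow> bool list \<Rightarrow> int" where
  "cube_exponent a [] = 0"
| "cube_exponent a (e # \<epsilon>) = (if e then a 0 else 0) + cube_exponent (\<lambda>i. a (Suc i)) \<epsilon>"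

lemma cube_exponent_False: "cube_exponent a (replicate n False) = 0"
  by (induction n arbitrary: a) auto

text \<open>
  Opposite faces differ by the constant \<open>t\<^sup>a\<^sup>0\<close>, so the quotient is a constant cube.
\<close>

lemma (in group_filtration) power_cube:
  assumes B1: "B 1 = carrier G" and t: "t \<in> carrier G"
  shows "(\<lambda>\<epsilon>. t [^] (b + cube_exponent a \<epsilon>)) \<in> cubes n 0"
proof (induction n arbitrary: a b)
  case 0
  then show ?case
    using t B_0 by auto
next
  case (Suc n)
  have "(\<lambda>\<epsilon>. t [^] (a 0)) \<in> cubes n (Suc 0)"
    using t B1 by (intro cubes_const) simp
  moreover have "inv (t [^] (b + cube_exponent a (False # \<epsilon>))) \<otimes> t [^] (b + cube_exponent a (True # \<epsilon>)) = t [^] (a 0)" for \<epsilon>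
  proof -
    have e: "a 0 = - (b + cube_exponent a (False # \<epsilon>)) + (b + cube_exponent a (True # \<epsilon>))"
      by simp
    show ?thesis
      by (subst e) (simp only: int_pow_mult[OF t] int_pow_neg[OF t])
  qed
  moreover have "(\<lambda>\<epsilon>. t [^] (b + cube_exponent a (False # \<epsilon>))) \<in> cubes n 0"
    using Suc.IH[of b "\<lambda>i. a (Suc i)"] by simp
  ultimately show ?case
    using t by (simp only: cubes.simps) auto
qed

context group
begin

lemma restricted_commutator:
  assumes H: "subgroup H G" and "x \<in> H" "y \<in> H"
  shows "group.commutator (G\<lparr>carrier := H\<rparr>) x y = commutator x y"
  using assms by (simp add: group.commutator_def[OF subgroup.subgroup_is_group[OF H group_axioms]] commutator_def)

lemma upper_central_restrict:
  assumes H: "subgroup H G"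
  shows "H \<inter> upper_central m \<subseteq> group.upper_central (G\<lparr>carrier := H\<rparr>) m"
proof -
  interpret H: group "G\<lparr>carrier := H\<rparr>"
    by (rule subgroup.subgroup_is_group[OF H group_axioms])
  show ?thesis
  proof (induction m)
    case (Suc m)
    have "H.commutator g h \<in> H.upper_central m"
      if g: "g \<in> H" "g \<in> upper_central (Suc m)" and h: "h \<in> H" for g h
    proof -
      have "commutator g h \<in> H"
        unfolding commutator_def using g h H
        by (intro subgroup.m_closed[OF H] subgroup.m_inv_closed[OF H])
      moreover have "commutator g h \<in> upper_central m"
        using g(2) subgroup.mem_carrier[OF H h] by simp
      ultimately show ?thesis
        using Suc restricted_commutator[OF H g(1) h] by auto
    qed
    then show ?case by auto
  qed simp
qed

end

context group_nbhds
begin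

text \<open>
  The centres of the translates are taken in \<open>A\<close>, so that the property survives in every subgroup
  containing \<open>A\<close>.
\<close>

definition precompact_set :: "'a set \<Rightarrow> bool" where
  "precompact_set A \<longleftrightarrow>
     A \<subseteq> carrier G \<and> (\<forall>U\<in>\<U>. \<exists>F. finite F \<and> F \<subseteq> A \<and> A \<subseteq> F <#> U)"

lemma group_nbhds_subgroup:
  assumes H: "subgroup H G"
  shows "group_nbhds (G\<lparr>carrier := H\<rparr>) ((\<inter>) H ` \<U>)"
proof -
  interpret H: group "G\<lparr>carrier := H\<rparr>"
    by (rule subgroup.subgroup_is_group[OF H group_axioms])
  note Hc = subgroup.mem_carrier[OF H] and Hi = subgroup.m_inv_closed[OF H] and Hm = subgroup.m_closed[OF H]
  show ?thesis
  proof (unfold_locales, goal_cases)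
    case 1
    have "H = H \<inter> carrier G"
      using subgroup.subset[OF H] by blast
    then have "H \<in> (\<inter>) H ` \<U>"
      using nb_carrier by (rule image_eqI)
    then show ?case
      by simp
  next
    case (2 U)
    then show ?case by auto
  next
    case (3 U)
    then show ?case
      using nb_one subgroup.one_closed[OF H] by auto
  next
    case (4 U V)
    then obtain U' V' where "U' \<in> \<U>" "V' \<in> \<U>" "U = H \<inter> U'" "V = H \<inter> V'"
      by blast
    then have "U \<inter> V = H \<inter> (U' \<inter> V')" "U' \<inter> V' \<in> \<U>"
      using nb_Int by auto
    then show ?case by blast
  next
    case (5 U)
    then obtain U' where U': "U' \<in> \<U>" "U = H \<inter> U'"
      by blast
    obtain V where V: "V \<in> \<U>" "\<forall>x\<in>V. \<forall>y\<in>V. x \<otimes> y \<in> U'"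
      using nb_mult[OF U'(1)] by (rule bexE)
    show ?case
    proof (rule bexI[of _ "H \<inter> V"])
      show "H \<inter> V \<in> (\<inter>) H ` \<U>" using V(1) by blast
      show "\<forall>x\<in>H \<inter> V. \<forall>y\<in>H \<inter> V. x \<otimes>\<^bsub>G\<lparr>carrier := H\<rparr>\<^esub> y \<in> U"
        using V(2) U'(2) Hm by auto
    qed
  next
    case (6 U)
    then obtain U' where U': "U' \<in> \<U>" "U = H \<inter> U'"
      by blast
    obtain V where V: "V \<in> \<U>" "\<forall>x\<in>V. inv x \<in> U'"
      using nb_inv[OF U'(1)] by (rule bexE)
    show ?case
    proof (rule bexI[of _ "H \<inter> V"])
      show "H \<inter> V \<in> (\<inter>) H ` \<U>" using V(1) by blast
      show "\<forall>x\<in>H \<inter> V. inv\<^bsub>G\<lparr>carrier := H\<rparr>\<^esub> x \<in> U"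
        using V(2) U'(2) Hi H by auto
    qed
  next
    case (7 U g)
    then obtain U' where U': "U' \<in> \<U>" "U = H \<inter> U'" and g: "g \<in> H"
      by auto
    obtain V where V: "V \<in> \<U>" "\<forall>v\<in>V. g \<otimes> v \<otimes> inv g \<in> U'"
      using nb_conj[OF U'(1) Hc[OF g]] by (rule bexE)
    show ?case
    proof (rule bexI[of _ "H \<inter> V"])
      show "H \<inter> V \<in> (\<inter>) H ` \<U>" using V(1) by blast
      show "\<forall>v\<in>H \<inter> V. g \<otimes>\<^bsub>G\<lparr>carrier := H\<rparr>\<^esub> v \<otimes>\<^bsub>G\<lparr>carrier := H\<rparr>\<^esub> inv\<^bsub>G\<lparr>carrier := H\<rparr>\<^esub> g \<in> U"
        using V(2) U'(2) g H by (auto intro!: Hm Hi)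
    qed
  next
    case 8
    obtain U where U: "U \<in> \<U>" "\<forall>J. subgroup J G \<longrightarrow> J \<subseteq> U \<longrightarrow> J = {\<one>}"
      using no_small_subgroups by (rule bexE)
    show ?case
    proof (rule bexI[of _ "H \<inter> U"])
      show "H \<inter> U \<in> (\<inter>) H ` \<U>" using U(1) by blast
      show "\<forall>J. subgroup J (G\<lparr>carrier := H\<rparr>) \<longrightarrow> J \<subseteq> H \<inter> U \<longrightarrow> J = {\<one>\<^bsub>G\<lparr>carrier := H\<rparr>\<^esub>}"
        using U(2) incl_subgroup[OF H] by simp
    qed
  qed
qed

text \<open>
  A translate \<open>f V\<close> contains at most one element of \<open>\<Gamma>\<close> if \<open>V\<^sup>-\<^sup>1 V\<close> meets \<open>\<Gamma>\<close> only in the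
  identity.
\<close>

lemma finite_discrete_inter_precompact:
  assumes \<Gamma>: "subgroup \<Gamma> G" and U: "U \<in> \<U>" "U \<inter> \<Gamma> \<subseteq> {\<one>}" and A: "precompact_set A"
  shows "finite (\<Gamma> \<inter> A)"
proof -
  obtain V where V: "V \<in> \<U>" "\<forall>x\<in>V. \<forall>y\<in>V. inv x \<otimes> y \<in> U"
    using nb_quotient[OF U(1)] by (rule bexE)
  note Vc = subsetD[OF nb_subset[OF V(1)]]
  obtain F where F: "finite F" "F \<subseteq> A" "A \<subseteq> F <#> V"
    using A V(1) unfolding precompact_set_def by blast
  have Fc: "f \<in> carrier G" if "f \<in> F" for f
    using that F(2) A by (auto simp: precompact_set_def)
  let ?S = "\<lambda>f. {x \<in> \<Gamma>. \<exists>v\<in>V. x = f \<otimes> v}"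
  have eq: "x = y" if f: "f \<in> F" and x: "x \<in> ?S f" and y: "y \<in> ?S f" for f x y
  proof -
    obtain v w where v: "v \<in> V" "x = f \<otimes> v" and w: "w \<in> V" "y = f \<otimes> w"
      using x y by blast
    have "inv x \<otimes> y = inv v \<otimes> w"
      using Fc[OF f] Vc[OF v(1)] Vc[OF w(1)] by (simp add: v w free_group_simps)
    moreover have "inv v \<otimes> w \<in> U"
      using v(1) w(1) V(2) by blast
    moreover have "inv x \<otimes> y \<in> \<Gamma>"
      using x y by (intro subgroup.m_closed[OF \<Gamma>] subgroup.m_inv_closed[OF \<Gamma>]) auto
    ultimately have 1: "inv x \<otimes> y = \<one>"
      using U(2) by auto
    have c: "x \<in> carrier G" "y \<in> carrier G"
      using x y subgroup.mem_carrier[OF \<Gamma>] by auto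
    have "y = x \<otimes> (inv x \<otimes> y)"
      using c by simp
    then show ?thesis
      using 1 c by simp
  qed
  have "finite (?S f)" if f: "f \<in> F" for f
  proof (cases "?S f = {}")
    case False
    then obtain x where "x \<in> ?S f" by blast
    then have "?S f \<subseteq> {x}"
      using eq[OF f] by blast
    then show ?thesis
      by (rule finite_subset) simp
  qed (simp only: finite.emptyI)
  then have "finite (\<Union>f\<in>F. ?S f)"
    using F(1) by blast
  moreover have "\<Gamma> \<inter> A \<subseteq> (\<Union>f\<in>F. ?S f)"
    using F(3) by (auto simp: mem_set_mult)
  ultimately show ?thesis
    by (rule rev_finite_subset)
qed

text \<open>
  A Schreier argument for the finite generation of \<open>\<Gamma> \<inter> H\<close>. For \<open>k, k' \<in> K\<close> write
  \<open>k k' = k'' \<delta>\<close> with \<open>k'' \<in> K\<close> and \<open>\<delta> \<in> \<Gamma>\<close>; then \<open>\<delta>\<close> is in the finite set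
  \<open>S = \<Gamma> \<inter> K K K\<close>. So \<open>K \<langle>S\<rangle>\<close> is stable under left multiplication by \<open>K\<close> and equals \<open>H\<close>.
  An element of \<open>\<Gamma> \<inter> H\<close> then has its \<open>K\<close>-component in \<open>\<Gamma> \<inter> K\<close>, which is part of \<open>S\<close>.
\<close>

lemma nilpotent_lattice_of_compact_generators:
  assumes d: "d \<ge> 1" "upper_central d = carrier G"
    and \<Gamma>: "subgroup \<Gamma> G" and U: "U \<in> \<U>" "U \<inter> \<Gamma> \<subseteq> {\<one>}"
    and K: "bounded_set K" "precompact_set K" "\<And>k. k \<in> K \<Longrightarrow> inv k \<in> K" "\<one> \<in> K"
    and K3: "precompact_set (K <#> K <#> K)"
    and cover: "carrier G = K <#> \<Gamma>"
    and H_def: "H = generate G K"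
  shows "nilpotent_lattice (G\<lparr>carrier := H\<rparr>) ((\<inter>) H ` \<U>) d (\<Gamma> \<inter> H) K (\<Gamma> \<inter> (K <#> K <#> K))"
proof -
  have Kc: "k \<in> carrier G" if "k \<in> K" for k
    using K(1) that by (auto simp: bounded_set_def)
  have H: "subgroup H G"
    unfolding H_def using Kc by (intro generate_is_subgroup) auto
  note Hc = subgroup.mem_carrier[OF H] and Hi = subgroup.m_inv_closed[OF H] and Hm = subgroup.m_closed[OF H]
  have KH: "k \<in> H" if "k \<in> K" for k
    unfolding H_def using that by (rule generate.incl)
  note \<Gamma>c = subgroup.mem_carrier[OF \<Gamma>] and \<Gamma>i = subgroup.m_inv_closed[OF \<Gamma>] and \<Gamma>m = subgroup.m_closed[OF \<Gamma>]
  have \<Gamma>H: "subgroup (\<Gamma> \<inter> H) G"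
    by (rule subgroups_Inter_pair[OF \<Gamma> H])
  define S where "S = \<Gamma> \<inter> (K <#> K <#> K)"
  have mem3: "x \<in> K <#> K <#> K \<longleftrightarrow> (\<exists>a\<in>K. \<exists>b\<in>K. \<exists>c\<in>K. x = a \<otimes> b \<otimes> c)" for x
    by (auto simp: set_mult_def)
  have SH: "S \<subseteq> \<Gamma> \<inter> H"
  proof
    fix x assume "x \<in> S"
    then obtain a b c where "x \<in> \<Gamma>" "a \<in> K" "b \<in> K" "c \<in> K" "x = a \<otimes> b \<otimes> c"
      by (auto simp: S_def mem3)
    then show "x \<in> \<Gamma> \<inter> H"
      using Hm[OF Hm[OF KH KH] KH] by simp
  qed
  have Sc: "S \<subseteq> carrier G"
    using SH \<Gamma>c by blast
  have S_finite: "finite S"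
    unfolding S_def by (rule finite_discrete_inter_precompact[OF \<Gamma> U K3])
  have S_inv: "inv s \<in> S" if s: "s \<in> S" for s
  proof -
    obtain a b c where abc: "s \<in> \<Gamma>" "a \<in> K" "b \<in> K" "c \<in> K" "s = a \<otimes> b \<otimes> c"
      using s by (auto simp: S_def mem3)
    have "inv s = inv c \<otimes> inv b \<otimes> inv a"
      using abc Kc by (simp add: free_group_simps)
    then show ?thesis
      unfolding S_def using abc K(3) \<Gamma>i mem3 by blast
  qed
  let ?\<Gamma>S = "generate G S"
  have \<Gamma>S: "subgroup ?\<Gamma>S G"
    by (rule generate_is_subgroup[OF Sc])
  have \<Gamma>S_sub: "?\<Gamma>S \<subseteq> \<Gamma> \<inter> H"
    by (rule generate_subgroup_incl[OF SH \<Gamma>H])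
  \<comment> \<open>\<open>K \<Gamma>\<^sub>S\<close> is stable under left multiplication by \<open>K\<close>, hence by \<open>H\<close>\<close>
  have stepK: "k \<otimes> y \<in> K <#> ?\<Gamma>S" if k: "k \<in> K" and y: "y \<in> K <#> ?\<Gamma>S" for k y
  proof -
    obtain k' \<gamma> where k': "k' \<in> K" "\<gamma> \<in> ?\<Gamma>S" "y = k' \<otimes> \<gamma>"
      using y by (auto simp only: mem_set_mult)
    have "k \<otimes> k' \<in> K <#> \<Gamma>"
      using Kc[OF k] Kc[OF k'(1)] by (simp flip: cover)
    then obtain k'' \<delta> where k'': "k'' \<in> K" "\<delta> \<in> \<Gamma>" "k \<otimes> k' = k'' \<otimes> \<delta>"
      by (auto simp only: mem_set_mult)
    have "\<delta> = inv k'' \<otimes> k \<otimes> k'"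
      using Kc[OF k''(1)] Kc[OF k] Kc[OF k'(1)] \<Gamma>c[OF k''(2)] k''(3) by (simp add: m_assoc)
    then have "\<delta> \<in> K <#> K <#> K"
      using mem3 K(3)[OF k''(1)] k k'(1) by blast
    then have "\<delta> \<in> S"
      using k''(2) by (simp add: S_def)
    then have "\<delta> \<otimes> \<gamma> \<in> ?\<Gamma>S"
      by (intro subgroup.m_closed[OF \<Gamma>S] k'(2) generate.incl)
    moreover have "k \<otimes> y = k'' \<otimes> (\<delta> \<otimes> \<gamma>)"
    proof -
      have \<gamma>c: "\<gamma> \<in> carrier G"
        by (rule subgroup.mem_carrier[OF \<Gamma>S k'(2)])
      have "k \<otimes> y = (k \<otimes> k') \<otimes> \<gamma>"
        using Kc[OF k] Kc[OF k'(1)] \<gamma>c by (simp add: k'(3) m_assoc)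
      also have "\<dots> = k'' \<otimes> (\<delta> \<otimes> \<gamma>)"
        using Kc[OF k''(1)] \<Gamma>c[OF k''(2)] \<gamma>c by (simp add: k''(3) m_assoc)
      finally show ?thesis .
    qed
    ultimately show ?thesis
      using k''(1) by (intro set_multI[of k'' K "\<delta> \<otimes> \<gamma>"])
  qed
  have K\<Gamma>S_c: "y \<in> carrier G" if "y \<in> K <#> ?\<Gamma>S" for y
    using that Kc subgroup.mem_carrier[OF \<Gamma>S] by (auto simp: mem_set_mult)
  have stepH: "\<forall>y\<in>K <#> ?\<Gamma>S. x \<otimes> y \<in> K <#> ?\<Gamma>S" if "x \<in> H" for x
    using that unfolding H_def
  proof (induction rule: generate.induct)
    case one
    then show ?case using K\<Gamma>S_c by simp
  next
    case (incl h)
    then show ?case using stepK by blast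
  next
    case (inv h)
    then show ?case using stepK K(3) by blast
  next
    case (eng h1 h2)
    have "h1 \<in> carrier G" "h2 \<in> carrier G"
      using eng.hyps Hc unfolding H_def by auto
    then show ?case
      using eng.IH K\<Gamma>S_c by (simp add: m_assoc)
  qed
  have HK: "x \<in> K <#> ?\<Gamma>S" if x: "x \<in> H" for x
  proof -
    have "\<one> \<in> K <#> ?\<Gamma>S"
      by (rule set_multI[OF K(4) generate.one]) simp
    then have "x \<otimes> \<one> \<in> K <#> ?\<Gamma>S"
      using stepH[OF x] by blast
    then show ?thesis
      using Hc[OF x] by simp
  qed
  have gen: "\<Gamma> \<inter> H = ?\<Gamma>S"
  proof
    show "\<Gamma> \<inter> H \<subseteq> ?\<Gamma>S"
    proof
      fix \<gamma> assume \<gamma>: "\<gamma> \<in> \<Gamma> \<inter> H"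
      then have "\<gamma> \<in> K <#> ?\<Gamma>S"
        using HK by blast
      then obtain k \<delta> where k: "k \<in> K" "\<delta> \<in> ?\<Gamma>S" "\<gamma> = k \<otimes> \<delta>"
        by (auto simp only: mem_set_mult)
      have \<delta>: "\<delta> \<in> \<Gamma>" "\<delta> \<in> carrier G"
        using k(2) \<Gamma>S_sub \<Gamma>c by auto
      have "k = \<gamma> \<otimes> inv \<delta>"
        using Kc[OF k(1)] \<delta>(2) by (simp add: k(3) m_assoc)
      then have "k \<in> \<Gamma>"
        using \<gamma> \<Gamma>m \<Gamma>i[OF \<delta>(1)] by simp
      moreover have "k = k \<otimes> \<one> \<otimes> \<one>"
        using Kc[OF k(1)] by simp
      then have "k \<in> K <#> K <#> K"
        using mem3 k(1) K(4) by blast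
      ultimately have "k \<in> ?\<Gamma>S"
        by (intro generate.incl) (simp add: S_def)
      then show "\<gamma> \<in> ?\<Gamma>S"
        unfolding k(3) using k(2) by (rule subgroup.m_closed[OF \<Gamma>S])
    qed
  qed (rule \<Gamma>S_sub)
  interpret HN: group_nbhds "G\<lparr>carrier := H\<rparr>" "(\<inter>) H ` \<U>"
    by (rule group_nbhds_subgroup[OF H])
  have set_mult_eq: "A <#>\<^bsub>G\<lparr>carrier := H\<rparr>\<^esub> B = A <#> B" for A B
    by (simp add: set_mult_def)
  show ?thesis
    unfolding S_def[symmetric]
  proof (unfold_locales, goal_cases)
    case 1
    then show ?case by (rule d(1))
  next
    case 2
    have "H \<subseteq> HN.upper_central d"
      using upper_central_restrict[OF H, of d] d(2) Hc by auto
    then show ?case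
      using HN.upper_central_props(2) by auto
  next
    case 3
    then show ?case
      unfolding gen using SH by (intro generate_consistent[symmetric] H) auto
  next
    case 4
    then show ?case by (rule S_finite)
  next
    case 5
    then show ?case using SH by simp
  next
    case (6 s)
    then have "s \<in> H" "inv s \<in> S"
      using SH S_inv by auto
    then show ?case
      using H by simp
  next
    case 7
    show ?case
    proof (rule bexI[of _ "H \<inter> U"])
      show "H \<inter> U \<inter> (\<Gamma> \<inter> H) \<subseteq> {\<one>\<^bsub>G\<lparr>carrier := H\<rparr>\<^esub>}"
        using U(2) by auto
      show "H \<inter> U \<in> (\<inter>) H ` \<U>" using U(1) by blast
    qed
  next
    case 8
    show ?case
      unfolding HN.bounded_set_def
    proof (intro conjI ballI)
      show "K \<subseteq> carrier (G\<lparr>carrier := H\<rparr>)" using KH by auto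
      fix W assume "W \<in> (\<inter>) H ` \<U>"
      then obtain W' where W': "W' \<in> \<U>" "W = H \<inter> W'" by blast
      obtain V where V: "V \<in> \<U>" "\<forall>a\<in>K. \<forall>v\<in>V. a \<otimes> v \<otimes> inv a \<in> W'"
        using K(1) W'(1) unfolding bounded_set_def by blast
      show "\<exists>V\<in>(\<inter>) H ` \<U>. \<forall>a\<in>K. \<forall>v\<in>V. a \<otimes>\<^bsub>G\<lparr>carrier := H\<rparr>\<^esub> v \<otimes>\<^bsub>G\<lparr>carrier := H\<rparr>\<^esub> inv\<^bsub>G\<lparr>carrier := H\<rparr>\<^esub> a \<in> W"
      proof (rule bexI[of _ "H \<inter> V"])
        show "H \<inter> V \<in> (\<inter>) H ` \<U>" using V(1) by blast
        show "\<forall>a\<in>K. \<forall>v\<in>H \<inter> V. a \<otimes>\<^bsub>G\<lparr>carrier := H\<rparr>\<^esub> v \<otimes>\<^bsub>G\<lparr>carrier := H\<rparr>\<^esub> inv\<^bsub>G\<lparr>carrier := H\<rparr>\<^esub> a \<in> W"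
          using V(2) W'(2) H KH by (auto intro!: Hm Hi)
      qed
    qed
  next
    case (9 W)
    then obtain W' where W': "W' \<in> \<U>" "W = H \<inter> W'" by blast
    obtain F where F: "finite F" "F \<subseteq> K" "K \<subseteq> F <#> W'"
      using K(2) W'(1) unfolding precompact_set_def by blast
    have "K \<subseteq> F <#> W"
    proof
      fix k assume k: "k \<in> K"
      obtain f w where f: "f \<in> F" "w \<in> W'" "k = f \<otimes> w"
        using subsetD[OF F(3) k] by (auto simp only: mem_set_mult)
      have fH: "f \<in> H"
        using f(1) F(2) KH by blast
      have "w = inv f \<otimes> k"
        using Hc[OF fH] subsetD[OF nb_subset[OF W'(1)] f(2)] by (simp add: f(3))
      then have "w \<in> H"
        using Hm[OF Hi[OF fH] KH[OF k]] by simp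
      then show "k \<in> F <#> W"
        using f W'(2) by (intro set_multI[of f F w]) auto
    qed
    then show ?case
      using F KH unfolding set_mult_eq by (intro exI[of _ F]) auto
  next
    case 10
    have "K <#> ?\<Gamma>S \<subseteq> H"
    proof
      fix x assume "x \<in> K <#> ?\<Gamma>S"
      then obtain k \<gamma> where k: "k \<in> K" "\<gamma> \<in> ?\<Gamma>S" "x = k \<otimes> \<gamma>"
        by (auto simp only: mem_set_mult)
      have "\<gamma> \<in> H"
        using k(2) \<Gamma>S_sub by blast
      then show "x \<in> H"
        unfolding k(3) by (rule Hm[OF KH[OF k(1)]])
    qed
    then have "H = K <#> ?\<Gamma>S"
      using HK by blast
    then show ?case
      unfolding set_mult_eq gen by simp
  qed
qed

text \<open>
  The vertex with exponent \<open>0\<close> lies near \<open>\<Gamma>\<close>, so after right multiplication by an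
  element of \<open>\<Gamma>\<close> it lies in the subgroup \<open>H\<close> generated by \<open>K\<close>. As \<open>t \<in> H\<close>, the whole cube is
  then in \<open>H\<close>, and its vertices are near \<open>\<Gamma>\<close> if and only if they are near \<open>\<Gamma> \<inter> H\<close>, because \<open>K\<close>
  contains a neighbourhood of the identity.
\<close>

theorem cube_rigidity:
  assumes d: "d \<ge> 1" "upper_central d = carrier G"
    and \<Gamma>: "subgroup \<Gamma> G" and disc: "U0 \<in> \<U>" "U0 \<inter> \<Gamma> \<subseteq> {\<one>}"
    and K: "bounded_set K" "precompact_set K" "\<And>k. k \<in> K \<Longrightarrow> inv k \<in> K" "precompact_set (K <#> K <#> K)"
      "carrier G = K <#> \<Gamma>"
    and nbhd: "U1 \<in> \<U>" "U1 \<subseteq> K" and t: "t \<in> K"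
    and U: "U \<in> \<U>"
  shows "\<exists>V\<in>\<U>. \<forall>w\<in>carrier G. \<forall>a.
    (\<forall>\<epsilon>. length \<epsilon> = Suc d \<longrightarrow> \<epsilon> \<noteq> replicate (Suc d) True \<longrightarrow> t [^] cube_exponent a \<epsilon> \<otimes> w \<in> V <#> \<Gamma>) \<longrightarrow>
    t [^] cube_exponent a (replicate (Suc d) True) \<otimes> w \<in> U <#> \<Gamma>"
proof -
  define H where "H = generate G K"
  have Kc: "k \<in> carrier G" if "k \<in> K" for k
    using K(1) that by (auto simp: bounded_set_def)
  have H: "subgroup H G"
    unfolding H_def using Kc by (intro generate_is_subgroup) auto
  note Hc = subgroup.mem_carrier[OF H] and Hi = subgroup.m_inv_closed[OF H] and Hm = subgroup.m_closed[OF H]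
  have KH: "k \<in> H" if "k \<in> K" for k
    unfolding H_def using that by (rule generate.incl)
  note \<Gamma>c = subgroup.mem_carrier[OF \<Gamma>] and \<Gamma>i = subgroup.m_inv_closed[OF \<Gamma>] and \<Gamma>m = subgroup.m_closed[OF \<Gamma>]
  have 1: "\<one> \<in> K"
    using nbhd nb_one by blast
  interpret N: nilpotent_lattice "G\<lparr>carrier := H\<rparr>" "(\<inter>) H ` \<U>" d "\<Gamma> \<inter> H" K "\<Gamma> \<inter> (K <#> K <#> K)"
    by (rule nilpotent_lattice_of_compact_generators[OF d \<Gamma> disc K(1-3) 1 K(4,5) H_def])
  have set_mult_eq: "A <#>\<^bsub>G\<lparr>carrier := H\<rparr>\<^esub> B = A <#> B" for A B
    by (simp add: set_mult_def)
  have tc: "t \<in> carrier G" and tH: "t \<in> H"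
    using Kc KH t by auto
  have "H \<inter> U \<in> (\<inter>) H ` \<U>"
    using U by blast
  then obtain V' where V': "V' \<in> (\<inter>) H ` \<U>" and last: "\<forall>f\<in>N.cubes (Suc d) 0.
      (\<forall>\<epsilon>. length \<epsilon> = Suc d \<longrightarrow> \<epsilon> \<noteq> replicate (Suc d) True \<longrightarrow> f \<epsilon> \<in> V' <#> (\<Gamma> \<inter> H)) \<longrightarrow>
      f (replicate (Suc d) True) \<in> (H \<inter> U) <#> (\<Gamma> \<inter> H)"
    using N.last_vertex_near_lattice[of "H \<inter> U" 0 "Suc d"] unfolding set_mult_eq by auto
  obtain V where V: "V \<in> \<U>" "V' = H \<inter> V"
    using V' by blast
  show ?thesis
  proof (intro bexI[of _ "V \<inter> U1"] ballI allI impI)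
    show "V \<inter> U1 \<in> \<U>"
      by (rule nb_Int[OF V(1) nbhd(1)])
    fix w a assume w: "w \<in> carrier G"
      and near: "\<forall>\<epsilon>. length \<epsilon> = Suc d \<longrightarrow> \<epsilon> \<noteq> replicate (Suc d) True \<longrightarrow> t [^] cube_exponent a \<epsilon> \<otimes> w \<in> (V \<inter> U1) <#> \<Gamma>"
    have ne: "replicate (Suc d) False \<noteq> replicate (Suc d) True" by simp
    have "w \<in> (V \<inter> U1) <#> \<Gamma>"
      using near[rule_format, OF length_replicate ne]
      unfolding cube_exponent_False int_pow_0 l_one[OF w] .
    then obtain q \<gamma>0 where q: "q \<in> V" "q \<in> U1" and \<gamma>0: "\<gamma>0 \<in> \<Gamma>" and w_eq: "w = q \<otimes> \<gamma>0"
      by (auto simp only: mem_set_mult)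
    have qH: "q \<in> H"
      using q(2) nbhd(2) KH by blast
    let ?f = "\<lambda>\<epsilon>. t [^] cube_exponent a \<epsilon> \<otimes> q"
    have powH: "t [^] (n::int) \<in> H" for n
      by (rule subgroup_int_pow_closed[OF H tH])
    have w_conv: "t [^] cube_exponent a \<epsilon> \<otimes> w = ?f \<epsilon> \<otimes> \<gamma>0" for \<epsilon>
      using w_eq tc Hc[OF qH] \<Gamma>c[OF \<gamma>0] by (simp add: m_assoc)
    have f: "?f \<in> N.cubes (Suc d) 0"
    proof -
      have "(\<lambda>\<epsilon>. t [^]\<^bsub>G\<lparr>carrier := H\<rparr>\<^esub> (0 + cube_exponent a \<epsilon>)) \<in> N.cubes (Suc d) 0"
        by (rule N.power_cube[OF N.central_filtration_1]) (simp add: tH)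
      moreover have "(\<lambda>\<epsilon>. q) \<in> N.cubes (Suc d) 0"
        by (rule N.cubes_const) (simp add: N.B_0 qH)
      ultimately have "(\<lambda>\<epsilon>. t [^]\<^bsub>G\<lparr>carrier := H\<rparr>\<^esub> (0 + cube_exponent a \<epsilon>) \<otimes>\<^bsub>G\<lparr>carrier := H\<rparr>\<^esub> q) \<in> N.cubes (Suc d) 0"
        by (rule N.cubes_mult)
      then show ?thesis
        by (simp add: int_pow_consistent[OF H tH, symmetric] del: N.cubes.simps)
    qed
    have "?f \<epsilon> \<in> V' <#> (\<Gamma> \<inter> H)" if \<epsilon>: "length \<epsilon> = Suc d" "\<epsilon> \<noteq> replicate (Suc d) True" for \<epsilon>
    proof -
      obtain v \<gamma> where v: "v \<in> V" "v \<in> U1" "\<gamma> \<in> \<Gamma>" "t [^] cube_exponent a \<epsilon> \<otimes> w = v \<otimes> \<gamma>"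
        using near[rule_format, OF \<epsilon>] by (auto simp only: mem_set_mult)
      have vH: "v \<in> H"
        using v(2) nbhd(2) KH by blast
      have fH: "?f \<epsilon> \<in> H"
        by (rule Hm[OF powH qH])
      have eq: "?f \<epsilon> \<otimes> \<gamma>0 = v \<otimes> \<gamma>"
        using v(4) w_conv by simp
      have "?f \<epsilon> = (?f \<epsilon> \<otimes> \<gamma>0) \<otimes> inv \<gamma>0"
        using Hc[OF fH] \<Gamma>c[OF \<gamma>0] by (simp only: m_assoc r_inv r_one inv_closed)
      then have eq': "?f \<epsilon> = v \<otimes> (\<gamma> \<otimes> inv \<gamma>0)"
        unfolding eq using Hc[OF vH] \<Gamma>c[OF v(3)] \<Gamma>c[OF \<gamma>0] by (simp only: m_assoc inv_closed)
      then have "\<gamma> \<otimes> inv \<gamma>0 = inv v \<otimes> ?f \<epsilon>"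
        using Hc[OF vH] \<Gamma>c[OF v(3)] \<Gamma>c[OF \<gamma>0] by simp
      then have "\<gamma> \<otimes> inv \<gamma>0 \<in> H"
        using Hm[OF Hi[OF vH] fH] by simp
      moreover have "\<gamma> \<otimes> inv \<gamma>0 \<in> \<Gamma>"
        by (rule \<Gamma>m[OF v(3) \<Gamma>i[OF \<gamma>0]])
      ultimately show ?thesis
        using vH v(1) V(2) by (intro set_multI[OF _ _ eq']) auto
    qed
    then have "?f (replicate (Suc d) True) \<in> (H \<inter> U) <#> (\<Gamma> \<inter> H)"
      by (intro last[rule_format, OF f])
    then obtain u \<gamma> where u: "u \<in> U" "\<gamma> \<in> \<Gamma>" "?f (replicate (Suc d) True) = u \<otimes> \<gamma>"
      by (auto simp only: mem_set_mult)
    show "t [^] cube_exponent a (replicate (Suc d) True) \<otimes> w \<in> U <#> \<Gamma>"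
    proof (rule set_multI[OF u(1) \<Gamma>m[OF u(2) \<gamma>0]])
      show "t [^] cube_exponent a (replicate (Suc d) True) \<otimes> w = u \<otimes> (\<gamma> \<otimes> \<gamma>0)"
        unfolding w_conv u(3) using subsetD[OF nb_subset[OF U] u(1)] \<Gamma>c[OF u(2)] \<Gamma>c[OF \<gamma>0]
        by (rule m_assoc)
    qed
  qed
qed

end

section \<open>Topological groups without small subgroups\<close>

locale nss_topological_group = group G for G :: "'a monoid" (structure) +
  fixes M :: "'a topology"
  assumes topspace_eq: "topspace M = carrier G"
    and mult_continuous: "continuous_map (prod_topology M M) M (\<lambda>(x, y). x \<otimes> y)"
    and inv_continuous: "continuous_map M M (\<lambda>x. inv x)"
    and Hausdorff: "Hausdorff_space M"
    and locally_compact: "locally_compact_space M"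
    and nss: "\<exists>U. openin M U \<and> \<one> \<in> U \<and> (\<forall>H. subgroup H G \<longrightarrow> H \<subseteq> U \<longrightarrow> H = {\<one>})"
begin

lemma continuous_mult:
  assumes "continuous_map X M f" "continuous_map X M g"
  shows "continuous_map X M (\<lambda>x. f x \<otimes> g x)"
  using continuous_map_compose[OF continuous_map_pairedI[OF assms] mult_continuous]
  by (simp add: o_def)

lemma continuous_inv:
  assumes "continuous_map X M f"
  shows "continuous_map X M (\<lambda>x. inv (f x))"
  using continuous_map_compose[OF assms inv_continuous] by (simp add: o_def)

lemma continuous_const: "a \<in> carrier G \<Longrightarrow> continuous_map X M (\<lambda>x. a)"
  by (simp add: topspace_eq)

lemma continuous_ident: "continuous_map M M (\<lambda>x. x)"
  by simp

lemma open_left_translate: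
  assumes a: "a \<in> carrier G" and U: "openin M U"
  shows "openin M ((\<lambda>u. a \<otimes> u) ` U)"
proof -
  have Uc: "U \<subseteq> carrier G"
    using openin_subset[OF U] topspace_eq by simp
  have "openin M {x \<in> topspace M. inv a \<otimes> x \<in> U}"
    by (rule openin_continuous_map_preimage[OF continuous_mult[OF continuous_const continuous_ident] U]) (simp add: a)
  moreover have "{x \<in> topspace M. inv a \<otimes> x \<in> U} = (\<lambda>u. a \<otimes> u) ` U"
  proof
    show "{x \<in> topspace M. inv a \<otimes> x \<in> U} \<subseteq> (\<lambda>u. a \<otimes> u) ` U"
    proof
      fix x assume "x \<in> {x \<in> topspace M. inv a \<otimes> x \<in> U}"
      then show "x \<in> (\<lambda>u. a \<otimes> u) ` U"
        using a by (intro image_eqI[of _ _ "inv a \<otimes> x"]) (auto simp: topspace_eq)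
    qed
    show "(\<lambda>u. a \<otimes> u) ` U \<subseteq> {x \<in> topspace M. inv a \<otimes> x \<in> U}"
      using a Uc by (auto simp: topspace_eq)
  qed
  ultimately show ?thesis by simp
qed

lemma open_right_translate:
  assumes a: "a \<in> carrier G" and U: "openin M U"
  shows "openin M ((\<lambda>u. u \<otimes> a) ` U)"
proof -
  have Uc: "U \<subseteq> carrier G"
    using openin_subset[OF U] topspace_eq by simp
  have "openin M {x \<in> topspace M. x \<otimes> inv a \<in> U}"
    by (rule openin_continuous_map_preimage[OF continuous_mult[OF continuous_ident continuous_const] U]) (simp add: a)
  moreover have "{x \<in> topspace M. x \<otimes> inv a \<in> U} = (\<lambda>u. u \<otimes> a) ` U"
  proof
    show "{x \<in> topspace M. x \<otimes> inv a \<in> U} \<subseteq> (\<lambda>u. u \<otimes> a) ` U"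
    proof
      fix x assume "x \<in> {x \<in> topspace M. x \<otimes> inv a \<in> U}"
      then show "x \<in> (\<lambda>u. u \<otimes> a) ` U"
        using a by (intro image_eqI[of _ _ "x \<otimes> inv a"]) (auto simp: topspace_eq m_assoc)
    qed
    show "(\<lambda>u. u \<otimes> a) ` U \<subseteq> {x \<in> topspace M. x \<otimes> inv a \<in> U}"
      using a Uc by (auto simp: topspace_eq m_assoc subset_iff)
  qed
  ultimately show ?thesis by simp
qed

sublocale group_nbhds G "{U. openin M U \<and> \<one> \<in> U}"
proof (unfold_locales, goal_cases)
  case 1
  then show ?case
    using openin_topspace[of M] by (simp add: topspace_eq)
next
  case (2 U)
  then show ?case
    using openin_subset[of M U] by (simp add: topspace_eq)
next
  case (3 U)
  then show ?case by simp
next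
  case (4 U V)
  then show ?case by (auto intro: openin_Int)
next
  case (5 U)
  have "openin (prod_topology M M) {p \<in> topspace (prod_topology M M). (\<lambda>(x, y). x \<otimes> y) p \<in> U}"
    using 5 by (intro openin_continuous_map_preimage[OF mult_continuous]) simp
  moreover have "(\<one>, \<one>) \<in> {p \<in> topspace (prod_topology M M). (\<lambda>(x, y). x \<otimes> y) p \<in> U}"
    using 5 by (simp add: topspace_eq)
  ultimately obtain A B where AB: "openin M A" "openin M B" "\<one> \<in> A" "\<one> \<in> B"
    "A \<times> B \<subseteq> {p \<in> topspace (prod_topology M M). (\<lambda>(x, y). x \<otimes> y) p \<in> U}"
    unfolding openin_prod_topology_alt by meson
  show ?case
    using AB by (intro bexI[of _ "A \<inter> B"]) auto
next
  case (6 U)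
  then have "openin M {x \<in> topspace M. inv x \<in> U}"
    by (intro openin_continuous_map_preimage[OF inv_continuous]) simp
  then show ?case
    using 6 by (intro bexI[of _ "{x \<in> topspace M. inv x \<in> U}"]) (auto simp: topspace_eq)
next
  case (7 U g)
  have "continuous_map M M (\<lambda>x. g \<otimes> x \<otimes> inv g)"
    using 7 by (intro continuous_mult continuous_const continuous_ident) auto
  then have "openin M {x \<in> topspace M. g \<otimes> x \<otimes> inv g \<in> U}"
    using 7 by (intro openin_continuous_map_preimage) auto
  then show ?case
    using 7 by (intro bexI[of _ "{x \<in> topspace M. g \<otimes> x \<otimes> inv g \<in> U}"]) (auto simp: topspace_eq)
next
  case 8
  then show ?case using nss by auto
qed

lemma compact_subset: "compactin M A \<Longrightarrow> A \<subseteq> carrier G"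
  using compactin_subset_topspace[of M A] by (simp add: topspace_eq)

text \<open>
  The tube lemma for the open set of pairs \<open>(a, v)\<close> with \<open>a v a\<^sup>-\<^sup>1 \<in> U\<close>, which contains
  \<open>A \<times> {\<one>}\<close>.
\<close>

lemma compact_imp_bounded:
  assumes A: "compactin M A"
  shows "bounded_set A"
  unfolding bounded_set_def
proof (intro conjI ballI)
  show "A \<subseteq> carrier G" by (rule compact_subset[OF A])
  fix U assume U: "U \<in> {U. openin M U \<and> \<one> \<in> U}"
  let ?W = "{p \<in> topspace (prod_topology M M). fst p \<otimes> snd p \<otimes> inv (fst p) \<in> U}"
  have "continuous_map (prod_topology M M) M (\<lambda>p. fst p \<otimes> snd p \<otimes> inv (fst p))"
    by (intro continuous_mult continuous_inv continuous_map_fst continuous_map_snd)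
  then have W: "openin (prod_topology M M) ?W"
    using U by (intro openin_continuous_map_preimage) auto
  have "A \<times> {\<one>} \<subseteq> ?W"
    using compact_subset[OF A] U by (auto simp: topspace_eq)
  then obtain C V where CV: "openin M C" "openin M V" "A \<subseteq> C" "\<one> \<in> V" "C \<times> V \<subseteq> ?W"
    using tube_lemma_left[OF W A, of \<one>] by (auto simp: topspace_eq)
  have "a \<otimes> v \<otimes> inv a \<in> U" if "a \<in> A" "v \<in> V" for a v
    using subsetD[OF CV(5), of "(a, v)"] CV(3) that by auto
  then show "\<exists>V\<in>{U. openin M U \<and> \<one> \<in> U}. \<forall>a\<in>A. \<forall>v\<in>V. a \<otimes> v \<otimes> inv a \<in> U"
    using CV by (intro bexI[of _ V]) auto
qed

lemma compact_imp_precompact: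
  assumes A: "compactin M A"
  shows "precompact_set A"
  unfolding precompact_set_def
proof (intro conjI ballI)
  show "A \<subseteq> carrier G" by (rule compact_subset[OF A])
  fix U assume U: "U \<in> {U. openin M U \<and> \<one> \<in> U}"
  let ?C = "(\<lambda>a. (\<lambda>u. a \<otimes> u) ` U) ` A"
  have "\<forall>V\<in>?C. openin M V"
    using U compact_subset[OF A] open_left_translate by auto
  moreover have "A \<subseteq> \<Union>?C"
  proof
    fix a assume a: "a \<in> A"
    then have "a = a \<otimes> \<one>" using compact_subset[OF A] by auto
    then show "a \<in> \<Union>?C" using a U by blast
  qed
  ultimately obtain \<F> where \<F>: "finite \<F>" "\<F> \<subseteq> ?C" "A \<subseteq> \<Union>\<F>"
    using A unfolding compactin_def by meson
  obtain F where F: "F \<subseteq> A" "finite F" "\<F> = (\<lambda>a. (\<lambda>u. a \<otimes> u) ` U) ` F"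
    using finite_subset_image[OF \<F>(1,2)] by blast
  have "A \<subseteq> F <#> U"
    using \<F>(3) F(3) by (force simp: mem_set_mult)
  then show "\<exists>F. finite F \<and> F \<subseteq> A \<and> A \<subseteq> F <#> U"
    using F by blast
qed

lemma compact_set_mult:
  assumes "compactin M A" "compactin M B"
  shows "compactin M (A <#> B)"
proof -
  have "compactin M ((\<lambda>(x, y). x \<otimes> y) ` (A \<times> B))"
    using assms by (intro image_compactin[OF _ mult_continuous]) (simp add: compactin_Times)
  moreover have "(\<lambda>(x, y). x \<otimes> y) ` (A \<times> B) = A <#> B"
    by (auto simp: set_mult_def)
  ultimately show ?thesis by simp
qed

lemma coset_eq_iff:
  assumes \<Gamma>: "subgroup \<Gamma> G" and "g \<in> carrier G" "h \<in> carrier G"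
  shows "g <# \<Gamma> = h <# \<Gamma> \<longleftrightarrow> (\<exists>\<gamma>\<in>\<Gamma>. g = h \<otimes> \<gamma>)"
proof
  assume "g <# \<Gamma> = h <# \<Gamma>"
  moreover have "g \<in> g <# \<Gamma>"
    using subgroup.one_closed[OF \<Gamma>] assms(2) by (force simp: l_coset_def)
  ultimately show "\<exists>\<gamma>\<in>\<Gamma>. g = h \<otimes> \<gamma>"
    by (auto simp: l_coset_def)
next
  assume "\<exists>\<gamma>\<in>\<Gamma>. g = h \<otimes> \<gamma>"
  then obtain \<gamma> where \<gamma>: "\<gamma> \<in> \<Gamma>" "g = h \<otimes> \<gamma>" by blast
  note \<Gamma>c = subgroup.mem_carrier[OF \<Gamma>]
  have "h \<otimes> \<gamma> \<otimes> \<delta> \<in> h <# \<Gamma>" if "\<delta> \<in> \<Gamma>" for \<delta>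
    using subgroup.m_closed[OF \<Gamma> \<gamma>(1) that] assms(3) \<Gamma>c[OF \<gamma>(1)] \<Gamma>c[OF that]
    by (auto simp: l_coset_def m_assoc)
  moreover have "h \<otimes> \<delta> \<in> (h \<otimes> \<gamma>) <# \<Gamma>" if "\<delta> \<in> \<Gamma>" for \<delta>
  proof -
    have "inv \<gamma> \<otimes> \<delta> \<in> \<Gamma>"
      by (rule subgroup.m_closed[OF \<Gamma> subgroup.m_inv_closed[OF \<Gamma> \<gamma>(1)] that])
    moreover have "h \<otimes> \<delta> = (h \<otimes> \<gamma>) \<otimes> (inv \<gamma> \<otimes> \<delta>)"
      using assms(3) \<Gamma>c[OF \<gamma>(1)] \<Gamma>c[OF that] by (simp add: m_assoc)
    ultimately show ?thesis
      by (auto simp: l_coset_def)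
  qed
  ultimately show "g <# \<Gamma> = h <# \<Gamma>"
    unfolding \<gamma>(2) by (auto simp: l_coset_def)
qed

lemma open_coset_image:
  assumes \<Gamma>: "subgroup \<Gamma> G" and U: "openin M U"
  shows "openin (left_coset_space G M \<Gamma>) ((\<lambda>g. g <# \<Gamma>) ` U)"
proof -
  have Uc: "U \<subseteq> carrier G"
    using openin_subset[OF U] topspace_eq by simp
  have "{g \<in> carrier G. g <# \<Gamma> \<in> (\<lambda>g. g <# \<Gamma>) ` U} = (\<Union>\<gamma>\<in>\<Gamma>. (\<lambda>u. u \<otimes> \<gamma>) ` U)"
  proof
    show "{g \<in> carrier G. g <# \<Gamma> \<in> (\<lambda>g. g <# \<Gamma>) ` U} \<subseteq> (\<Union>\<gamma>\<in>\<Gamma>. (\<lambda>u. u \<otimes> \<gamma>) ` U)"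
      using coset_eq_iff[OF \<Gamma>] Uc by fastforce
    show "(\<Union>\<gamma>\<in>\<Gamma>. (\<lambda>u. u \<otimes> \<gamma>) ` U) \<subseteq> {g \<in> carrier G. g <# \<Gamma> \<in> (\<lambda>g. g <# \<Gamma>) ` U}"
    proof
      fix g assume "g \<in> (\<Union>\<gamma>\<in>\<Gamma>. (\<lambda>u. u \<otimes> \<gamma>) ` U)"
      then obtain \<gamma> u where g: "\<gamma> \<in> \<Gamma>" "u \<in> U" "g = u \<otimes> \<gamma>" by blast
      then have c: "g \<in> carrier G" "u \<in> carrier G"
        using Uc subgroup.mem_carrier[OF \<Gamma>] by auto
      then have "g <# \<Gamma> = u <# \<Gamma>"
        using coset_eq_iff[OF \<Gamma>] g by blast
      then show "g \<in> {g \<in> carrier G. g <# \<Gamma> \<in> (\<lambda>g. g <# \<Gamma>) ` U}"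
        using c g by blast
    qed
  qed
  moreover have "openin M (\<Union>\<gamma>\<in>\<Gamma>. (\<lambda>u. u \<otimes> \<gamma>) ` U)"
    using open_right_translate[OF subgroup.mem_carrier[OF \<Gamma>] U] by (intro openin_Union) auto
  ultimately show ?thesis
    using Uc by (simp add: openin_left_coset_space[OF topspace_eq] image_mono)
qed

lemma exists_compact_cover:
  assumes \<Gamma>: "subgroup \<Gamma> G" and cpt: "compact_space (left_coset_space G M \<Gamma>)"
  shows "\<exists>K. compactin M K \<and> carrier G = K <#> \<Gamma>"
proof -
  let ?X = "left_coset_space G M \<Gamma>" and ?\<pi> = "\<lambda>g. g <# \<Gamma>"
  have top: "topspace ?X = ?\<pi> ` carrier G"
    using quotient_imp_surjective_map[OF quotient_map_left_coset_space[OF topspace_eq]] topspace_eq by metis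
  have "\<forall>g\<in>carrier G. \<exists>U K. openin M U \<and> compactin M K \<and> g \<in> U \<and> U \<subseteq> K"
    using locally_compact by (simp add: locally_compact_space_def topspace_eq)
  then obtain U K where UK: "\<And>g. g \<in> carrier G \<Longrightarrow> openin M (U g) \<and> compactin M (K g) \<and> g \<in> U g \<and> U g \<subseteq> K g"
    by metis
  let ?C = "(\<lambda>g. ?\<pi> ` U g) ` carrier G"
  have "\<forall>V\<in>?C. openin ?X V"
    using UK open_coset_image[OF \<Gamma>] by blast
  moreover have "topspace ?X \<subseteq> \<Union>?C"
    unfolding top using UK by blast
  ultimately obtain \<F> where \<F>: "finite \<F>" "\<F> \<subseteq> ?C" "topspace ?X \<subseteq> \<Union>\<F>"
    using cpt unfolding compact_space_def compactin_def by meson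
  obtain F where F: "F \<subseteq> carrier G" "finite F" "\<F> = (\<lambda>g. ?\<pi> ` U g) ` F"
    using finite_subset_image[OF \<F>(1,2)] by blast
  define L where "L = (\<Union>g\<in>F. K g)"
  have L: "compactin M L"
    unfolding L_def using F UK by (intro compactin_Union) auto
  have "carrier G \<subseteq> L <#> \<Gamma>"
  proof
    fix g assume g: "g \<in> carrier G"
    then have "?\<pi> g \<in> \<Union>\<F>"
      using \<F>(3) top by blast
    then obtain f u where f: "f \<in> F" "u \<in> U f" "?\<pi> g = ?\<pi> u"
      using F(3) by blast
    have fc: "f \<in> carrier G" using f(1) F(1) by blast
    have uL: "u \<in> L"
      using f UK[OF fc] by (auto simp: L_def)
    then have "u \<in> carrier G"
      using compact_subset[OF L] by blast
    then obtain \<gamma> where "\<gamma> \<in> \<Gamma>" "g = u \<otimes> \<gamma>"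
      using coset_eq_iff[OF \<Gamma> g] f(3) by blast
    then show "g \<in> L <#> \<Gamma>"
      using uL by (intro set_multI)
  qed
  moreover have "L <#> \<Gamma> \<subseteq> carrier G"
    using compact_subset[OF L] subgroup.subset[OF \<Gamma>] by (rule set_mult_closed)
  ultimately show ?thesis
    using L by blast
qed

lemma discrete_nbhd:
  assumes \<Gamma>: "subgroup \<Gamma> G" and disc: "subtopology M \<Gamma> = discrete_topology \<Gamma>"
  shows "\<exists>U. openin M U \<and> \<one> \<in> U \<and> U \<inter> \<Gamma> \<subseteq> {\<one>}"
proof -
  have "openin (subtopology M \<Gamma>) {\<one>}"
    unfolding disc using subgroup.one_closed[OF \<Gamma>] by simp
  then obtain U where "openin M U" "{\<one>} = U \<inter> \<Gamma>"
    by (auto simp: openin_subtopology)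
  then show ?thesis by blast
qed

text \<open>
  Discrete subgroups are closed: \<open>x\<close> has at most one representation \<open>w \<gamma>\<close> with \<open>w\<close> in a small \<open>V\<close>,
  and \<open>w \<noteq> \<one>\<close> is excluded by shrinking \<open>V\<close>.
\<close>

lemma nbhd_avoiding_coset:
  assumes \<Gamma>: "subgroup \<Gamma> G" and U0: "openin M U0" "\<one> \<in> U0" "U0 \<inter> \<Gamma> \<subseteq> {\<one>}"
    and x: "x \<in> carrier G" "x \<notin> \<Gamma>"
  shows "\<exists>W\<in>{U. openin M U \<and> \<one> \<in> U}. x \<notin> W <#> \<Gamma>"
proof -
  have U0': "U0 \<in> {U. openin M U \<and> \<one> \<in> U}" using U0 by simp
  obtain V where V: "V \<in> {U. openin M U \<and> \<one> \<in> U}" "\<forall>x\<in>V. \<forall>y\<in>V. inv x \<otimes> y \<in> U0"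
    using nb_quotient[OF U0'] by (rule bexE)
  note Vc = subsetD[OF nb_subset[OF V(1)]]
  show ?thesis
  proof (cases "x \<in> V <#> \<Gamma>")
    case False
    then show ?thesis using V by blast
  next
    case True
    then obtain w \<gamma> where w: "w \<in> V" "\<gamma> \<in> \<Gamma>" "x = w \<otimes> \<gamma>"
      by (auto simp only: mem_set_mult)
    have \<gamma>c: "\<gamma> \<in> carrier G" by (rule subgroup.mem_carrier[OF \<Gamma> w(2)])
    have "w \<noteq> \<one>"
      using w(2,3) x(2) \<gamma>c by auto
    then obtain W1 where W1: "openin M W1" "\<one> \<in> W1" "w \<notin> W1"
      using Hausdorff Vc[OF w(1)] unfolding Hausdorff_space_def topspace_eq by (metis disjnt_iff one_closed)
    have "x \<notin> (V \<inter> W1) <#> \<Gamma>"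
    proof
      assume "x \<in> (V \<inter> W1) <#> \<Gamma>"
      then obtain v \<delta> where v: "v \<in> V" "v \<in> W1" "\<delta> \<in> \<Gamma>" "x = v \<otimes> \<delta>"
        by (auto simp only: mem_set_mult)
      have \<delta>c: "\<delta> \<in> carrier G" by (rule subgroup.mem_carrier[OF \<Gamma> v(3)])
      have c: "v \<in> carrier G" "w \<in> carrier G" using Vc[OF v(1)] Vc[OF w(1)] by auto
      have "inv v \<otimes> (w \<otimes> \<gamma>) \<otimes> inv \<gamma> = inv v \<otimes> (v \<otimes> \<delta>) \<otimes> inv \<gamma>"
        using w(3) v(4) by simp
      then have "inv v \<otimes> w = \<delta> \<otimes> inv \<gamma>"
        using c \<gamma>c \<delta>c by (simp add: m_assoc)
      moreover have "\<delta> \<otimes> inv \<gamma> \<in> \<Gamma>"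
        by (rule subgroup.m_closed[OF \<Gamma> v(3) subgroup.m_inv_closed[OF \<Gamma> w(2)]])
      moreover have "inv v \<otimes> w \<in> U0"
        using v(1) w(1) V(2) by auto
      ultimately have "inv v \<otimes> w = \<one>"
        using U0(3) by auto
      then have "w = v"
        using c by (metis cancel_left_inv inv_closed r_one)
      then show False
        using v(2) W1(3) by simp
    qed
    moreover have "V \<inter> W1 \<in> {U. openin M U \<and> \<one> \<in> U}"
      using V W1 by auto
    ultimately show ?thesis by blast
  qed
qed

text \<open>
  Cube rigidity on the quotient. Replacing \<open>\<Gamma>\<close> by its conjugate \<open>\<Delta>\<close> under \<open>g\<^sub>0\<close> turns proximity to
  the base point \<open>g\<^sub>0 \<Gamma>\<close> into proximity to the lattice \<open>\<Delta>\<close>; a last vertex close to \<open>y\<^sub>0 \<Gamma>\<close> would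
  make \<open>y\<^sub>0 g\<^sub>0\<^sup>-\<^sup>1\<close> close to \<open>\<Delta>\<close>.
\<close>

theorem coset_cube_rigidity:
  assumes d: "d \<ge> 1" "upper_central d = carrier G"
    and \<Gamma>: "subgroup \<Gamma> G" and disc: "subtopology M \<Gamma> = discrete_topology \<Gamma>"
    and cpt: "compact_space (left_coset_space G M \<Gamma>)"
    and t: "t \<in> carrier G" and g0: "g0 \<in> carrier G" and y0: "y0 \<in> carrier G"
    and ne: "g0 <# \<Gamma> \<noteq> y0 <# \<Gamma>"
  shows "\<exists>O1 O2. openin (left_coset_space G M \<Gamma>) O1 \<and> openin (left_coset_space G M \<Gamma>) O2 \<and>
    g0 <# \<Gamma> \<in> O1 \<and> y0 <# \<Gamma> \<in> O2 \<and>
    (\<forall>w\<in>carrier G. \<forall>a.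
      (\<forall>\<epsilon>. length \<epsilon> = Suc d \<longrightarrow> \<epsilon> \<noteq> replicate (Suc d) True \<longrightarrow> (t [^] cube_exponent a \<epsilon> \<otimes> w) <# \<Gamma> \<in> O1) \<longrightarrow>
      (t [^] cube_exponent a (replicate (Suc d) True) \<otimes> w) <# \<Gamma> \<notin> O2)"
proof -
  let ?\<U> = "{U. openin M U \<and> \<one> \<in> U}"
  note \<Gamma>c = subgroup.mem_carrier[OF \<Gamma>] and \<Gamma>i = subgroup.m_inv_closed[OF \<Gamma>] and \<Gamma>m = subgroup.m_closed[OF \<Gamma>]
  \<comment> \<open>the stabilizer of the base point \<open>g\<^sub>0\<Gamma>\<close>\<close>
  define \<Delta> where "\<Delta> = (\<lambda>\<gamma>. g0 \<otimes> \<gamma> \<otimes> inv g0) ` \<Gamma>"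
  have \<Delta>: "subgroup \<Delta> G"
  proof (rule subgroupI)
    show "\<Delta> \<subseteq> carrier G" using \<Gamma>c g0 by (auto simp: \<Delta>_def)
    show "\<Delta> \<noteq> {}" using subgroup.one_closed[OF \<Gamma>] by (auto simp: \<Delta>_def)
    fix a assume "a \<in> \<Delta>"
    then obtain \<gamma> where \<gamma>: "\<gamma> \<in> \<Gamma>" "a = g0 \<otimes> \<gamma> \<otimes> inv g0" by (auto simp: \<Delta>_def)
    have "inv a = g0 \<otimes> inv \<gamma> \<otimes> inv g0"
      using \<gamma>(2) \<Gamma>c[OF \<gamma>(1)] g0 by (simp add: free_group_simps)
    then show "inv a \<in> \<Delta>" using \<Gamma>i[OF \<gamma>(1)] by (auto simp: \<Delta>_def)
    fix b assume "b \<in> \<Delta>"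
    then obtain \<delta> where \<delta>: "\<delta> \<in> \<Gamma>" "b = g0 \<otimes> \<delta> \<otimes> inv g0" by (auto simp: \<Delta>_def)
    have "a \<otimes> b = g0 \<otimes> (\<gamma> \<otimes> \<delta>) \<otimes> inv g0"
      using \<gamma>(2) \<delta>(2) \<Gamma>c[OF \<gamma>(1)] \<Gamma>c[OF \<delta>(1)] g0 by (simp add: free_group_simps)
    then show "a \<otimes> b \<in> \<Delta>" using \<Gamma>m[OF \<gamma>(1) \<delta>(1)] by (auto simp: \<Delta>_def)
  qed
  note \<Delta>c = subgroup.mem_carrier[OF \<Delta>] and \<Delta>m = subgroup.m_closed[OF \<Delta>] and \<Delta>i = subgroup.m_inv_closed[OF \<Delta>]
  obtain U' where U': "openin M U'" "\<one> \<in> U'" "U' \<inter> \<Gamma> \<subseteq> {\<one>}"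
    using discrete_nbhd[OF \<Gamma> disc] by blast
  obtain U0 where U0: "U0 \<in> ?\<U>" "\<forall>v\<in>U0. inv g0 \<otimes> v \<otimes> inv (inv g0) \<in> U'"
    using nb_conj[of U' "inv g0"] U' g0 by auto
  have U0\<Delta>: "U0 \<inter> \<Delta> \<subseteq> {\<one>}"
  proof
    fix x assume x: "x \<in> U0 \<inter> \<Delta>"
    then obtain \<gamma> where \<gamma>: "\<gamma> \<in> \<Gamma>" "x = g0 \<otimes> \<gamma> \<otimes> inv g0" by (auto simp: \<Delta>_def)
    have "inv g0 \<otimes> x \<otimes> inv (inv g0) = \<gamma>"
      using \<gamma>(2) \<Gamma>c[OF \<gamma>(1)] g0 by (simp add: m_assoc)
    then have "\<gamma> \<in> U'" using U0(2) x by auto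
    then have "\<gamma> = \<one>" using U'(3) \<gamma>(1) by blast
    then show "x \<in> {\<one>}" using \<gamma>(2) g0 by simp
  qed
  obtain K0 where K0: "compactin M K0" "carrier G = K0 <#> \<Gamma>"
    using exists_compact_cover[OF \<Gamma> cpt] by blast
  obtain N0 N where N: "openin M N0" "compactin M N" "\<one> \<in> N0" "N0 \<subseteq> N"
    using locally_compact unfolding locally_compact_space_def topspace_eq by (meson one_closed)
  \<comment> \<open>\<open>K\<close> has to contain \<open>t\<close> and a neighbourhood of the identity, and to be symmetric\<close>
  define L where "L = (K0 <#> {inv g0}) \<union> {t} \<union> N"
  have L: "compactin M L"
    unfolding L_def using t g0 N(2) K0(1)
    by (intro compactin_Un compact_set_mult) (auto simp: topspace_eq)
  define K where "K = L \<union> (\<lambda>x. inv x) ` L"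
  have K: "compactin M K"
    unfolding K_def by (intro compactin_Un L image_compactin[OF L inv_continuous])
  have K_inv: "inv k \<in> K" if "k \<in> K" for k
    using that compact_subset[OF L] by (auto simp: K_def)
  have cover: "carrier G = K <#> \<Delta>"
  proof
    show "K <#> \<Delta> \<subseteq> carrier G"
      using compact_subset[OF K] subgroup.subset[OF \<Delta>] by (rule set_mult_closed)
    show "carrier G \<subseteq> K <#> \<Delta>"
    proof
      fix g assume g: "g \<in> carrier G"
      have "g \<otimes> g0 \<in> K0 <#> \<Gamma>"
        using g g0 K0(2) by auto
      then obtain k \<gamma> where k: "k \<in> K0" "\<gamma> \<in> \<Gamma>" "g \<otimes> g0 = k \<otimes> \<gamma>"
        by (auto simp only: mem_set_mult)
      have kc: "k \<in> carrier G" using compact_subset[OF K0(1)] k(1) by blast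
      have "g = (g \<otimes> g0) \<otimes> inv g0"
        using g g0 by (simp add: m_assoc)
      also have "\<dots> = (k \<otimes> inv g0) \<otimes> (g0 \<otimes> \<gamma> \<otimes> inv g0)"
        unfolding k(3) using kc \<Gamma>c[OF k(2)] g0 by (simp add: m_assoc)
      finally have e: "g = (k \<otimes> inv g0) \<otimes> (g0 \<otimes> \<gamma> \<otimes> inv g0)" .
      show "g \<in> K <#> \<Delta>"
      proof (rule set_multI[OF _ _ e])
        show "k \<otimes> inv g0 \<in> K"
          using k(1) by (auto simp: K_def L_def mem_set_mult)
        show "g0 \<otimes> \<gamma> \<otimes> inv g0 \<in> \<Delta>"
          using k(2) by (auto simp: \<Delta>_def)
      qed
    qed
  qed
  have y\<Delta>: "y0 \<otimes> inv g0 \<notin> \<Delta>"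
  proof
    assume "y0 \<otimes> inv g0 \<in> \<Delta>"
    then obtain \<gamma> where \<gamma>: "\<gamma> \<in> \<Gamma>" "y0 \<otimes> inv g0 = g0 \<otimes> \<gamma> \<otimes> inv g0" by (auto simp: \<Delta>_def)
    then have "y0 = g0 \<otimes> \<gamma>"
      using y0 g0 \<Gamma>c[OF \<gamma>(1)] by (metis inv_closed m_closed right_cancel)
    then show False
      using ne coset_eq_iff[OF \<Gamma> y0 g0] \<gamma>(1) by auto
  qed
  obtain W where W: "W \<in> ?\<U>" "y0 \<otimes> inv g0 \<notin> W <#> \<Delta>"
    using nbhd_avoiding_coset[OF \<Delta> _ _ U0\<Delta> _ y\<Delta>] U0(1) y0 g0 by auto
  obtain U where U: "U \<in> ?\<U>" and UW: "\<forall>x\<in>U. \<forall>y\<in>U. inv x \<otimes> y \<in> W"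
    using nb_quotient[OF W(1)] by (rule bexE)
  note Uc = subsetD[OF nb_subset[OF U]]
  have "\<exists>V\<in>?\<U>. \<forall>w\<in>carrier G. \<forall>a.
    (\<forall>\<epsilon>. length \<epsilon> = Suc d \<longrightarrow> \<epsilon> \<noteq> replicate (Suc d) True \<longrightarrow> t [^] cube_exponent a \<epsilon> \<otimes> w \<in> V <#> \<Delta>) \<longrightarrow>
    t [^] cube_exponent a (replicate (Suc d) True) \<otimes> w \<in> U <#> \<Delta>"
  proof (rule cube_rigidity[OF d \<Delta> U0(1) U0\<Delta> compact_imp_bounded[OF K] compact_imp_precompact[OF K] K_inv _ cover _ _ _ U])
    show "precompact_set (K <#> K <#> K)"
      by (intro compact_imp_precompact compact_set_mult K)
    show "N0 \<in> ?\<U>" using N by simp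
    show "N0 \<subseteq> K" using N(4) by (auto simp: K_def L_def)
    show "t \<in> K" by (simp add: K_def L_def)
  qed
  then obtain V where V: "V \<in> ?\<U>" and rigid: "\<forall>w\<in>carrier G. \<forall>a.
    (\<forall>\<epsilon>. length \<epsilon> = Suc d \<longrightarrow> \<epsilon> \<noteq> replicate (Suc d) True \<longrightarrow> t [^] cube_exponent a \<epsilon> \<otimes> w \<in> V <#> \<Delta>) \<longrightarrow>
    t [^] cube_exponent a (replicate (Suc d) True) \<otimes> w \<in> U <#> \<Delta>"
    by (rule bexE)
  note Vc = subsetD[OF nb_subset[OF V]]
  define O1 where "O1 = (\<lambda>g. g <# \<Gamma>) ` (\<lambda>v. v \<otimes> g0) ` V"
  define O2 where "O2 = (\<lambda>g. g <# \<Gamma>) ` (\<lambda>u. u \<otimes> y0) ` U"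
  have "openin (left_coset_space G M \<Gamma>) O1"
    unfolding O1_def using V by (intro open_coset_image[OF \<Gamma>] open_right_translate[OF g0]) auto
  moreover have "openin (left_coset_space G M \<Gamma>) O2"
    unfolding O2_def using U by (intro open_coset_image[OF \<Gamma>] open_right_translate[OF y0]) auto
  moreover have "g0 <# \<Gamma> \<in> O1"
  proof -
    have "g0 = \<one> \<otimes> g0" using g0 by simp
    then show ?thesis unfolding O1_def using V by blast
  qed
  moreover have "y0 <# \<Gamma> \<in> O2"
  proof -
    have "y0 = \<one> \<otimes> y0" using y0 by simp
    then show ?thesis unfolding O2_def using U by blast
  qed
  moreover have "(t [^] cube_exponent a (replicate (Suc d) True) \<otimes> w) <# \<Gamma> \<notin> O2"
    if w: "w \<in> carrier G"
      and near: "\<forall>\<epsilon>. length \<epsilon> = Suc d \<longrightarrow> \<epsilon> \<noteq> replicate (Suc d) True \<longrightarrow> (t [^] cube_exponent a \<epsilon> \<otimes> w) <# \<Gamma> \<in> O1" for w a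
  proof
    have wg: "w \<otimes> inv g0 \<in> carrier G" using w g0 by simp
    have pc: "t [^] (n::int) \<otimes> w \<in> carrier G" for n using t w by simp
    have "t [^] cube_exponent a \<epsilon> \<otimes> (w \<otimes> inv g0) \<in> V <#> \<Delta>"
      if \<epsilon>: "length \<epsilon> = Suc d" "\<epsilon> \<noteq> replicate (Suc d) True" for \<epsilon>
    proof -
      obtain v where v: "v \<in> V" "(t [^] cube_exponent a \<epsilon> \<otimes> w) <# \<Gamma> = (v \<otimes> g0) <# \<Gamma>"
        using near[rule_format, OF \<epsilon>] by (auto simp: O1_def)
      obtain \<gamma> where \<gamma>: "\<gamma> \<in> \<Gamma>" "t [^] cube_exponent a \<epsilon> \<otimes> w = v \<otimes> g0 \<otimes> \<gamma>"
        using v(2) coset_eq_iff[OF \<Gamma> pc] Vc[OF v(1)] g0 by auto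
      have "t [^] cube_exponent a \<epsilon> \<otimes> (w \<otimes> inv g0) = (t [^] cube_exponent a \<epsilon> \<otimes> w) \<otimes> inv g0"
        using t w g0 by (simp add: m_assoc)
      also have "\<dots> = v \<otimes> (g0 \<otimes> \<gamma> \<otimes> inv g0)"
        unfolding \<gamma>(2) using Vc[OF v(1)] g0 \<Gamma>c[OF \<gamma>(1)] by (simp add: m_assoc)
      finally show ?thesis
        by (rule set_multI[OF v(1), rotated]) (use \<gamma>(1) in \<open>auto simp: \<Delta>_def\<close>)
    qed
    then have "t [^] cube_exponent a (replicate (Suc d) True) \<otimes> (w \<otimes> inv g0) \<in> U <#> \<Delta>"
      by (intro rigid[rule_format, OF wg])
    then obtain u \<delta> where u: "u \<in> U" "\<delta> \<in> \<Delta>" "t [^] cube_exponent a (replicate (Suc d) True) \<otimes> (w \<otimes> inv g0) = u \<otimes> \<delta>"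
      by (auto simp only: mem_set_mult)
    assume "(t [^] cube_exponent a (replicate (Suc d) True) \<otimes> w) <# \<Gamma> \<in> O2"
    then obtain u' where u': "u' \<in> U" "(t [^] cube_exponent a (replicate (Suc d) True) \<otimes> w) <# \<Gamma> = (u' \<otimes> y0) <# \<Gamma>"
      unfolding O2_def by blast
    obtain \<gamma> where \<gamma>: "\<gamma> \<in> \<Gamma>" "t [^] cube_exponent a (replicate (Suc d) True) \<otimes> w = u' \<otimes> y0 \<otimes> \<gamma>"
      using u'(2) coset_eq_iff[OF \<Gamma> pc m_closed[OF Uc[OF u'(1)] y0]] by blast
    define \<delta>' where "\<delta>' = g0 \<otimes> inv \<gamma> \<otimes> inv g0"
    have \<delta>': "\<delta>' \<in> \<Delta>"
      using \<Gamma>i[OF \<gamma>(1)] by (auto simp: \<Delta>_def \<delta>'_def)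
    have "u \<otimes> \<delta> = (t [^] cube_exponent a (replicate (Suc d) True) \<otimes> w) \<otimes> inv g0"
      unfolding u(3)[symmetric] using t w g0 by (simp only: m_assoc int_pow_closed inv_closed)
    then have "u \<otimes> \<delta> = u' \<otimes> y0 \<otimes> \<gamma> \<otimes> inv g0"
      unfolding \<gamma>(2) .
    then have "inv u' \<otimes> (u \<otimes> \<delta>) \<otimes> \<delta>' = inv u' \<otimes> (u' \<otimes> y0 \<otimes> \<gamma> \<otimes> inv g0) \<otimes> \<delta>'"
      by simp
    moreover have "inv u' \<otimes> (u' \<otimes> y0 \<otimes> \<gamma> \<otimes> inv g0) \<otimes> \<delta>' = y0 \<otimes> inv g0"
      using Uc[OF u'(1)] y0 g0 \<Gamma>c[OF \<gamma>(1)] by (simp add: \<delta>'_def m_assoc)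
    moreover have "inv u' \<otimes> (u \<otimes> \<delta>) \<otimes> \<delta>' = (inv u' \<otimes> u) \<otimes> (\<delta> \<otimes> \<delta>')"
      using Uc[OF u'(1)] Uc[OF u(1)] \<Delta>c[OF u(2)] \<Delta>c[OF \<delta>'] by (simp add: m_assoc)
    ultimately have "y0 \<otimes> inv g0 = (inv u' \<otimes> u) \<otimes> (\<delta> \<otimes> \<delta>')"
      by simp
    moreover have "inv u' \<otimes> u \<in> W"
      using u'(1) u(1) UW by blast
    ultimately have "y0 \<otimes> inv g0 \<in> W <#> \<Delta>"
      by (rule set_multI[OF _ \<Delta>m[OF u(2) \<delta>'], rotated])
    then show False
      using W(2) by simp
  qed
  ultimately show ?thesis
    by blast
qed

end

section \<open>Lie groups have no small subgroups\<close>

text \<open>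
  Boxes rather than balls, because they allow one coordinate to be changed at a time.
\<close>

definition coordinate_box :: "nat \<Rightarrow> (nat \<Rightarrow> real) \<Rightarrow> real \<Rightarrow> (nat \<Rightarrow> real) set" where
  "coordinate_box n p r = {x. (\<forall>i\<ge>n. x i = 0) \<and> (\<forall>i<n. \<bar>x i - p i\<bar> < r)}"

lemma coordinate_box_mono: "r \<le> s \<Longrightarrow> coordinate_box n p r \<subseteq> coordinate_box n p s"
  by (force simp: coordinate_box_def)

lemma finite_coordinate_box:
  assumes "finite I" "\<And>i. i \<in> I \<Longrightarrow> \<exists>r>0. \<forall>x\<in>coordinate_box n p r. P i x"
  shows "\<exists>r>0. \<forall>i\<in>I. \<forall>x\<in>coordinate_box n p r. P i x"
  using assms
proof (induction I rule: finite_induct)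
  case empty
  then show ?case by (auto intro: exI[of _ 1])
next
  case (insert i I)
  obtain r where r: "r > 0" "\<forall>i\<in>I. \<forall>x\<in>coordinate_box n p r. P i x"
    using insert by auto
  obtain s where s: "s > 0" "\<forall>x\<in>coordinate_box n p s. P i x"
    using insert.prems by blast
  have "coordinate_box n p (min r s) \<subseteq> coordinate_box n p r \<inter> coordinate_box n p s"
    using coordinate_box_mono[of "min r s"] by auto
  then show ?case
    using r s by (intro exI[of _ "min r s"]) auto
qed

lemma openin_Euclidean_space_coordinate_box:
  assumes S: "openin (Euclidean_space n) S" and p: "p \<in> S"
  shows "\<exists>r>0. coordinate_box n p r \<subseteq> S"
proof -
  obtain S' where S': "openin (powertop_real UNIV) S'" "S = S' \<inter> {x. \<forall>i\<ge>n. x i = 0}"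
    using S by (auto simp: Euclidean_space_def openin_subtopology)
  obtain X where X: "p \<in> (\<Pi>\<^sub>E i\<in>UNIV. X i)" "\<forall>i. openin euclideanreal (X i)" "(\<Pi>\<^sub>E i\<in>UNIV. X i) \<subseteq> S'"
    using product_topology_open_contains_basis[OF S'(1)] p S'(2) by blast
  have each: "\<exists>r>0. \<forall>x\<in>coordinate_box n p r. x i \<in> X i" if "i \<in> {..<n}" for i
  proof -
    have "open (X i)" "p i \<in> X i"
      using X by (auto simp: PiE_iff)
    then obtain r where "r > 0" "\<forall>y. dist y (p i) < r \<longrightarrow> y \<in> X i"
      by (auto simp: open_dist)
    then show ?thesis
      using that by (intro exI[of _ r]) (auto simp: coordinate_box_def dist_real_def)
  qed
  have "\<exists>r>0. \<forall>i\<in>{..<n}. \<forall>x\<in>coordinate_box n p r. x i \<in> X i"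
    by (rule finite_coordinate_box[OF finite_lessThan]) (rule each)
  then obtain r where r: "r > 0" "\<forall>i\<in>{..<n}. \<forall>x\<in>coordinate_box n p r. x i \<in> X i"
    by blast
  have "x \<in> S" if x: "x \<in> coordinate_box n p r" for x
  proof -
    have "x i \<in> X i" for i
    proof (cases "i < n")
      case False
      then have "x i = p i"
        using x p S'(2) by (auto simp: coordinate_box_def)
      then show ?thesis using X(1) by (auto simp: PiE_iff)
    qed (use r x in auto)
    then have "x \<in> S'"
      using X(3) by (auto simp: PiE_iff)
    then show ?thesis
      using x S'(2) by (auto simp: coordinate_box_def)
  qed
  then show ?thesis
    using r(1) by blast
qed

lemma mean_value_bound:
  fixes f :: "real \<Rightarrow> real"
  assumes "\<And>t. min a b \<le> t \<Longrightarrow> t \<le> max a b \<Longrightarrow> (f has_real_derivative f' t) (at t) \<and> \<bar>f' t - e\<bar> \<le> \<eta>"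
  shows "\<bar>f b - f a - e * (b - a)\<bar> \<le> \<eta> * \<bar>b - a\<bar>"
proof -
  have *: "\<bar>f v - f u - e * (v - u)\<bar> \<le> \<eta> * \<bar>v - u\<bar>"
    if uv: "u < v" and d: "\<And>t. u \<le> t \<Longrightarrow> t \<le> v \<Longrightarrow> (f has_real_derivative f' t) (at t) \<and> \<bar>f' t - e\<bar> \<le> \<eta>" for u v
  proof -
    obtain z where z: "u < z" "z < v" "f v - f u = (v - u) * f' z"
      using MVT2[OF uv, of f f'] d by blast
    have "f v - f u - e * (v - u) = (f' z - e) * (v - u)"
      using z by (simp add: algebra_simps)
    then show ?thesis
      using d[of z] z by (simp add: abs_mult mult_right_mono)
  qed
  consider "a < b" | "b < a" | "a = b" by linarith
  then show ?thesis
  proof cases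
    case 1
    then show ?thesis using *[of a b] assms by simp
  next
    case 2
    have "\<bar>f a - f b - e * (a - b)\<bar> \<le> \<eta> * \<bar>a - b\<bar>"
      using *[of b a] 2 assms by simp
    moreover have "f a - f b - e * (a - b) = - (f b - f a - e * (b - a))"
      by (simp add: algebra_simps)
    ultimately show ?thesis
      by (simp add: abs_minus_commute)
  qed simp
qed

text \<open>
  Pass from \<open>p\<close> to \<open>X\<close> by changing one coordinate after the other, and apply the mean value theorem
  to each segment.
\<close>

lemma linear_approximation_on_box:
  fixes f :: "(nat \<Rightarrow> real) \<Rightarrow> real"
  assumes p: "p \<in> coordinate_box n p r" and X: "X \<in> coordinate_box n p r"
    and deriv: "\<And>x i. x \<in> coordinate_box n p r \<Longrightarrow> i < n \<Longrightarrow>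
      ((\<lambda>t. f (x(i := t))) has_real_derivative g i x) (at (x i)) \<and> \<bar>g i x - e i\<bar> \<le> \<eta>"
  shows "\<bar>f X - f p - (\<Sum>i<n. e i * (X i - p i))\<bar> \<le> \<eta> * (\<Sum>i<n. \<bar>X i - p i\<bar>)"
proof -
  define y where "y k = (\<lambda>i. if i < k then X i else p i)" for k
  have "k \<le> n \<Longrightarrow> \<bar>f (y k) - f p - (\<Sum>i<k. e i * (X i - p i))\<bar> \<le> \<eta> * (\<Sum>i<k. \<bar>X i - p i\<bar>)" for k
  proof (induction k)
    case 0
    then show ?case by (simp add: y_def)
  next
    case (Suc k)
    have yk: "y (Suc k) = (y k)(k := X k)" "y k = (y k)(k := p k)"
      by (auto simp: y_def fun_eq_iff less_Suc_eq)
    have "\<bar>f ((y k)(k := X k)) - f ((y k)(k := p k)) - e k * (X k - p k)\<bar> \<le> \<eta> * \<bar>X k - p k\<bar>"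
    proof (rule mean_value_bound)
      fix t assume t: "min (p k) (X k) \<le> t" "t \<le> max (p k) (X k)"
      have kn: "k < n" using Suc.prems by simp
      have "\<bar>X k - p k\<bar> < r"
        using X kn by (simp add: coordinate_box_def)
      then have "\<bar>t - p k\<bar> < r"
        using t by (auto simp: min_def max_def split: if_splits)
      then have "(y k)(k := t) \<in> coordinate_box n p r"
        using X p kn by (auto simp: coordinate_box_def y_def)
      from deriv[OF this kn]
      show "((\<lambda>t. f ((y k)(k := t))) has_real_derivative g k ((y k)(k := t))) (at t) \<and> \<bar>g k ((y k)(k := t)) - e k\<bar> \<le> \<eta>"
        by simp
    qed
    then have 1: "\<bar>f (y (Suc k)) - f (y k) - e k * (X k - p k)\<bar> \<le> \<eta> * \<bar>X k - p k\<bar>"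
      using yk by simp
    have "\<bar>f (y k) - f p - (\<Sum>i<k. e i * (X i - p i))\<bar> \<le> \<eta> * (\<Sum>i<k. \<bar>X i - p i\<bar>)"
      using Suc by simp
    then have "\<bar>(f (y (Suc k)) - f (y k) - e k * (X k - p k)) + (f (y k) - f p - (\<Sum>i<k. e i * (X i - p i)))\<bar>
        \<le> \<eta> * \<bar>X k - p k\<bar> + \<eta> * (\<Sum>i<k. \<bar>X i - p i\<bar>)"
      using 1 by linarith
    moreover have "(f (y (Suc k)) - f (y k) - e k * (X k - p k)) + (f (y k) - f p - (\<Sum>i<k. e i * (X i - p i)))
        = f (y (Suc k)) - f p - (\<Sum>i<Suc k. e i * (X i - p i))"
      by simp
    ultimately show ?case
      by (simp add: distrib_left add.commute)
  qed
  from this[of n] have "\<bar>f (y n) - f p - (\<Sum>i<n. e i * (X i - p i))\<bar> \<le> \<eta> * (\<Sum>i<n. \<bar>X i - p i\<bar>)"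
    by simp
  moreover have "y n = X"
    using X p by (auto simp: y_def coordinate_box_def fun_eq_iff)
  ultimately show ?thesis by simp
qed

lemma lie_group_locally_compact:
  assumes "lie_group G M"
  shows "locally_compact_space (mtop M)"
  unfolding locally_compact_space_def
proof
  let ?E = "Euclidean_space (mdim M)"
  fix g assume g: "g \<in> topspace (mtop M)"
  have man: "smooth_manifold M"
    using assms by (simp add: lie_group_def)
  then obtain U \<phi> where U: "(U, \<phi>) \<in> atlas M" "g \<in> U"
    using g unfolding smooth_manifold_def by blast
  have oU: "openin (mtop M) U" and o\<phi>: "openin ?E (\<phi> ` U)"
    and hom: "homeomorphic_map (subtopology (mtop M) U) (subtopology ?E (\<phi> ` U)) \<phi>"
    using man U(1) unfolding smooth_manifold_def by blast+
  have "locally_compact_space (subtopology ?E (\<phi> ` U))"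
    by (rule locally_compact_space_open_subset[OF _ locally_compact_Euclidean_space o\<phi>])
      (simp add: Hausdorff_Euclidean_space)
  then have "locally_compact_space (subtopology (mtop M) U)"
    using homeomorphic_locally_compact_space homeomorphic_map_imp_homeomorphic_space[OF hom] by blast
  moreover have "g \<in> topspace (subtopology (mtop M) U)"
    using g U(2) by simp
  ultimately obtain V K where V: "openin (subtopology (mtop M) U) V" "compactin (subtopology (mtop M) U) K" "g \<in> V" "V \<subseteq> K"
    unfolding locally_compact_space_def by meson
  then show "\<exists>V K. openin (mtop M) V \<and> compactin (mtop M) K \<and> g \<in> V \<and> V \<subseteq> K"
    using oU openin_trans_full by (metis compactin_subtopology)
qed

lemma openin_coordinate_box: "openin (Euclidean_space n) (coordinate_box n p r)"
proof -
  let ?E = "Euclidean_space n"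
  have cont: "continuous_map ?E euclideanreal (\<lambda>x. x i)" for i
    unfolding Euclidean_space_def
    by (intro continuous_map_from_subtopology continuous_map_product_projection) simp
  have "openin ?E {x \<in> topspace ?E. x i \<in> ball (p i) r}" for i
    by (rule openin_continuous_map_preimage[OF cont]) simp
  then have "openin ?E ((\<Inter>i\<in>{..<n}. {x \<in> topspace ?E. x i \<in> ball (p i) r}) \<inter> topspace ?E)"
    by (intro openin_INT) auto
  moreover have "(\<Inter>i\<in>{..<n}. {x \<in> topspace ?E. x i \<in> ball (p i) r}) \<inter> topspace ?E = coordinate_box n p r"
    by (auto simp: coordinate_box_def topspace_Euclidean_space dist_real_def abs_minus_commute)
  ultimately show ?thesis by simp
qed

text \<open>
  As \<open>x \<one> = x\<close> and \<open>\<one> y = y\<close>, the differential of the multiplication at the identity is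
  \<open>(x, y) \<mapsto> x + y\<close>, so squaring has differential \<open>2\<close>. The partial derivatives are continuous,
  hence in a chart around the identity squaring differs from doubling by a small relative error.
\<close>

lemma lie_group_squaring_expands:
  fixes G :: "'g monoid" (structure)
  assumes lie: "lie_group G M"
  shows "\<exists>U \<phi> r. openin (mtop M) U \<and> \<one>\<^bsub>G\<^esub> \<in> U \<and> inj_on \<phi> U \<and> \<phi> ` U \<subseteq> coordinate_box (mdim M) (\<phi> \<one>\<^bsub>G\<^esub>) r \<and>
    (\<forall>u\<in>U. \<forall>B. (\<forall>i<mdim M. \<bar>\<phi> u i - \<phi> \<one>\<^bsub>G\<^esub> i\<bar> \<le> B) \<longrightarrow>
      (\<forall>j<mdim M. 2 * \<bar>\<phi> u j - \<phi> \<one>\<^bsub>G\<^esub> j\<bar> - B / 2 \<le> \<bar>\<phi> (u \<otimes>\<^bsub>G\<^esub> u) j - \<phi> \<one>\<^bsub>G\<^esub> j\<bar>))"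
proof -
  interpret group G using lie by (simp add: lie_group_def)
  define n where "n = mdim M"
  let ?T = "mtop M" and ?E = "Euclidean_space n" and ?E2 = "Euclidean_space (n + n)"
  have man: "smooth_manifold M" and top: "topspace ?T = carrier G"
    using lie by (auto simp: lie_group_def)
  have smooth: "smooth_map (prod_charted M M) M (\<lambda>(x, y). x \<otimes> y)"
    using lie by (simp add: lie_group_def)
  have mult_cont: "continuous_map (prod_topology ?T ?T) ?T (\<lambda>(x, y). x \<otimes> y)"
    using smooth by (simp add: smooth_map_def prod_charted_def)
  obtain U \<phi> where U: "(U, \<phi>) \<in> atlas M" and U1: "\<one> \<in> U"
    using man top one_closed unfolding smooth_manifold_def by blast
  have oU: "openin ?T U" and o\<phi>: "openin ?E (\<phi> ` U)"
    and hom: "homeomorphic_map (subtopology ?T U) (subtopology ?E (\<phi> ` U)) \<phi>"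
    using man U unfolding smooth_manifold_def n_def by blast+
  have Uc: "U \<subseteq> carrier G" and topU: "topspace (subtopology ?T U) = U"
    using openin_subset[OF oU] top by (auto simp: topspace_subtopology)
  obtain \<psi> where \<psi>: "homeomorphic_maps (subtopology ?T U) (subtopology ?E (\<phi> ` U)) \<phi> \<psi>"
    using hom unfolding homeomorphic_map_maps by blast
  have \<psi>_cont: "continuous_map (subtopology ?E (\<phi> ` U)) (subtopology ?T U) \<psi>"
    and \<psi>\<phi>: "\<And>u. u \<in> U \<Longrightarrow> \<psi> (\<phi> u) = u"
    using \<psi> topU by (auto simp: homeomorphic_maps_def)
  have \<phi>E: "\<phi> u i = 0" if "u \<in> U" "i \<ge> n" for u i
    using openin_subset[OF o\<phi>] that by (auto simp: topspace_Euclidean_space)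
  have \<phi>\<psi>: "\<phi> (\<psi> y) = y" "\<psi> y \<in> U" if "y \<in> \<phi> ` U" for y
    using that \<psi>\<phi> by auto
  have inj: "inj_on \<phi> U"
    using \<psi>\<phi> by (metis inj_onI)
  define c where "c = \<phi> \<one>"
  have c: "c \<in> \<phi> ` U" "\<psi> c = \<one>"
    using U1 \<psi>\<phi> by (auto simp: c_def)
  \<comment> \<open>the chart of \<open>G \<times> G\<close> and its two halves\<close>
  define \<Phi> where "\<Phi> = (\<lambda>(x, y) i. if i < mdim M then \<phi> x i else \<phi> y (i - mdim M))"
  define \<alpha> where "\<alpha> x = (\<lambda>i. if i < n then x i else (0::real))" for x :: "nat \<Rightarrow> real"
  define \<beta> where "\<beta> x = (\<lambda>i. if i < n then x (i + n) else (0::real))" for x :: "nat \<Rightarrow> real"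
  have \<alpha>\<Phi>: "\<alpha> (\<Phi> (u, v)) = \<phi> u" and \<beta>\<Phi>: "\<beta> (\<Phi> (u, v)) = \<phi> v" if "u \<in> U" "v \<in> U" for u v
    using \<phi>E that by (auto simp: \<alpha>_def \<beta>_def \<Phi>_def n_def fun_eq_iff)
  have inj\<Phi>: "inj_on \<Phi> (U \<times> U)"
  proof (rule inj_onI, clarsimp)
    fix u v u' v' assume *: "u \<in> U" "v \<in> U" "u' \<in> U" "v' \<in> U" "\<Phi> (u, v) = \<Phi> (u', v')"
    then have "\<phi> u = \<phi> u'" "\<phi> v = \<phi> v'"
      using \<alpha>\<Phi> \<beta>\<Phi> by metis+
    then show "u = u' \<and> v = v'"
      using inj * by (auto dest: inj_onD)
  qed
  define D where "D = \<Phi> ` ((U \<times> U) \<inter> (\<lambda>(x, y). x \<otimes> y) -` U)"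
  define F where "F = \<phi> \<circ> (\<lambda>(x, y). x \<otimes> y) \<circ> inv_into (U \<times> U) \<Phi>"
  have chart: "(U \<times> U, \<Phi>) \<in> atlas (prod_charted M M)"
    unfolding prod_charted_def charted_space.select_convs mem_Collect_eq
    by (rule exI[of _ U], rule exI[of _ \<phi>], rule exI[of _ U], rule exI[of _ \<phi>]) (simp add: \<Phi>_def U)
  note in_charts = smooth[unfolded smooth_map_def, THEN conjunct2, THEN bspec, OF chart, unfolded prod.case]
  have "mdim (prod_charted M M) = n + n"
    by (simp add: prod_charted_def n_def)
  then have "smooth_on (n + n) n D F"
    using in_charts[THEN bspec, OF U, unfolded prod.case] by (simp only: D_def F_def n_def)
  then have C1: "C_k_on (n + n) (Suc 0) D (\<lambda>x. F x j)" if "j < n" for j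
    unfolding smooth_on_def using that by blast
  define partial where "partial j i g \<longleftrightarrow>
    (\<forall>x\<in>D. ((\<lambda>t. F (x(i := t)) j) has_real_derivative g x) (at (x i))) \<and>
    continuous_map (subtopology ?E2 D) euclideanreal g" for j i g
  define g where "g j i = (SOME g. partial j i g)" for j i
  have "partial j i (g j i)" if "j < n" "i < n + n" for j i
  proof -
    have "\<exists>g. partial j i g"
      using C1[OF that(1)] that(2) by (simp add: partial_def)
    then show ?thesis
      unfolding g_def by (rule someI_ex)
  qed
  then have g: "\<And>i j x. j < n \<Longrightarrow> i < n + n \<Longrightarrow> x \<in> D \<Longrightarrow>
      ((\<lambda>t. F (x(i := t)) j) has_real_derivative g j i x) (at (x i))"
    and g_cont: "\<And>i j. j < n \<Longrightarrow> i < n + n \<Longrightarrow> continuous_map (subtopology ?E2 D) euclideanreal (g j i)"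
    unfolding partial_def by blast+
  have coord: "continuous_map ?E2 euclideanreal (\<lambda>x. x i)" for i
    unfolding Euclidean_space_def
    by (intro continuous_map_from_subtopology continuous_map_product_projection) simp
  have \<alpha>_cont: "continuous_map ?E2 ?E \<alpha>" and \<beta>_cont: "continuous_map ?E2 ?E \<beta>"
    unfolding \<alpha>_def \<beta>_def by (simp_all add: continuous_map_componentwise_Euclidean_space coord)
  define B where "B = {x \<in> topspace ?E2. \<alpha> x \<in> \<phi> ` U} \<inter> {x \<in> topspace ?E2. \<beta> x \<in> \<phi> ` U}"
  have oB: "openin ?E2 B"
    unfolding B_def
    by (intro openin_Int openin_continuous_map_preimage[OF \<alpha>_cont o\<phi>] openin_continuous_map_preimage[OF \<beta>_cont o\<phi>])
  define D' where "D' = {x \<in> topspace (subtopology ?E2 B). \<psi> (\<alpha> x) \<otimes> \<psi> (\<beta> x) \<in> U}"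
  have "openin ?E2 D'"
  proof (rule openin_trans_full[OF _ oB])
    have half: "continuous_map (subtopology ?E2 B) ?T (\<lambda>x. \<psi> (\<gamma> x))"
      if "continuous_map ?E2 ?E \<gamma>" "\<And>x. x \<in> B \<Longrightarrow> \<gamma> x \<in> \<phi> ` U" for \<gamma>
    proof -
      have "continuous_map (subtopology ?E2 B) (subtopology ?E (\<phi> ` U)) \<gamma>"
        using that by (auto simp: continuous_map_in_subtopology continuous_map_from_subtopology)
      from continuous_map_compose[OF this continuous_map_into_fulltopology[OF \<psi>_cont]]
      show ?thesis by (simp add: o_def)
    qed
    have "continuous_map (subtopology ?E2 B) (prod_topology ?T ?T) (\<lambda>x. (\<psi> (\<alpha> x), \<psi> (\<beta> x)))"
      by (intro continuous_map_pairedI half \<alpha>_cont \<beta>_cont) (auto simp: B_def)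
    from continuous_map_compose[OF this mult_cont]
    have "continuous_map (subtopology ?E2 B) ?T (\<lambda>x. \<psi> (\<alpha> x) \<otimes> \<psi> (\<beta> x))"
      by (simp add: o_def)
    then show "openin (subtopology ?E2 B) D'"
      unfolding D'_def by (rule openin_continuous_map_preimage[OF _ oU])
  qed
  have D'D: "x \<in> D \<and> F x = \<phi> (\<psi> (\<alpha> x) \<otimes> \<psi> (\<beta> x))" if x: "x \<in> D'" for x
  proof -
    have ab: "\<alpha> x \<in> \<phi> ` U" "\<beta> x \<in> \<phi> ` U" and xE: "\<And>i. i \<ge> n + n \<Longrightarrow> x i = 0"
      and m: "\<psi> (\<alpha> x) \<otimes> \<psi> (\<beta> x) \<in> U"
      using x by (auto simp: D'_def B_def topspace_Euclidean_space)
    have \<Phi>x: "\<Phi> (\<psi> (\<alpha> x), \<psi> (\<beta> x)) = x"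
    proof
      fix i show "\<Phi> (\<psi> (\<alpha> x), \<psi> (\<beta> x)) i = x i"
        using \<phi>\<psi>(1)[OF ab(1)] \<phi>\<psi>(1)[OF ab(2)] xE[of i]
        by (auto simp: \<Phi>_def \<alpha>_def \<beta>_def n_def not_less)
    qed
    have mem: "(\<psi> (\<alpha> x), \<psi> (\<beta> x)) \<in> U \<times> U"
      using \<phi>\<psi>(2) ab by simp
    have "inv_into (U \<times> U) \<Phi> x = (\<psi> (\<alpha> x), \<psi> (\<beta> x))"
      using inv_into_f_f[OF inj\<Phi> mem] \<Phi>x by simp
    then have "F x = \<phi> (\<psi> (\<alpha> x) \<otimes> \<psi> (\<beta> x))"
      by (simp add: F_def)
    moreover have "\<Phi> (\<psi> (\<alpha> x), \<psi> (\<beta> x)) \<in> D"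
      unfolding D_def using mem m by (intro imageI) simp
    ultimately show ?thesis
      using \<Phi>x by simp
  qed
  define p where "p = \<Phi> (\<one>, \<one>)"
  have p_half: "\<alpha> p = c" "\<beta> p = c"
    unfolding p_def c_def by (rule \<alpha>\<Phi>[OF U1 U1], rule \<beta>\<Phi>[OF U1 U1])
  have pE: "p i = 0" if "i \<ge> n + n" for i
    using that \<phi>E[OF U1] by (simp add: p_def \<Phi>_def n_def)
  have pD': "p \<in> D'"
    using p_half c U1 pE by (simp add: D'_def B_def topspace_Euclidean_space)
  obtain r0 where r0: "r0 > 0" "coordinate_box (n + n) p r0 \<subseteq> D'"
    using openin_Euclidean_space_coordinate_box[OF \<open>openin ?E2 D'\<close> pD'] by blast
  define e where "e j i = (if i = j \<or> i = j + n then 1 else (0::real))" for i j :: nat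
  \<comment> \<open>since \<open>x \<one> = x\<close> and \<open>\<one> y = y\<close>, the partial derivatives at the identity are those of \<open>x + y\<close>\<close>
  have g_p: "g j i p = e j i" if j: "j < n" and i: "i < n + n" for i j
  proof -
    define k where "k = (if i < n then j else j + n)"
    have Fk: "(p(i := t)) k = F (p(i := t)) j" if t: "dist t (p i) < r0" for t
    proof -
      have "p(i := t) \<in> coordinate_box (n + n) p r0"
        using t i pE r0(1) by (auto simp: coordinate_box_def dist_real_def)
      then have tD: "p(i := t) \<in> D'"
        using r0(2) by blast
      then have ab: "\<alpha> (p(i := t)) \<in> \<phi> ` U" "\<beta> (p(i := t)) \<in> \<phi> ` U"
        by (auto simp: D'_def B_def)
      show ?thesis
      proof (cases "i < n")
        case True
        then have "\<beta> (p(i := t)) = \<beta> p"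
          by (auto simp: \<beta>_def fun_eq_iff)
        then have "\<psi> (\<beta> (p(i := t))) = \<one>"
          using p_half c by simp
        then have "F (p(i := t)) = \<alpha> (p(i := t))"
          using D'D[OF tD] \<phi>\<psi>[OF ab(1)] Uc by auto
        then show ?thesis
          using True j by (simp add: \<alpha>_def k_def)
      next
        case False
        then have "\<alpha> (p(i := t)) = \<alpha> p"
          by (auto simp: \<alpha>_def fun_eq_iff)
        then have "\<psi> (\<alpha> (p(i := t))) = \<one>"
          using p_half c by simp
        then have "F (p(i := t)) = \<beta> (p(i := t))"
          using D'D[OF tD] \<phi>\<psi>[OF ab(2)] Uc by auto
        then show ?thesis
          using False j by (simp add: \<beta>_def k_def)
      qed
    qed
    have "((\<lambda>t. (p(i := t)) k) has_real_derivative e j i) (at (p i))"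
    proof (cases "k = i")
      case True
      then have "e j i = 1" by (auto simp: e_def k_def split: if_splits)
      then show ?thesis using True by simp
    next
      case False
      then have "e j i = 0" using j by (auto simp: e_def k_def split: if_splits)
      then show ?thesis using False by simp
    qed
    then have "((\<lambda>t. F (p(i := t)) j) has_real_derivative e j i) (at (p i))"
      by (rule has_field_derivative_transform_within[OF _ r0(1)]) (use Fk in auto)
    moreover have "((\<lambda>t. F (p(i := t)) j) has_real_derivative g j i p) (at (p i))"
      using g[OF j i] D'D[OF pD'] by blast
    ultimately show ?thesis
      by (rule DERIV_unique[symmetric])
  qed
  \<comment> \<open>a linear approximation with slope error \<open>\<eta>\<close> in \<open>2 n\<close> variables has error at most \<open>B / 2\<close>\<close>
  define \<eta> where "\<eta> = 1 / (4 * real n + 4)"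
  have \<eta>: "\<eta> > 0" "\<eta> * (2 * real n) \<le> 1 / 2"
    by (auto simp: \<eta>_def field_simps)
  have near: "\<exists>r>0. \<forall>x\<in>coordinate_box (n + n) p r. \<bar>g (fst k) (snd k) x - e (fst k) (snd k)\<bar> \<le> \<eta>"
    if k: "k \<in> {..<n} \<times> {..<n + n}" for k
  proof -
    let ?g = "g (fst k) (snd k)"
    have jk: "fst k < n" "snd k < n + n" using k by auto
    have "openin (subtopology ?E2 D) {x \<in> topspace (subtopology ?E2 D). ?g x \<in> ball (?g p) \<eta>}"
      by (rule openin_continuous_map_preimage[OF g_cont[OF jk]]) simp
    then obtain V where V: "openin ?E2 V" "{x \<in> topspace (subtopology ?E2 D). ?g x \<in> ball (?g p) \<eta>} = V \<inter> D"
      by (auto simp: openin_subtopology)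
    have "p \<in> {x \<in> topspace (subtopology ?E2 D). ?g x \<in> ball (?g p) \<eta>}"
      using D'D[OF pD'] pE \<eta> by (simp add: topspace_Euclidean_space)
    then have "p \<in> V \<inter> D'"
      using V(2) pD' by blast
    then obtain r where r: "r > 0" "coordinate_box (n + n) p r \<subseteq> V \<inter> D'"
      using openin_Euclidean_space_coordinate_box openin_Int[OF V(1) \<open>openin ?E2 D'\<close>] by blast
    have "\<bar>?g x - e (fst k) (snd k)\<bar> \<le> \<eta>" if "x \<in> coordinate_box (n + n) p r" for x
    proof -
      have "x \<in> V \<inter> D" using r(2) that D'D by blast
      then have "?g x \<in> ball (?g p) \<eta>" using V(2) by blast
      then show ?thesis
        using g_p[OF jk] by (simp add: dist_real_def)
    qed
    then show ?thesis using r(1) by blast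
  qed
  have "\<exists>r>0. \<forall>k\<in>{..<n} \<times> {..<n + n}. \<forall>x\<in>coordinate_box (n + n) p r. \<bar>g (fst k) (snd k) x - e (fst k) (snd k)\<bar> \<le> \<eta>"
    by (rule finite_coordinate_box) (simp, rule near)
  then obtain r1 where r1: "r1 > 0"
    "\<forall>k\<in>{..<n} \<times> {..<n + n}. \<forall>x\<in>coordinate_box (n + n) p r1. \<bar>g (fst k) (snd k) x - e (fst k) (snd k)\<bar> \<le> \<eta>"
    by blast
  define r where "r = min r0 r1"
  have r: "r > 0" "coordinate_box (n + n) p r \<subseteq> D'"
    "\<And>j i x. j < n \<Longrightarrow> i < n + n \<Longrightarrow> x \<in> coordinate_box (n + n) p r \<Longrightarrow> \<bar>g j i x - e j i\<bar> \<le> \<eta>"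
  proof -
    have sub: "coordinate_box (n + n) p r \<subseteq> coordinate_box (n + n) p r0"
      "coordinate_box (n + n) p r \<subseteq> coordinate_box (n + n) p r1"
      by (rule coordinate_box_mono, simp add: r_def)+
    show "r > 0" using r0(1) r1(1) by (simp add: r_def)
    show "coordinate_box (n + n) p r \<subseteq> D'" using sub(1) r0(2) by blast
    show "\<bar>g j i x - e j i\<bar> \<le> \<eta>" if "j < n" "i < n + n" "x \<in> coordinate_box (n + n) p r" for j i x
      using r1(2)[rule_format, of "(j, i)" x] subsetD[OF sub(2) that(3)] that(1,2) by simp
  qed
  define V where "V = {u \<in> topspace (subtopology ?T U). \<phi> u \<in> coordinate_box n c r}"
  have "openin (subtopology ?T U) V"
    unfolding V_def
    using homeomorphic_imp_continuous_map[OF hom] openin_coordinate_box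
    by (intro openin_continuous_map_preimage[OF continuous_map_into_fulltopology]) auto
  then have oV: "openin ?T V"
    using oU by (rule openin_trans_full)
  have V1: "\<one> \<in> V"
    using U1 \<phi>E[OF U1] r(1) topU by (simp add: V_def c_def coordinate_box_def)
  have VU: "V \<subseteq> U"
    using topU by (auto simp: V_def)
  have expand: "2 * \<bar>\<phi> u j - c j\<bar> - B / 2 \<le> \<bar>\<phi> (u \<otimes> u) j - c j\<bar>"
    if u: "u \<in> V" and B: "\<forall>i<n. \<bar>\<phi> u i - c i\<bar> \<le> B" and j: "j < n" for u B j
  proof -
    have uU: "u \<in> U" and ubox: "\<phi> u \<in> coordinate_box n c r"
      using u VU by (auto simp: V_def)
    define X where "X = \<Phi> (u, u)"
    have Xp: "X i - p i = (if i < n then \<phi> u i - c i else \<phi> u (i - n) - c (i - n))" for i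
      by (simp add: X_def p_def \<Phi>_def n_def c_def)
    have Xbox: "X \<in> coordinate_box (n + n) p r"
    proof -
      have "X i = 0" if "i \<ge> n + n" for i
        using that \<phi>E[OF uU] by (simp add: X_def \<Phi>_def n_def)
      moreover have "\<bar>X i - p i\<bar> < r" if "i < n + n" for i
        unfolding Xp using that ubox by (auto simp: coordinate_box_def)
      ultimately show ?thesis by (simp add: coordinate_box_def)
    qed
    have pbox: "p \<in> coordinate_box (n + n) p r"
      using pE r(1) by (simp add: coordinate_box_def)
    have "\<bar>F X j - F p j - (\<Sum>i<n + n. e j i * (X i - p i))\<bar> \<le> \<eta> * (\<Sum>i<n + n. \<bar>X i - p i\<bar>)"
    proof (rule linear_approximation_on_box[OF pbox Xbox])
      fix x i assume x: "x \<in> coordinate_box (n + n) p r" and i: "i < n + n"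
      then show "((\<lambda>t. F (x(i := t)) j) has_real_derivative g j i x) (at (x i)) \<and> \<bar>g j i x - e j i\<bar> \<le> \<eta>"
        using g[OF j i] D'D r(2) r(3)[OF j i x] by blast
    qed
    moreover have "F X j = \<phi> (u \<otimes> u) j"
      using D'D[of X] r(2) Xbox \<alpha>\<Phi>[OF uU uU] \<beta>\<Phi>[OF uU uU] \<psi>\<phi>[OF uU] by (auto simp: X_def)
    moreover have "F p j = c j"
      using D'D[OF pD'] p_half c by (simp add: c_def)
    moreover have "(\<Sum>i<n + n. e j i * (X i - p i)) = 2 * (\<phi> u j - c j)"
    proof -
      have "(\<Sum>i<n + n. e j i * (X i - p i)) =
          (\<Sum>i<n + n. (if i = j then X i - p i else 0) + (if i = j + n then X i - p i else 0))"
        using j by (intro sum.cong) (auto simp: e_def)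
      also have "\<dots> = (\<Sum>i<n + n. if i = j then X i - p i else 0) + (\<Sum>i<n + n. if i = j + n then X i - p i else 0)"
        by (rule sum.distrib)
      also have "\<dots> = (X j - p j) + (X (j + n) - p (j + n))"
      proof -
        have "j \<in> {..<n + n}" "j + n \<in> {..<n + n}" using j by auto
        then show ?thesis
          by (simp only: sum.delta[OF finite_lessThan] if_True)
      qed
      also have "\<dots> = 2 * (\<phi> u j - c j)"
        unfolding Xp using j by simp
      finally show ?thesis .
    qed
    moreover have "\<eta> * (\<Sum>i<n + n. \<bar>X i - p i\<bar>) \<le> B / 2"
    proof -
      have B0: "B \<ge> 0"
        using B j by (meson abs_ge_zero order_trans)
      have "(\<Sum>i<n + n. \<bar>X i - p i\<bar>) \<le> (\<Sum>i<n + n. B)"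
        unfolding Xp using B by (intro sum_mono) auto
      then have "\<eta> * (\<Sum>i<n + n. \<bar>X i - p i\<bar>) \<le> \<eta> * (2 * real n * B)"
        using \<eta>(1) by (intro mult_left_mono) auto
      also have "\<dots> = (\<eta> * (2 * real n)) * B"
        by simp
      also have "\<dots> \<le> (1 / 2) * B"
        using \<eta>(2) B0 by (rule mult_right_mono)
      finally show ?thesis by simp
    qed
    ultimately show ?thesis by linarith
  qed
  show ?thesis
  proof (intro exI[of _ V] exI[of _ \<phi>] exI[of _ r] conjI)
    show "\<phi> ` V \<subseteq> coordinate_box (mdim M) (\<phi> \<one>) r"
      by (auto simp: V_def c_def n_def)
    show "inj_on \<phi> V"
      using inj VU by (rule inj_on_subset)
    show "\<forall>u\<in>V. \<forall>B. (\<forall>i<mdim M. \<bar>\<phi> u i - \<phi> \<one> i\<bar> \<le> B) \<longrightarrow>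
      (\<forall>j<mdim M. 2 * \<bar>\<phi> u j - \<phi> \<one> j\<bar> - B / 2 \<le> \<bar>\<phi> (u \<otimes> u) j - \<phi> \<one> j\<bar>)"
      using expand by (simp add: c_def n_def)
  qed (rule oV V1)+
qed

text \<open>
  Squaring multiplies the distance from the identity in the chart by at least \<open>3/2\<close>, so the iterated
  squares of an element other than \<open>\<one>\<close> leave the bounded chart domain.
\<close>

lemma lie_group_no_small_subgroups:
  fixes G :: "'g monoid" (structure)
  assumes lie: "lie_group G M"
  shows "\<exists>U. openin (mtop M) U \<and> \<one>\<^bsub>G\<^esub> \<in> U \<and> (\<forall>H. subgroup H G \<longrightarrow> H \<subseteq> U \<longrightarrow> H = {\<one>\<^bsub>G\<^esub>})"
proof -
  interpret group G using lie by (simp add: lie_group_def)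
  define n where "n = mdim M"
  obtain U \<phi> r where U: "openin (mtop M) U" "\<one> \<in> U" "inj_on \<phi> U"
    and box: "\<phi> ` U \<subseteq> coordinate_box n (\<phi> \<one>) r"
    and ex: "\<forall>u\<in>U. \<forall>B. (\<forall>i<n. \<bar>\<phi> u i - \<phi> \<one> i\<bar> \<le> B) \<longrightarrow>
      (\<forall>j<n. 2 * \<bar>\<phi> u j - \<phi> \<one> j\<bar> - B / 2 \<le> \<bar>\<phi> (u \<otimes> u) j - \<phi> \<one> j\<bar>)"
    using lie_group_squaring_expands[OF lie, folded n_def] by (elim exE conjE)
  note expand = ex[rule_format]
  have "H = {\<one>}" if H: "subgroup H G" "H \<subseteq> U" for H
  proof -
    define N where "N u = Max (insert 0 ((\<lambda>i. \<bar>\<phi> u i - \<phi> \<one> i\<bar>) ` {..<n}))" for u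
    have N_ge: "\<bar>\<phi> u i - \<phi> \<one> i\<bar> \<le> N u" if "i < n" for u i
      unfolding N_def using that by (intro Max_ge) auto
    have N_le: "N u \<le> r \<or> N u = 0" if "u \<in> U" for u
    proof -
      have "N u \<in> insert 0 ((\<lambda>i. \<bar>\<phi> u i - \<phi> \<one> i\<bar>) ` {..<n})"
        unfolding N_def by (rule Max_in) auto
      then show ?thesis
        using box that by (auto simp: coordinate_box_def image_subset_iff intro: less_imp_le)
    qed
    have double: "3 / 2 * N u \<le> N (u \<otimes> u)" if u: "u \<in> U" for u
    proof -
      have "N u \<in> insert 0 ((\<lambda>i. \<bar>\<phi> u i - \<phi> \<one> i\<bar>) ` {..<n})"
        unfolding N_def by (rule Max_in) auto
      then consider "N u = 0" | j where "j < n" "N u = \<bar>\<phi> u j - \<phi> \<one> j\<bar>"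
        by auto
      then show ?thesis
      proof cases
        case 1
        have "0 \<le> N (u \<otimes> u)"
          unfolding N_def by (rule Max_ge) auto
        then show ?thesis using 1 by simp
      next
        case 2
        have a: "2 * N u - N u / 2 \<le> \<bar>\<phi> (u \<otimes> u) j - \<phi> \<one> j\<bar>"
          using expand[OF u N_ge 2(1)] by (simp only: 2(2)[symmetric])
        show ?thesis
          using order_trans[OF a N_ge[OF 2(1), of "u \<otimes> u"]] by simp
      qed
    qed
    have "h = \<one>" if h: "h \<in> H" for h
    proof -
      define s where "s k = ((\<lambda>u. u \<otimes> u) ^^ k) h" for k
      have sH: "s k \<in> H" for k
        by (induction k) (auto simp: s_def h intro: subgroup.m_closed[OF H(1)])
      have grow: "(3 / 2) ^ k * N h \<le> N (s k)" for k
      proof (induction k)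
        case 0
        then show ?case by (simp add: s_def)
      next
        case (Suc k)
        have "(3 / 2) ^ Suc k * N h = 3 / 2 * ((3 / 2) ^ k * N h)" by simp
        also have "\<dots> \<le> 3 / 2 * N (s k)" by (rule mult_left_mono[OF Suc]) simp
        also have "\<dots> \<le> N (s k \<otimes> s k)"
          using sH H(2) by (intro double) auto
        finally show ?case by (simp add: s_def)
      qed
      have "N h = 0"
      proof (rule ccontr)
        assume "N h \<noteq> 0"
        moreover have "0 \<le> N h"
          unfolding N_def by (rule Max_ge) auto
        ultimately have pos: "N h > 0" by simp
        obtain k where k: "\<bar>r\<bar> / N h < (3 / 2) ^ k"
        proof -
          have "1 < (3 / 2 :: real)" by simp
          from real_arch_pow[OF this] show thesis
            using that by blast
        qed
        have "\<bar>r\<bar> < (3 / 2) ^ k * N h"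
          using k pos_divide_less_eq[OF pos] by blast
        then have "\<bar>r\<bar> < N (s k)"
          using grow[of k] by (rule less_le_trans)
        then show False
          using N_le[OF subsetD[OF H(2) sH[of k]]] by (elim disjE) linarith+
      qed
      then have eq: "\<phi> h i = \<phi> \<one> i" if "i < n" for i
        using N_ge[OF that, of h] by simp
      have "\<phi> h = \<phi> \<one>"
      proof
        fix i show "\<phi> h i = \<phi> \<one> i"
        proof (cases "i < n")
          case False
          have "\<phi> h \<in> coordinate_box n (\<phi> \<one>) r" "\<phi> \<one> \<in> coordinate_box n (\<phi> \<one>) r"
            using box h H(2) U(2) by auto
          then show ?thesis using False by (simp add: coordinate_box_def)
        qed (rule eq)
      qed
      then show ?thesis
        using inj_onD[OF U(3)] h H(2) U(2) by blast
    qed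
    then show ?thesis
      using subgroup.one_closed[OF H(1)] by blast
  qed
  then show ?thesis
    using U by blast
qed

lemma lie_group_nss_topological_group:
  fixes G :: "'g monoid" (structure)
  assumes "lie_group G M"
  shows "nss_topological_group G (mtop M)"
proof -
  interpret group G using assms by (simp add: lie_group_def)
  show ?thesis
  proof unfold_locales
    show "topspace (mtop M) = carrier G" "Hausdorff_space (mtop M)"
      using assms by (auto simp: lie_group_def smooth_manifold_def)
    show "continuous_map (prod_topology (mtop M) (mtop M)) (mtop M) (\<lambda>(x, y). x \<otimes> y)"
      "continuous_map (mtop M) (mtop M) (\<lambda>x. inv x)"
      using assms by (auto simp: lie_group_def smooth_map_def prod_charted_def)
    show "locally_compact_space (mtop M)"
      by (rule lie_group_locally_compact[OF assms])
  qed (rule lie_group_no_small_subgroups[OF assms])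
qed

section \<open>Enveloping semigroups of cube-rigid systems\<close>

lemma compact_UNIV_fun: "compact (UNIV :: 'a::topological_space set) \<Longrightarrow> compact (UNIV :: ('b \<Rightarrow> 'a) set)"
proof -
  assume "compact (UNIV :: 'a set)"
  then have "compact_space (euclidean :: 'a topology)"
    by (simp add: compact_space_def)
  then have "compact_space (product_topology (\<lambda>_. euclidean :: 'a topology) (UNIV :: 'b set))"
    by (simp add: compact_space_product_topology)
  then show ?thesis
    unfolding euclidean_product_topology by (simp add: compact_space_def)
qed

lemma compact_imp_closed_fun:
  fixes S :: "('b \<Rightarrow> 'a::metric_space) set"
  assumes "compact S"
  shows "closed S"
proof -
  have "Hausdorff_space (product_topology (\<lambda>_. euclidean :: 'a topology) (UNIV :: 'b set))"
    by (simp add: Hausdorff_space_product_topology)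
  then have "Hausdorff_space (euclidean :: ('b \<Rightarrow> 'a) topology)"
    unfolding euclidean_product_topology .
  then show ?thesis
    using compactin_imp_closedin[of euclidean S] assms by simp
qed

lemma continuous_comp_right:
  fixes g :: "'c \<Rightarrow> 'b"
  shows "continuous_on UNIV (\<lambda>h :: 'b \<Rightarrow> 'a::topological_space. h \<circ> g)"
  by (rule continuous_on_coordinatewise_then_product) (simp add: continuous_on_product_coordinates)

lemma closed_vimage_UNIV:
  "continuous_on UNIV f \<Longrightarrow> closed S \<Longrightarrow> closed (f -` S)"
  using closed_vimage by blast

text \<open>
  The Ellis--Numakura lemma. By compactness there is a minimal closed subsemigroup \<open>A\<close>. For
  \<open>u \<in> A\<close> the closed subsemigroup \<open>A \<circ> u\<close> is all of \<open>A\<close>, so \<open>h \<circ> u = u\<close> for some \<open>h \<in> A\<close>; such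
  \<open>h\<close> form a closed subsemigroup, which is again \<open>A\<close> and hence contains \<open>u\<close>. The argument
  rests on the continuity of \<open>h \<mapsto> h \<circ> u\<close>.
\<close>

lemma exists_idempotent:
  fixes S :: "('a::metric_space \<Rightarrow> 'a) set"
  assumes cpt: "compact (UNIV :: 'a set)" and S: "closed S" "S \<noteq> {}" "\<And>u v. u \<in> S \<Longrightarrow> v \<in> S \<Longrightarrow> u \<circ> v \<in> S"
  shows "\<exists>u\<in>S. u \<circ> u = u"
proof -
  have cptF: "compact A" if "closed A" for A :: "('a \<Rightarrow> 'a) set"
    using compact_Int_closed[OF compact_UNIV_fun[OF cpt] that] by simp
  define P where "P A \<longleftrightarrow> closed A \<and> A \<noteq> {} \<and> A \<subseteq> S \<and> (\<forall>u\<in>A. \<forall>v\<in>A. u \<circ> v \<in> A)" for A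
  \<comment> \<open>Zorn's lemma for maximal elements is applied to the complements\<close>
  have "\<exists>M\<in>uminus ` Collect P. \<forall>X\<in>uminus ` Collect P. M \<subseteq> X \<longrightarrow> X = M"
  proof (rule subset_Zorn_nonempty)
    have "P S" using S by (simp add: P_def)
    then show "uminus ` Collect P \<noteq> {}" by blast
    fix \<C> assume ne: "\<C> \<noteq> {}" and chain: "subset.chain (uminus ` Collect P) \<C>"
    define \<F> where "\<F> = uminus ` \<C>"
    have \<F>P: "P A" if "A \<in> \<F>" for A
      using that chain unfolding \<F>_def subset.chain_def by auto
    have lin: "A \<subseteq> B \<or> B \<subseteq> A" if AB: "A \<in> \<F>" "B \<in> \<F>" for A B
    proof -
      obtain X Y where "X \<in> \<C>" "A = - X" "Y \<in> \<C>" "B = - Y"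
        using AB unfolding \<F>_def by blast
      moreover from this have "X \<subseteq> Y \<or> Y \<subseteq> X"
        using chain unfolding subset_chain_def by blast
      ultimately show ?thesis by auto
    qed
    have fin: "finite \<G> \<Longrightarrow> \<G> \<noteq> {} \<Longrightarrow> \<G> \<subseteq> \<F> \<Longrightarrow> \<Inter>\<G> \<in> \<G>" for \<G>
    proof (induction \<G> rule: finite_ne_induct)
      case (insert A \<G>)
      then have "\<Inter>\<G> \<in> \<F>" "A \<in> \<F>" "\<Inter>\<G> \<in> \<G>" by auto
      then show ?case
        using lin[of A "\<Inter>\<G>"] by (auto simp: Int_absorb1 Int_absorb2)
    qed simp
    have "UNIV \<inter> \<Inter>\<F> \<noteq> {}"
    proof (rule compact_imp_fip[OF compact_UNIV_fun[OF cpt]])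
      show "closed A" if "A \<in> \<F>" for A
        using \<F>P[OF that] by (simp add: P_def)
      fix \<G> assume \<G>: "finite \<G>" "\<G> \<subseteq> \<F>"
      show "UNIV \<inter> \<Inter>\<G> \<noteq> {}"
      proof (cases "\<G> = {}")
        case False
        have "\<Inter>\<G> \<in> \<F>" by (rule subsetD[OF \<G>(2) fin[OF \<G>(1) False \<G>(2)]])
        from \<F>P[OF this] show ?thesis by (simp add: P_def)
      qed simp
    qed
    moreover obtain A where A: "A \<in> \<F>" using ne by (auto simp: \<F>_def)
    moreover have "closed (\<Inter>\<F>)"
      using \<F>P by (intro closed_Inter ballI) (simp add: P_def)
    moreover have "\<Inter>\<F> \<subseteq> S"
      using A \<F>P[OF A] by (auto simp: P_def)
    moreover have "u \<circ> v \<in> \<Inter>\<F>" if "u \<in> \<Inter>\<F>" "v \<in> \<Inter>\<F>" for u v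
    proof
      fix X assume X: "X \<in> \<F>"
      then have "u \<in> X" "v \<in> X" using that by auto
      then show "u \<circ> v \<in> X" using \<F>P[OF X] by (simp add: P_def)
    qed
    ultimately have "P (\<Inter>\<F>)"
      unfolding P_def by simp
    moreover have "\<Union>\<C> = - \<Inter>\<F>"
      by (auto simp: \<F>_def)
    ultimately show "\<Union>\<C> \<in> uminus ` Collect P"
      by (intro image_eqI[of _ _ "\<Inter>\<F>"]) simp_all
  qed
  then obtain A where A: "P A" and "\<forall>X\<in>uminus ` Collect P. - A \<subseteq> X \<longrightarrow> X = - A"
    by blast
  then have min: "B = A" if "P B" "B \<subseteq> A" for B
    using that by (metis Compl_subset_Compl_iff double_complement imageI mem_Collect_eq)
  have cl: "closed A" and ne: "A \<noteq> {}" and AS: "A \<subseteq> S" and mult: "\<And>u v. u \<in> A \<Longrightarrow> v \<in> A \<Longrightarrow> u \<circ> v \<in> A"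
    using A by (auto simp: P_def)
  obtain u where u: "u \<in> A" using ne by blast
  have "P ((\<lambda>h. h \<circ> u) ` A)"
  proof -
    have "compact ((\<lambda>h. h \<circ> u) ` A)"
      by (rule compact_continuous_image[OF continuous_on_subset[OF continuous_comp_right] cptF[OF cl]]) simp
    then have "closed ((\<lambda>h. h \<circ> u) ` A)"
      by (rule compact_imp_closed_fun)
    moreover have "(h \<circ> u) \<circ> (k \<circ> u) \<in> (\<lambda>h. h \<circ> u) ` A" if "h \<in> A" "k \<in> A" for h k
      using mult[OF mult[OF that(1) u] that(2)] by (auto simp: o_assoc)
    ultimately show ?thesis
      using u mult AS by (auto simp: P_def)
  qed
  then have "(\<lambda>h. h \<circ> u) ` A = A"
    by (rule min) (use mult u in auto)
  then obtain h where h: "h \<in> A" "h \<circ> u = u"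
    using u by (metis (no_types, lifting) imageE)
  have "P {h \<in> A. h \<circ> u = u}"
  proof -
    have "{h \<in> A. h \<circ> u = u} = A \<inter> (\<lambda>h. h \<circ> u) -` {u}" by auto
    moreover have "closed (A \<inter> (\<lambda>h. h \<circ> u) -` {u})"
      by (intro closed_Int cl closed_vimage_UNIV continuous_comp_right compact_imp_closed_fun) simp
    ultimately have "closed {h \<in> A. h \<circ> u = u}" by simp
    moreover have "k \<circ> h \<in> {h \<in> A. h \<circ> u = u}" if "k \<in> {h \<in> A. h \<circ> u = u}" "h \<in> {h \<in> A. h \<circ> u = u}" for h k
      using that mult by (simp add: comp_assoc)
    ultimately show ?thesis
      using h AS unfolding P_def by blast
  qed
  then have "{h \<in> A. h \<circ> u = u} = A"
    by (rule min) auto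
  then have "u \<circ> u = u" using u by blast
  then show ?thesis
    using u AS by blast
qed

definition upper_facet :: "nat \<Rightarrow> bool list set" where
  "upper_facet i = {\<epsilon>. i < length \<epsilon> \<and> \<epsilon> ! i}"

definition face_action :: "bool list set \<Rightarrow> ('a \<Rightarrow> 'a) \<Rightarrow> (bool list \<Rightarrow> 'a) \<Rightarrow> bool list \<Rightarrow> 'a" where
  "face_action A u z = (\<lambda>\<epsilon>. if \<epsilon> \<in> A then u (z \<epsilon>) else z \<epsilon>)"

text \<open>
  The index runs through the lists of all lengths, so that the cubes of every dimension are
  described by a single closed set.
\<close>

definition dynamical_cubes :: "('a::topological_space \<Rightarrow> 'a) \<Rightarrow> (bool list \<Rightarrow> 'a) set" where
  "dynamical_cubes T = closure {\<lambda>\<epsilon>. int_iterate T (cube_exponent a \<epsilon>) x | a x. True}"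

lemma cube_exponent_update:
  "cube_exponent (a(i := a i + n)) \<epsilon> = cube_exponent a \<epsilon> + (if \<epsilon> \<in> upper_facet i then n else 0)"
proof (induction \<epsilon> arbitrary: a i)
  case Nil
  then show ?case by (simp add: upper_facet_def)
next
  case (Cons e \<epsilon>)
  show ?case
  proof (cases i)
    case 0
    then show ?thesis by (simp add: upper_facet_def)
  next
    case (Suc j)
    have "(\<lambda>k. (a(i := a i + n)) (Suc k)) = (\<lambda>k. a (Suc k))(j := a (Suc j) + n)"
      by (auto simp: Suc fun_eq_iff)
    then show ?thesis
      using Cons.IH[of "\<lambda>k. a (Suc k)" j] by (auto simp: Suc upper_facet_def)
  qed
qed

lemma cube_exponent_zero: "cube_exponent (\<lambda>_. 0) \<epsilon> = 0"
  by (induction \<epsilon>) auto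

locale compact_system =
  fixes T :: "'a::metric_space \<Rightarrow> 'a"
  assumes compact_UNIV: "compact (UNIV :: 'a set)"
    and homeo: "homeomorphism UNIV UNIV T (inv_into UNIV T)"
begin

lemma T_inv: "T (inv_into UNIV T x) = x" "inv_into UNIV T (T x) = x"
  using homeo by (auto simp: homeomorphism_def)

lemma iterate_0: "int_iterate T 0 = id"
  by (simp add: int_iterate_def)

lemma iterate_Suc: "int_iterate T (n + 1) = T \<circ> int_iterate T n"
proof (cases "n \<ge> 0")
  case True
  then have "nat (n + 1) = Suc (nat n)" by simp
  then show ?thesis using True by (simp add: int_iterate_def)
next
  case False
  define k where "k = nat (- (n + 1))"
  have k: "nat (- n) = Suc k" "nat (- (n + 1)) = k"
    using False by (auto simp: k_def)
  show ?thesis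
  proof
    fix x
    have "T (inv_into UNIV T ((inv_into UNIV T ^^ k) x)) = (inv_into UNIV T ^^ k) x"
      by (rule T_inv)
    moreover have "int_iterate T (n + 1) x = (inv_into UNIV T ^^ k) x"
      using False k by (auto simp: int_iterate_def)
    ultimately show "int_iterate T (n + 1) x = (T \<circ> int_iterate T n) x"
      using False k by (simp add: int_iterate_def)
  qed
qed

lemma iterate_pred: "int_iterate T (n - 1) = inv_into UNIV T \<circ> int_iterate T n"
  using iterate_Suc[of "n - 1"] T_inv by (auto simp: fun_eq_iff)

lemma iterate_add: "int_iterate T (m + n) = int_iterate T m \<circ> int_iterate T n"
proof (induction m rule: int_induct[where k = 0])
  case base
  then show ?case by (simp add: iterate_0)
next
  case (step1 m)
  have "int_iterate T (m + 1 + n) = int_iterate T ((m + n) + 1)" by (simp add: ac_simps)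
  then show ?case
    unfolding iterate_Suc using step1 by (simp add: comp_assoc)
next
  case (step2 m)
  have "int_iterate T (m - 1 + n) = int_iterate T ((m + n) - 1)" by (simp add: algebra_simps)
  then show ?case
    unfolding iterate_pred using step2 by (simp add: comp_assoc)
qed

lemma T_continuous: "continuous_on UNIV T" "continuous_on UNIV (inv_into UNIV T)"
  using homeo by (simp_all add: homeomorphism_def)

lemma iterate_continuous: "continuous_on UNIV (int_iterate T n)"
proof (induction n rule: int_induct[where k = 0])
  case base
  then show ?case by (simp add: iterate_0 continuous_on_id)
next
  case (step1 n)
  show ?case
    unfolding iterate_Suc
    by (rule continuous_on_compose[OF step1(2) continuous_on_subset[OF T_continuous(1) subset_UNIV]])
next
  case (step2 n)
  show ?case
    unfolding iterate_pred
    by (rule continuous_on_compose[OF step2(2) continuous_on_subset[OF T_continuous(2) subset_UNIV]])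
qed

abbreviation E where "E \<equiv> enveloping_semigroup T"

lemma E_closed: "closed E"
  by (simp add: enveloping_semigroup_def)

lemma iterate_in_E: "int_iterate T n \<in> E"
  unfolding enveloping_semigroup_def by (rule subsetD[OF closure_subset rangeI])

lemma id_in_E: "id \<in> E"
  using iterate_in_E[of 0] by (simp add: iterate_0)

lemma E_induct:
  assumes "closed C" "\<And>n. int_iterate T n \<in> C" "u \<in> E"
  shows "u \<in> C"
  using closure_minimal[of "range (int_iterate T)" C] assms by (auto simp: enveloping_semigroup_def)

lemma continuous_comp_left:
  assumes "continuous_on UNIV (f :: 'a \<Rightarrow> 'a)"
  shows "continuous_on UNIV (\<lambda>h :: 'b \<Rightarrow> 'a. f \<circ> h)"
proof (rule continuous_on_coordinatewise_then_product)
  fix i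
  have "continuous_on UNIV (\<lambda>h :: 'b \<Rightarrow> 'a. f (h i))"
    by (rule continuous_on_compose2[OF assms continuous_on_product_coordinates]) simp
  then show "continuous_on UNIV (\<lambda>h :: 'b \<Rightarrow> 'a. (f \<circ> h) i)" by simp
qed

lemma E_mult:
  assumes u: "u \<in> E" and v: "v \<in> E"
  shows "u \<circ> v \<in> E"
proof -
  have "int_iterate T n \<circ> v \<in> E" for n
  proof -
    have "v \<in> (\<lambda>h. int_iterate T n \<circ> h) -` E"
      by (rule E_induct[OF closed_vimage_UNIV[OF continuous_comp_left[OF iterate_continuous] E_closed] _ v])
        (simp add: iterate_in_E flip: iterate_add)
    then show ?thesis by simp
  qed
  then have "u \<in> (\<lambda>h. h \<circ> v) -` E"
    by (intro E_induct[OF closed_vimage_UNIV[OF continuous_comp_right E_closed] _ u]) simp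
  then show ?thesis by simp
qed

definition face_stabilizer :: "bool list set \<Rightarrow> ('a \<Rightarrow> 'a) set" where
  "face_stabilizer A = {u. \<forall>z\<in>dynamical_cubes T. face_action A u z \<in> dynamical_cubes T}"

lemma face_stabilizer_closed: "closed (face_stabilizer A)"
proof -
  have cl: "closed (dynamical_cubes T)"
    by (simp add: dynamical_cubes_def)
  have "continuous_on UNIV (\<lambda>u. face_action A u z)" for z :: "bool list \<Rightarrow> 'a"
  proof (rule continuous_on_coordinatewise_then_product)
    fix \<epsilon>
    show "continuous_on UNIV (\<lambda>u. face_action A u z \<epsilon>)"
      by (cases "\<epsilon> \<in> A") (simp_all add: face_action_def continuous_on_product_coordinates)
  qed
  then have "closed ((\<lambda>u. face_action A u z) -` dynamical_cubes T)" for z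
    by (rule closed_vimage_UNIV[OF _ cl])
  moreover have "face_stabilizer A = (\<Inter>z\<in>dynamical_cubes T. (\<lambda>u. face_action A u z) -` dynamical_cubes T)"
    by (auto simp: face_stabilizer_def)
  ultimately show ?thesis by auto
qed

lemma face_stabilizer_mult:
  assumes "u \<in> face_stabilizer A" "v \<in> face_stabilizer A"
  shows "u \<circ> v \<in> face_stabilizer A"
proof -
  have "face_action A (u \<circ> v) z = face_action A u (face_action A v z)" for z
    by (auto simp: face_action_def)
  then show ?thesis
    using assms by (simp add: face_stabilizer_def)
qed

text \<open>
  The stabilizer is closed, which reduces the claim to iterates of \<open>T\<close>; these act continuously,
  which reduces it further to the points whose closure defines the cubes.
\<close>

lemma E_subset_face_stabilizer:
  assumes "\<And>n a x. \<exists>b y. face_action A (int_iterate T n) (\<lambda>\<epsilon>. int_iterate T (cube_exponent a \<epsilon>) x)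
      = (\<lambda>\<epsilon>. int_iterate T (cube_exponent b \<epsilon>) y)"
  shows "E \<subseteq> face_stabilizer A"
proof
  fix u assume u: "u \<in> E"
  show "u \<in> face_stabilizer A"
  proof (rule E_induct[OF face_stabilizer_closed _ u])
    fix n
    let ?f = "face_action A (int_iterate T n)"
    let ?X = "{\<lambda>\<epsilon>. int_iterate T (cube_exponent a \<epsilon>) x | a x. True}"
    have "continuous_on UNIV ?f"
    proof (rule continuous_on_coordinatewise_then_product)
      fix \<epsilon>
      show "continuous_on UNIV (\<lambda>z. ?f z \<epsilon>)"
        by (cases "\<epsilon> \<in> A") (simp_all add: face_action_def continuous_on_product_coordinates
            continuous_on_compose2[OF iterate_continuous continuous_on_product_coordinates])
    qed
    then have "closed (?f -` dynamical_cubes T)"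
      by (rule closed_vimage_UNIV) (simp add: dynamical_cubes_def)
    moreover have "?X \<subseteq> ?f -` dynamical_cubes T"
    proof
      fix z assume "z \<in> ?X"
      then obtain a x where z: "z = (\<lambda>\<epsilon>. int_iterate T (cube_exponent a \<epsilon>) x)"
        by blast
      obtain b y where "?f (\<lambda>\<epsilon>. int_iterate T (cube_exponent a \<epsilon>) x) = (\<lambda>\<epsilon>. int_iterate T (cube_exponent b \<epsilon>) y)"
        using assms by blast
      then have "?f (\<lambda>\<epsilon>. int_iterate T (cube_exponent a \<epsilon>) x) \<in> ?X" by blast
      then have "?f z \<in> dynamical_cubes T"
        unfolding dynamical_cubes_def z by (rule subsetD[OF closure_subset])
      then show "z \<in> ?f -` dynamical_cubes T"
        by simp
    qed
    ultimately have "dynamical_cubes T \<subseteq> ?f -` dynamical_cubes T"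
      unfolding dynamical_cubes_def[of T] by (intro closure_minimal)
    then show "int_iterate T n \<in> face_stabilizer A"
      by (auto simp: face_stabilizer_def)
  qed
qed

lemma iterate_apply: "int_iterate T m (int_iterate T n x) = int_iterate T (m + n) x"
  by (simp add: iterate_add)

text \<open>
  Applying \<open>T\<^sup>n\<close> on the facet changes the coefficient \<open>a i\<close> to \<open>a i + n\<close>.
\<close>

lemma E_upper_facet: "E \<subseteq> face_stabilizer (upper_facet i)"
proof (rule E_subset_face_stabilizer)
  fix n a x
  have "face_action (upper_facet i) (int_iterate T n) (\<lambda>\<epsilon>. int_iterate T (cube_exponent a \<epsilon>) x)
      = (\<lambda>\<epsilon>. int_iterate T (cube_exponent (a(i := a i + n)) \<epsilon>) x)"
    unfolding cube_exponent_update
    by (auto simp: face_action_def iterate_apply fun_eq_iff add.commute)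
  then show "\<exists>b y. face_action (upper_facet i) (int_iterate T n) (\<lambda>\<epsilon>. int_iterate T (cube_exponent a \<epsilon>) x)
      = (\<lambda>\<epsilon>. int_iterate T (cube_exponent b \<epsilon>) y)"
    by blast
qed

text \<open>
  Applying \<open>T\<^sup>n\<close> everywhere moves the base point, and the effect on the opposite facet is undone
  by changing one coefficient.
\<close>

lemma E_lower_facet: "E \<subseteq> face_stabilizer (- upper_facet i)"
proof (rule E_subset_face_stabilizer)
  fix n a x
  have "face_action (- upper_facet i) (int_iterate T n) (\<lambda>\<epsilon>. int_iterate T (cube_exponent a \<epsilon>) x)
      = (\<lambda>\<epsilon>. int_iterate T (cube_exponent (a(i := a i + (- n))) \<epsilon>) (int_iterate T n x))"
    unfolding cube_exponent_update
    by (auto simp: face_action_def iterate_apply fun_eq_iff add.commute)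
  then show "\<exists>b y. face_action (- upper_facet i) (int_iterate T n) (\<lambda>\<epsilon>. int_iterate T (cube_exponent a \<epsilon>) x)
      = (\<lambda>\<epsilon>. int_iterate T (cube_exponent b \<epsilon>) y)"
    by blast
qed

lemma constant_cube: "(\<lambda>\<epsilon>. x) \<in> dynamical_cubes T"
proof -
  have "(\<lambda>\<epsilon>. x) = (\<lambda>\<epsilon>. int_iterate T (cube_exponent (\<lambda>_. 0) \<epsilon>) x)"
    by (simp add: cube_exponent_zero iterate_0)
  then have "(\<lambda>\<epsilon>. x) \<in> {\<lambda>\<epsilon>. int_iterate T (cube_exponent a \<epsilon>) x | a x. True}"
    by blast
  then show ?thesis
    unfolding dynamical_cubes_def by (rule subsetD[OF closure_subset])
qed

end

lemma top_vertex_iff: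
  assumes "length \<epsilon> = n"
  shows "\<epsilon> = replicate n True \<longleftrightarrow> (\<forall>i<n. \<epsilon> \<in> upper_facet i)"
  using assms by (auto simp: list_eq_iff_nth_eq upper_facet_def)

text \<open>
  A weak form of the property that the last vertex of a \<open>(d + 1)\<close>-dimensional cube is a function of the
  other vertices.
\<close>

locale cube_rigid_system = compact_system +
  fixes d :: nat
  assumes rigid: "z \<in> dynamical_cubes T \<Longrightarrow>
      (\<And>\<epsilon>. length \<epsilon> = Suc d \<Longrightarrow> \<epsilon> \<noteq> replicate (Suc d) True \<Longrightarrow> z \<epsilon> = x) \<Longrightarrow>
      z (replicate (Suc d) True) = x"
begin

abbreviation EG where "EG \<equiv> enveloping_monoid T"

abbreviation ET where "ET \<equiv> enveloping_topology T"

text \<open>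
  Apply \<open>u\<close> to the constant cube \<open>x\<close> on one lower facet after the other. As \<open>u\<close> is idempotent, the
  values \<open>u x\<close> already obtained do not change, and in the end only the last vertex still has the
  value \<open>x\<close>; by rigidity it equals \<open>u x\<close>.
\<close>

lemma idempotent_eq_id:
  assumes u: "u \<in> E" "u \<circ> u = u"
  shows "u = id"
proof
  fix x
  have uu: "u (u y) = u y" for y
    using u(2) by (metis comp_apply)
  have "(\<lambda>\<epsilon>. if \<forall>i<k. \<epsilon> \<in> upper_facet i then x else u x) \<in> dynamical_cubes T" for k
  proof (induction k)
    case 0
    then show ?case by (simp add: constant_cube)
  next
    case (Suc k)
    have "u \<in> face_stabilizer (- upper_facet k)"
      using E_lower_facet u(1) by blast
    then have "face_action (- upper_facet k) u (\<lambda>\<epsilon>. if \<forall>i<k. \<epsilon> \<in> upper_facet i then x else u x) \<in> dynamical_cubes T"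
      using Suc by (simp add: face_stabilizer_def)
    moreover have "face_action (- upper_facet k) u (\<lambda>\<epsilon>. if \<forall>i<k. \<epsilon> \<in> upper_facet i then x else u x)
        = (\<lambda>\<epsilon>. if \<forall>i<Suc k. \<epsilon> \<in> upper_facet i then x else u x)"
      by (auto simp: face_action_def fun_eq_iff less_Suc_eq uu)
    ultimately show ?case by simp
  qed
  note cube = this[of "Suc d"]
  have eq: "(if \<forall>i<Suc d. replicate (Suc d) True \<in> upper_facet i then x else u x) = u x"
  proof (rule rigid[OF cube])
    fix \<epsilon> :: "bool list" assume "length \<epsilon> = Suc d" "\<epsilon> \<noteq> replicate (Suc d) True"
    then have "\<not> (\<forall>i<Suc d. \<epsilon> \<in> upper_facet i)"
      using top_vertex_iff[of \<epsilon> "Suc d"] by blast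
    then show "(if \<forall>i<Suc d. \<epsilon> \<in> upper_facet i then x else u x) = u x"
      by (simp only: if_False)
  qed
  have top: "\<forall>i<Suc d. replicate (Suc d) True \<in> upper_facet i"
    using top_vertex_iff[of "replicate (Suc d) True" "Suc d"] by simp
  show "u x = id x"
    using eq unfolding if_P[OF top] by simp
qed

text \<open>
  The closed subsemigroup \<open>S \<circ> u\<close> contains an idempotent, which can only be the identity.
\<close>

lemma closed_subsemigroup_inverse:
  assumes S: "closed S" "S \<subseteq> E" "\<And>u v. u \<in> S \<Longrightarrow> v \<in> S \<Longrightarrow> u \<circ> v \<in> S" and u: "u \<in> S"
  shows "\<exists>v\<in>S. v \<circ> u = id"
proof -
  have "compact S"
    using compact_Int_closed[OF compact_UNIV_fun[OF compact_UNIV] S(1)] by simp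
  then have "compact ((\<lambda>h. h \<circ> u) ` S)"
    by (rule compact_continuous_image[OF continuous_on_subset[OF continuous_comp_right], rotated]) simp
  then have cl: "closed ((\<lambda>h. h \<circ> u) ` S)"
    by (rule compact_imp_closed_fun)
  have ne: "(\<lambda>h. h \<circ> u) ` S \<noteq> {}"
    using u by blast
  have mult: "v \<circ> w \<in> (\<lambda>h. h \<circ> u) ` S" if "v \<in> (\<lambda>h. h \<circ> u) ` S" "w \<in> (\<lambda>h. h \<circ> u) ` S" for v w
  proof -
    obtain v' w' where vw: "v' \<in> S" "v = v' \<circ> u" "w' \<in> S" "w = w' \<circ> u" using \<open>v \<in> _\<close> \<open>w \<in> _\<close> by blast
    have "v \<circ> w = (v' \<circ> u \<circ> w') \<circ> u" using vw by (simp add: comp_assoc)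
    then show ?thesis using S(3)[OF S(3)[OF vw(1) u] vw(3)] by blast
  qed
  have "\<exists>e\<in>(\<lambda>h. h \<circ> u) ` S. e \<circ> e = e"
    by (rule exists_idempotent[OF compact_UNIV cl ne]) (rule mult)
  then obtain e where e: "e \<in> (\<lambda>h. h \<circ> u) ` S" "e \<circ> e = e"
    by (rule bexE)
  obtain v where v: "v \<in> S" "e = v \<circ> u"
    using e(1) by blast
  have "e \<in> E"
    unfolding v(2) by (rule E_mult[OF subsetD[OF S(2) v(1)] subsetD[OF S(2) u]])
  then have "e = id"
    using e(2) by (rule idempotent_eq_id)
  then have "v \<circ> u = id"
    using v(2) by simp
  then show ?thesis
    using v(1) by (rule bexI)
qed

lemma enveloping_monoid_simps [simp]:
  "carrier EG = E"
  "u \<otimes>\<^bsub>EG\<^esub> v = u \<circ> v"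
  "\<one>\<^bsub>EG\<^esub> = id"
  by (simp_all add: enveloping_monoid_def)

lemma enveloping_group: "group EG"
proof (rule groupI, unfold enveloping_monoid_simps)
  fix u v w assume uvw: "u \<in> E" "v \<in> E" "w \<in> E"
  show "u \<circ> v \<in> E" by (rule E_mult[OF uvw(1,2)])
  show "u \<circ> v \<circ> w = u \<circ> (v \<circ> w)" by (rule comp_assoc)
next
  fix u assume u: "u \<in> E"
  show "id \<circ> u = u" by simp
  show "\<exists>v\<in>E. v \<circ> u = id"
    by (rule closed_subsemigroup_inverse[OF E_closed order_refl _ u]) (rule E_mult)
qed (rule id_in_E)

sublocale G: group "EG"
  by (rule enveloping_group)

lemma E_inverse:
  assumes "u \<in> E"
  shows "u \<circ> inv\<^bsub>EG\<^esub> u = id" "inv\<^bsub>EG\<^esub> u \<circ> u = id"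
    "inv\<^bsub>EG\<^esub> u \<in> E"
proof -
  have u: "u \<in> carrier EG" using assms by simp
  show "u \<circ> inv\<^bsub>EG\<^esub> u = id" "inv\<^bsub>EG\<^esub> u \<circ> u = id"
    "inv\<^bsub>EG\<^esub> u \<in> E"
    using G.r_inv[OF u] G.l_inv[OF u] G.inv_closed[OF u] by (simp_all only: enveloping_monoid_simps)
qed

lemma closed_subsemigroup_subgroup:
  assumes S: "closed S" "S \<subseteq> E" "id \<in> S" "\<And>u v. u \<in> S \<Longrightarrow> v \<in> S \<Longrightarrow> u \<circ> v \<in> S"
  shows "subgroup S EG"
proof (rule G.subgroupI)
  fix u assume u: "u \<in> S"
  have "\<exists>v\<in>S. v \<circ> u = id"
    by (rule closed_subsemigroup_inverse[OF S(1,2) _ u]) (rule S(4))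
  then obtain v where v: "v \<in> S" "v \<circ> u = id"
    by (rule bexE)
  have "inv\<^bsub>EG\<^esub> u = v"
    by (rule G.inv_equality) (use v subsetD[OF S(2) u] subsetD[OF S(2) v(1)] in simp_all)
  then show "inv\<^bsub>EG\<^esub> u \<in> S"
    using v by simp
next
  show "S \<subseteq> carrier EG" "S \<noteq> {}"
    using S(2,3) by auto
  fix u v assume "u \<in> S" "v \<in> S"
  then show "u \<otimes>\<^bsub>EG\<^esub> v \<in> S"
    using S(4) by simp
qed

text \<open>
  The face has codimension \<open>j + 1\<close>, so that the index matches that of \<open>lower_central\<close>.
\<close>

definition stabilizer_group :: "nat \<Rightarrow> ('a \<Rightarrow> 'a) set" where
  "stabilizer_group j = E \<inter> face_stabilizer (\<Inter>i\<in>{..j}. upper_facet i)"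

lemma stabilizer_group_subgroup: "subgroup (stabilizer_group j) EG"
proof (rule closed_subsemigroup_subgroup)
  show "closed (stabilizer_group j)"
    unfolding stabilizer_group_def by (intro closed_Int E_closed face_stabilizer_closed)
  have "face_action A id z = z" for A :: "bool list set" and z :: "bool list \<Rightarrow> 'a"
    by (auto simp: face_action_def)
  then show "id \<in> stabilizer_group j"
    by (simp add: stabilizer_group_def face_stabilizer_def id_in_E)
qed (auto simp: stabilizer_group_def intro: E_mult face_stabilizer_mult)

lemma stabilizer_group_closedin: "closedin ET (stabilizer_group j)"
  unfolding enveloping_topology_def stabilizer_group_def
  by (rule closedin_closed_Int[OF face_stabilizer_closed])

text \<open>
  Let \<open>a\<close> act on a face \<open>A\<close> and \<open>b\<close> on a facet \<open>B\<close>. The commutator of these two actions is the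
  action of \<open>[a, b]\<close> on \<open>A \<inter> B\<close>, since everywhere else at least one of them is absent and the
  other cancels.
\<close>

lemma commutator_stabilizer:
  assumes a: "a \<in> stabilizer_group j" and b: "b \<in> E"
  shows "a \<circ> b \<circ> inv\<^bsub>EG\<^esub> a \<circ> inv\<^bsub>EG\<^esub> b \<in> stabilizer_group (Suc j)"
proof -
  let ?A = "\<Inter>i\<in>{..j}. upper_facet i" and ?B = "upper_facet (Suc j)"
  let ?a = "inv\<^bsub>EG\<^esub> a" and ?b = "inv\<^bsub>EG\<^esub> b"
  have aE: "a \<in> E" using a by (simp add: stabilizer_group_def)
  have a': "?a \<in> stabilizer_group j"
    by (rule subgroup.m_inv_closed[OF stabilizer_group_subgroup a])
  have inv: "a (?a y) = y" "b (?b y) = y" for y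
    using E_inverse(1)[OF aE] E_inverse(1)[OF b] by (metis comp_apply id_apply)+
  have stab: "face_action ?A a z \<in> dynamical_cubes T" "face_action ?A ?a z \<in> dynamical_cubes T"
    "face_action ?B b z \<in> dynamical_cubes T" "face_action ?B ?b z \<in> dynamical_cubes T"
    if "z \<in> dynamical_cubes T" for z
  proof -
    have "b \<in> face_stabilizer ?B" "?b \<in> face_stabilizer ?B"
      using E_upper_facet b E_inverse(3)[OF b] by blast+
    then show "face_action ?A a z \<in> dynamical_cubes T" "face_action ?A ?a z \<in> dynamical_cubes T"
      "face_action ?B b z \<in> dynamical_cubes T" "face_action ?B ?b z \<in> dynamical_cubes T"
      using a a' that by (simp_all add: stabilizer_group_def face_stabilizer_def)
  qed
  have split: "(\<Inter>i\<in>{..Suc j}. upper_facet i) = ?A \<inter> ?B"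
    by (auto simp: atMost_Suc)
  have "face_action (?A \<inter> ?B) (a \<circ> b \<circ> ?a \<circ> ?b) z
      = face_action ?A a (face_action ?B b (face_action ?A ?a (face_action ?B ?b z)))" for z
    by (rule ext) (simp add: face_action_def inv)
  then have "a \<circ> b \<circ> ?a \<circ> ?b \<in> face_stabilizer (?A \<inter> ?B)"
    using stab by (simp add: face_stabilizer_def)
  moreover have "a \<circ> b \<circ> ?a \<circ> ?b \<in> E"
    by (intro E_mult aE b E_inverse(3))
  ultimately show ?thesis
    by (simp add: stabilizer_group_def split)
qed

lemma top_lower_central_subset:
  "top_lower_central EG ET j \<subseteq> stabilizer_group j"
proof (induction j)
  case 0
  then show ?case
    using E_upper_facet[of 0] by (auto simp: stabilizer_group_def)
next
  case (Suc j)
  have "commutators EG (top_lower_central EG ET j)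
      (carrier EG) \<subseteq> stabilizer_group (Suc j)"
    using Suc commutator_stabilizer by (auto simp: commutators_def)
  then show ?case
    using stabilizer_group_subgroup stabilizer_group_closedin by (auto simp: closed_generate_def)
qed

text \<open>
  A face of codimension \<open>d + 1\<close> of a \<open>(d + 1)\<close>-dimensional cube is a single vertex, so \<open>u\<close> changes
  the constant cube \<open>x\<close> at this vertex only; by rigidity \<open>u x = x\<close>.
\<close>

lemma stabilizer_group_trivial: "stabilizer_group d \<subseteq> {id}"
proof
  fix u assume u: "u \<in> stabilizer_group d"
  have "u x = x" for x
  proof -
    let ?A = "\<Inter>i\<in>{..d}. upper_facet i"
    have A: "\<epsilon> \<in> ?A \<longleftrightarrow> \<epsilon> = replicate (Suc d) True" if "length \<epsilon> = Suc d" for \<epsilon>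
      using top_vertex_iff[OF that] by (auto simp: less_Suc_eq_le)
    have cube: "face_action ?A u (\<lambda>\<epsilon>. x) \<in> dynamical_cubes T"
      using u constant_cube by (simp add: stabilizer_group_def face_stabilizer_def)
    have "face_action ?A u (\<lambda>\<epsilon>. x) (replicate (Suc d) True) = x"
      by (rule rigid[OF cube]) (use A in \<open>auto simp: face_action_def\<close>)
    then show "u x = x"
      using A[of "replicate (Suc d) True"] by (simp add: face_action_def del: replicate.simps)
  qed
  then show "u \<in> {id}" by (auto simp: fun_eq_iff)
qed

lemma closed_generate_props:
  assumes "C \<subseteq> E"
  shows "subgroup (closed_generate EG ET C) EG"
    "C \<subseteq> closed_generate EG ET C"
proof -
  have "closedin ET E"
    by (simp add: enveloping_topology_def)
  then have "E \<in> {H. subgroup H EG \<and> closedin ET H \<and> C \<subseteq> H}"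
    using assms G.subgroup_self by simp
  then show "subgroup (closed_generate EG ET C) EG"
    unfolding closed_generate_def by (intro G.subgroups_Inter) auto
  show "C \<subseteq> closed_generate EG ET C"
    by (auto simp: closed_generate_def)
qed

lemma commutators_subset: "A \<subseteq> E \<Longrightarrow> commutators EG A E \<subseteq> E"
  using E_mult E_inverse(3) by (auto simp: commutators_def subset_iff)

lemma top_lower_central_subgroup:
  "subgroup (top_lower_central EG ET j) EG"
proof (induction j)
  case 0
  then show ?case using G.subgroup_self by simp
next
  case (Suc j)
  then show ?case
    using closed_generate_props(1)[OF commutators_subset] subgroup.subset[OF Suc] by simp
qed

lemma lower_central_subset:
  "lower_central EG j \<subseteq> top_lower_central EG ET j"
proof (induction j)
  case (Suc j)
  let ?L = "top_lower_central EG ET j"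
  have "commutators EG (lower_central EG j) E
      \<subseteq> commutators EG ?L E"
    using Suc by (auto simp: commutators_def)
  also have "\<dots> \<subseteq> closed_generate EG ET (commutators EG ?L E)"
    using subgroup.subset[OF top_lower_central_subgroup] by (intro closed_generate_props(2) commutators_subset) simp
  finally show ?case
    using G.generate_subgroup_incl[OF _ top_lower_central_subgroup[of "Suc j"]] by simp
qed simp

theorem enveloping_semigroup_nilpotent:
  "top_nilpotent_group d EG ET"
  "nilpotent_group d EG"
proof -
  have top: "top_lower_central EG ET d = {id}"
    using top_lower_central_subset[of d] stabilizer_group_trivial
      subgroup.one_closed[OF top_lower_central_subgroup[of d]] by auto
  then show "top_nilpotent_group d EG ET"
    using enveloping_group by (simp add: top_nilpotent_group_def enveloping_topology_def)
  have "id \<in> lower_central EG d"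
    by (cases d) (auto simp: id_in_E intro: generate.one[of "EG", simplified])
  then have "lower_central EG d = {id}"
    using lower_central_subset[of d] top by auto
  then show "nilpotent_group d EG"
    using enveloping_group by (simp add: nilpotent_group_def)
qed

end

section \<open>Systems of finite order are cube rigid\<close>

context compact_system
begin

lemma iterate_coset:
  fixes G :: "'g monoid" (structure)
  assumes G: "group G" and \<Gamma>: "\<Gamma> \<subseteq> carrier G" and t: "t \<in> carrier G"
    and \<rho>: "\<And>x. \<rho> x \<in> (\<lambda>g. g <# \<Gamma>) ` carrier G" "\<And>x. \<rho> (T x) = t <# \<rho> x"
    and w: "w \<in> carrier G" "\<rho> x = w <# \<Gamma>"
  shows "\<rho> (int_iterate T n x) = (t [^] n \<otimes> w) <# \<Gamma>"
proof -
  interpret group G by (rule G)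
  show ?thesis
  proof (induction n rule: int_induct[where k = 0])
    case base
    then show ?case using w by (simp add: iterate_0)
  next
    case (step1 n)
    have "\<rho> (int_iterate T (n + 1) x) = t <# ((t [^] n \<otimes> w) <# \<Gamma>)"
      unfolding iterate_Suc comp_apply \<rho>(2) step1(2) ..
    also have "\<dots> = (t \<otimes> (t [^] n \<otimes> w)) <# \<Gamma>"
      using t w(1) by (intro lcos_m_assoc \<Gamma>) auto
    also have "t \<otimes> (t [^] n \<otimes> w) = t [^] (n + 1) \<otimes> w"
      using t w(1) int_pow_mult[OF t, of 1 n] by (simp add: add.commute m_assoc)
    finally show ?case .
  next
    case (step2 n)
    define v where "v = int_iterate T (n - 1) x"
    have Tv: "T v = int_iterate T n x"
      unfolding v_def iterate_pred by (simp add: T_inv)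
    obtain v0 where v0: "v0 \<in> carrier G" "\<rho> v = v0 <# \<Gamma>"
      using \<rho>(1)[of v] by blast
    have "inv t <# (t <# (v0 <# \<Gamma>)) = inv t <# ((t [^] n \<otimes> w) <# \<Gamma>)"
      using \<rho>(2)[of v] step2(2) unfolding Tv v0(2) by simp
    then have "(inv t \<otimes> (t \<otimes> v0)) <# \<Gamma> = (inv t \<otimes> (t [^] n \<otimes> w)) <# \<Gamma>"
      using t w(1) v0(1) \<Gamma> by (simp add: lcos_m_assoc)
    moreover have "inv t \<otimes> (t \<otimes> v0) = v0"
      using t v0(1) by simp
    moreover have "inv t \<otimes> (t [^] n \<otimes> w) = t [^] (n - 1) \<otimes> w"
    proof -
      have "t [^] (n - 1) = t [^] (- 1 + n)" by (simp add: algebra_simps)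
      also have "\<dots> = inv t \<otimes> t [^] n"
        unfolding int_pow_mult[OF t] using t by (simp add: int_pow_neg)
      finally show ?thesis using t w(1) by (simp add: m_assoc)
    qed
    ultimately show ?case
      using v0(2) by (simp add: v_def)
  qed
qed

text \<open>
  Otherwise the open sets \<open>O1\<close> and \<open>O2\<close> of \<open>coset_cube_rigidity\<close>, pulled back to \<open>X\<close>, define
  a neighbourhood of \<open>z\<close> that contains no point \<open>\<epsilon> \<mapsto> T\<^sup>a\<^sup>\<cdot>\<^sup>\<epsilon> x'\<close>, although \<open>z\<close> is a limit of such
  points.
\<close>

lemma rigid_in_nilfactor:
  assumes d: "d \<ge> 1" and nil: "nilsystem TYPE('g) d Y S"
    and \<pi>: "continuous_map euclidean Y \<pi>" "\<And>x. \<pi> (T x) = S (\<pi> x)"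
    and z: "z \<in> dynamical_cubes T"
    and zx: "\<And>\<epsilon>. length \<epsilon> = Suc d \<Longrightarrow> \<epsilon> \<noteq> replicate (Suc d) True \<Longrightarrow> z \<epsilon> = x"
  shows "\<pi> (z (replicate (Suc d) True)) = \<pi> x"
proof (rule ccontr)
  let ?top = "replicate (Suc d) True"
  assume ne: "\<pi> (z ?top) \<noteq> \<pi> x"
  obtain G :: "'g monoid" and M \<Gamma> t where lie: "lie_group G M" and nilp: "nilpotent_group d G"
    and \<Gamma>: "subgroup \<Gamma> G" and disc: "subtopology (mtop M) \<Gamma> = discrete_topology \<Gamma>"
    and cpt: "compact_space (left_coset_space G (mtop M) \<Gamma>)" and t: "t \<in> carrier G"
    and conj: "conjugate_systems Y S (left_coset_space G (mtop M) \<Gamma>) (\<lambda>x. t <#\<^bsub>G\<^esub> x)"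
    using nil unfolding nilsystem_def by (elim exE conjE)
  interpret nss_topological_group G "mtop M"
    by (rule lie_group_nss_topological_group[OF lie])
  let ?C = "left_coset_space G (mtop M) \<Gamma>"
  have topC: "topspace ?C = (\<lambda>g. g <#\<^bsub>G\<^esub> \<Gamma>) ` carrier G"
    using quotient_imp_surjective_map[OF quotient_map_left_coset_space[OF topspace_eq]] topspace_eq by metis
  obtain h where h: "homeomorphic_map Y ?C h" "\<forall>y\<in>topspace Y. h (S y) = t <#\<^bsub>G\<^esub> h y"
    using conj unfolding conjugate_systems_def by (elim exE conjE)
  have \<pi>Y: "\<pi> x \<in> topspace Y" for x
    using continuous_map_image_subset_topspace[OF \<pi>(1)] by auto
  define \<rho> where "\<rho> x = h (\<pi> x)" for x
  have \<rho>_cont: "continuous_map euclidean ?C \<rho>"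
  proof -
    have "\<rho> = h \<circ> \<pi>" by (auto simp: \<rho>_def)
    then show ?thesis
      using continuous_map_compose[OF \<pi>(1) homeomorphic_imp_continuous_map[OF h(1)]] by simp
  qed
  have \<rho>C: "\<rho> x \<in> (\<lambda>g. g <#\<^bsub>G\<^esub> \<Gamma>) ` carrier G" for x
    using continuous_map_image_subset_topspace[OF \<rho>_cont] topC by auto
  have \<rho>T: "\<rho> (T x) = t <#\<^bsub>G\<^esub> \<rho> x" for x
    using h(2) \<pi>Y \<pi>(2) by (simp add: \<rho>_def)
  have "\<rho> (z ?top) \<noteq> \<rho> x"
    using ne \<pi>Y homeomorphic_imp_injective_map[OF h(1)] by (auto simp: \<rho>_def dest: inj_onD)
  moreover obtain g0 where g0: "g0 \<in> carrier G" "\<rho> x = g0 <#\<^bsub>G\<^esub> \<Gamma>"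
    using \<rho>C[of x] by blast
  moreover obtain y0 where y0: "y0 \<in> carrier G" "\<rho> (z ?top) = y0 <#\<^bsub>G\<^esub> \<Gamma>"
    using \<rho>C[of "z ?top"] by blast
  ultimately have ne': "g0 <#\<^bsub>G\<^esub> \<Gamma> \<noteq> y0 <#\<^bsub>G\<^esub> \<Gamma>"
    by simp
  obtain O1 O2 where O: "openin ?C O1" "openin ?C O2" "g0 <#\<^bsub>G\<^esub> \<Gamma> \<in> O1" "y0 <#\<^bsub>G\<^esub> \<Gamma> \<in> O2"
    and rigid: "\<forall>w\<in>carrier G. \<forall>a.
      (\<forall>\<epsilon>. length \<epsilon> = Suc d \<longrightarrow> \<epsilon> \<noteq> ?top \<longrightarrow> (t [^]\<^bsub>G\<^esub> cube_exponent a \<epsilon> \<otimes>\<^bsub>G\<^esub> w) <#\<^bsub>G\<^esub> \<Gamma> \<in> O1) \<longrightarrow>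
      (t [^]\<^bsub>G\<^esub> cube_exponent a ?top \<otimes>\<^bsub>G\<^esub> w) <#\<^bsub>G\<^esub> \<Gamma> \<notin> O2"
    using coset_cube_rigidity[OF d upper_central_eq_carrier[OF nilp] \<Gamma> disc cpt t g0(1) y0(1) ne']
    by (elim exE conjE)
  have U: "open (\<rho> -` O1)" "open (\<rho> -` O2)"
    using openin_continuous_map_preimage[OF \<rho>_cont O(1)] openin_continuous_map_preimage[OF \<rho>_cont O(2)]
    by (auto simp: vimage_def)
  let ?I = "{\<epsilon>. length \<epsilon> = Suc d \<and> \<epsilon> \<noteq> ?top}"
  have fin: "finite ?I"
    by (rule finite_subset[OF _ finite_lists_length_eq[of "UNIV :: bool set" "Suc d"]]) auto
  define W where "W = (\<Inter>\<epsilon>\<in>?I. (\<lambda>z. z \<epsilon>) -` (\<rho> -` O1)) \<inter> (\<lambda>z. z ?top) -` (\<rho> -` O2)"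
  have coord: "open ((\<lambda>z. z \<epsilon>) -` A)" if "open A" for \<epsilon> :: "bool list" and A :: "'a set"
    by (rule open_vimage[OF that continuous_on_product_coordinates])
  have "open W"
    unfolding W_def by (intro open_Int open_INT fin ballI coord U)
  moreover have "z \<in> W"
    using zx g0(2) y0(2) O(3,4) by (auto simp: W_def)
  ultimately obtain a x' where ax: "(\<lambda>\<epsilon>. int_iterate T (cube_exponent a \<epsilon>) x') \<in> W"
    using z open_Int_closure_eq_empty[of W "{\<lambda>\<epsilon>. int_iterate T (cube_exponent a \<epsilon>) x | a x. True}"]
    unfolding dynamical_cubes_def by blast
  obtain w where w: "w \<in> carrier G" "\<rho> x' = w <#\<^bsub>G\<^esub> \<Gamma>"
    using \<rho>C[of x'] by blast
  have it: "\<rho> (int_iterate T n x') = (t [^]\<^bsub>G\<^esub> n \<otimes>\<^bsub>G\<^esub> w) <#\<^bsub>G\<^esub> \<Gamma>" for n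
    by (rule iterate_coset[OF group_axioms subgroup.subset[OF \<Gamma>] t \<rho>C \<rho>T w])
  have 1: "(t [^]\<^bsub>G\<^esub> cube_exponent a \<epsilon> \<otimes>\<^bsub>G\<^esub> w) <#\<^bsub>G\<^esub> \<Gamma> \<in> O1" if "length \<epsilon> = Suc d" "\<epsilon> \<noteq> ?top" for \<epsilon>
  proof -
    have "\<rho> (int_iterate T (cube_exponent a \<epsilon>) x') \<in> O1"
      using ax that unfolding W_def by blast
    then show ?thesis unfolding it .
  qed
  have 2: "(t [^]\<^bsub>G\<^esub> cube_exponent a ?top \<otimes>\<^bsub>G\<^esub> w) <#\<^bsub>G\<^esub> \<Gamma> \<in> O2"
  proof -
    have "\<rho> (int_iterate T (cube_exponent a ?top) x') \<in> O2"
      using ax unfolding W_def by blast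
    then show ?thesis unfolding it .
  qed
  show False
    using rigid[rule_format, OF w(1) 1] 2 by blast
qed

end

text \<open>
  Maps to nilsystems separate points: the identity for a nilsystem, the coordinates for an
  inverse limit. So rigidity of the cubes can be tested in nilsystems.
\<close>

lemma system_of_order_cube_rigid:
  fixes T :: "'a::metric_space \<Rightarrow> 'a"
  assumes d: "d \<ge> 1" and sys: "system_of_order TYPE('g) d T"
  shows "cube_rigid_system T d"
proof -
  interpret compact_system T
    using sys by (unfold_locales) (auto simp: system_of_order_def minimal_system_def topological_dynamical_system_def)
  show ?thesis
  proof unfold_locales
    fix z x
    assume z: "z \<in> dynamical_cubes T"
      and zx: "\<And>\<epsilon>. length \<epsilon> = Suc d \<Longrightarrow> \<epsilon> \<noteq> replicate (Suc d) True \<Longrightarrow> z \<epsilon> = x"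
    let ?y = "z (replicate (Suc d) True)"
    consider (nil) "nilsystem TYPE('g) d euclidean T" | (lim) "inverse_limit_of_nilsystems TYPE('g) d euclidean T"
      using sys by (auto simp: system_of_order_def)
    then show "?y = x"
    proof cases
      case nil
      have "id ?y = id x"
        by (rule rigid_in_nilfactor[OF d nil _ _ z zx]) auto
      then show ?thesis by simp
    next
      case lim
      then obtain Y :: "nat \<Rightarrow> 'g set topology" and S p where nil: "\<forall>i. nilsystem TYPE('g) d (Y i) (S i)"
        and conj: "conjugate_systems euclidean T (inverse_limit_space Y p) (\<lambda>x i. S i (x i))"
        unfolding inverse_limit_of_nilsystems_def by (elim exE conjE)
      obtain h where h: "homeomorphic_map euclidean (inverse_limit_space Y p) h"
        "\<forall>x\<in>topspace euclidean. h (T x) = (\<lambda>i. S i (h x i))"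
        using conj unfolding conjugate_systems_def by (elim exE conjE)
      have "continuous_map euclidean (product_topology Y UNIV) h"
        using homeomorphic_imp_continuous_map[OF h(1)] unfolding inverse_limit_space_def
        by (rule continuous_map_into_fulltopology)
      then have cont: "continuous_map euclidean (Y i) (\<lambda>x. h x i)" for i
        using continuous_map_compose[OF _ continuous_map_product_projection[of i UNIV Y]] by (simp add: o_def)
      have "h ?y i = h x i" for i
        by (rule rigid_in_nilfactor[OF d nil[rule_format] cont _ z zx]) (use h(2) in auto)
      then have "h ?y = h x" by (rule ext)
      then show ?thesis
        using homeomorphic_imp_injective_map[OF h(1)] by (auto dest: inj_onD)
    qed
  qed
qed

theorem theorem1p1:
  fixes T :: "'a::metric_space \<Rightarrow> 'a" and d :: nat
  assumes "d \<ge> 1"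
    and "system_of_order TYPE('g) d T"
  shows "top_nilpotent_group d (enveloping_monoid T) (enveloping_topology T) \<and>
         nilpotent_group d (enveloping_monoid T)"
proof -
  interpret cube_rigid_system T d
    by (rule system_of_order_cube_rigid[OF assms])
  show ?thesis
    using enveloping_semigroup_nilpotent by blast
qed

end
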